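(* Let $\mathcal{C}$ be a cd-category with effect conditioning, let $G$ be a finite DAG with vertex set $V$, each vertex $X\in V$ being associated with an object of $\mathcal{C}$ (also denoted $X$), and let $\omega$ be a normalised state over $V$ which factorises according to $G$. Then for all pairwise disjoint subsets $Y,Z,W\subseteq V$: if $Y$ and $Z$ are d-separated by $W$ in $G$, then $(Y\perp\!\!\!\perp Z\mid W)_\omega$.
   Context: A cd-category is a symmetric monoidal category $(\mathcal{C},\otimes,I)$ (symmetry $\sigma$) in which every object $X$ carries $\Delta_X\colon X\to X\otimes X$ and $\epsilon_X\colon X\to I$ forming a commutative comonoid, compatible with the tensor ($\Delta_{X\otimes Y}=(\mathrm{id}\otimes\sigma\otimes\mathrm{id})\circ(\Delta_X\otimes\Delta_Y)$, $\epsilon_{X\otimes Y}=\epsilon_X\otimes\epsilon_Y$, $\Delta_I=\epsilon_I=\mathrm{id}_I$). A channel is $f\colon X\to Y$ with $\epsilon_Y\circ f=\epsilon_X$; a state $\omega\colon I\to X$ is normalised if $\epsilon_X\circ\omega=\mathrm{id}_I$. A partial channel is $f$ with $f=(f\otimes(\epsilon_Y\circ f))\circ\Delta_X$. Effect conditioning: $\mathcal{C}$ has (i) normalisation: a partial channel $\mathrm{norm}(f)$ for each $f\colon X\to Y$ with $f=(\mathrm{norm}(f)\otimes(\epsilon_Y\circ f))\circ\Delta_X$, $\mathrm{norm}(f)=f$ for partial channels $f$, $\mathrm{norm}(f\otimes g)=\mathrm{norm}(f)\otimes\mathrm{norm}(g)$, $\mathrm{norm}(\epsilon\circ f)=\epsilon\circ\mathrm{norm}(f)$,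 $\mathrm{norm}(f\circ\Delta_X)=\mathrm{norm}(f)\circ\Delta_X$ for $f\colon X\otimes X\to Y$; and (ii) cancellative caps: effects $\cap_X\colon X\otimes X\to I$ that are symmetric, satisfy $\cap_X\circ\Delta_X=\epsilon_X$, $(\cap_X\otimes\mathrm{id})\circ(\mathrm{id}\otimes\Delta_X)=(\mathrm{id}\otimes\cap_X)\circ(\Delta_X\otimes\mathrm{id})$, are compatible with $\otimes$ ($\cap_{X\otimes Y}=(\cap_X\otimes\cap_Y)\circ(\mathrm{id}\otimes\sigma\otimes\mathrm{id})$, $\cap_I=\mathrm{id}_I$), and such that $(\mathrm{id}_B\otimes\cap_X)\circ(f\otimes\mathrm{id}_X)=(\mathrm{id}_B\otimes\cap_X)\circ(g\otimes\mathrm{id}_X)$ implies $f=g$ for $f,g\colon A\to B\otimes X$. Conditionals: for $f\colon X\to Y\otimes Z$, $f|_Z:=\mathrm{norm}((\mathrm{id}_Y\otimes\cap_Z)\circ(f\otimes\mathrm{id}_Z))\colon X\otimes Z\to Y$. For a state $\omega$ over $V$ (i.e. of $\bigotimes_{X\in V}X$) and subsets $S\subseteq V$, $X_S=\bigotimes_{X\in S}X$, $\omega_S$ = marginal on $X_S$ (discard other factors), and for disjoint $S,T$, $\omega_{S|T}:=(\omega_{S\cup T})|_{X_T}\colon X_T\to X_S$. Conditional independence $(Y\perp\!\!\!\perp Z\mid W)_\omega$ means $\omega_{Y\cup Z|W}=(\omega_{Y|W}\otimes\omega_{Z|W})\circ\Delta_{X_W}$. Factorisation: $\omega$ factorises according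 to $G$ if there are channels $c_X\colon X_{\mathrm{Pa}(X)}\to X$ ($\mathrm{Pa}(X)$ = parents of $X$ in $G$) such that, for a topological ordering $X_1,\dots,X_n$ of $V$, with $\omega_0=\mathrm{id}_I$ and $\omega_k=(\mathrm{id}_{X_1\otimes\cdots\otimes X_{k-1}}\otimes(c_{X_k}\circ\pi_k))\circ\Delta_{X_1\otimes\cdots\otimes X_{k-1}}\circ\omega_{k-1}$, where $\pi_k\colon X_1\otimes\cdots\otimes X_{k-1}\to X_{\mathrm{Pa}(X_k)}$ discards the non-parents, one has $\omega=\omega_n$ (up to reordering factors). d-separation: a path (sequence of edges regardless of orientation) between two vertices is blocked by $W$ if it contains a chain $A\to M\to B$ or fork $A\leftarrow M\to B$ with $M\in W$, or a collider $A\to C\leftarrow B$ such that neither $C$ nor any descendant of $C$ is in $W$. $Y,Z$ are d-separated by $W$ if every path between a vertex of $Y$ and a vertex of $Z$ is blocked by $W$. *)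

theory Defs
  imports Main
begin

section \<open>Symmetric monoidal categories\<close>

record ('o, 'm) smc =
  Obj :: "'o set"
  Arr :: "'m set"
  Dom :: "'m \<Rightarrow> 'o"
  Cod :: "'m \<Rightarrow> 'o"
  ide :: "'o \<Rightarrow> 'm"  (\<open>\<i>\<d>\<index>\<close>)
  Comp :: "'m \<Rightarrow> 'm \<Rightarrow> 'm"  (infixr \<open>\<cdot>\<index>\<close> 65)
  unit_obj :: "'o"  (\<open>\<I>\<index>\<close>)
  tensor_obj :: "'o \<Rightarrow> 'o \<Rightarrow> 'o"  (infixr \<open>\<boxtimes>\<index>\<close> 75)
  tensor_arr :: "'m \<Rightarrow> 'm \<Rightarrow> 'm"  (infixr \<open>\<otimes>\<index>\<close> 70)
  associator :: "'o \<Rightarrow> 'o \<Rightarrow> 'o \<Rightarrow> 'm"  (\<open>\<alpha>\<index>\<close>)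
  associator_inv :: "'o \<Rightarrow> 'o \<Rightarrow> 'o \<Rightarrow> 'm"  (\<open>\<alpha>''\<index>\<close>)
  left_unitor :: "'o \<Rightarrow> 'm"  (\<open>\<l>\<index>\<close>)
  left_unitor_inv :: "'o \<Rightarrow> 'm"  (\<open>\<l>''\<index>\<close>)
  right_unitor :: "'o \<Rightarrow> 'm"  (\<open>\<r>\<index>\<close>)
  right_unitor_inv :: "'o \<Rightarrow> 'm"  (\<open>\<r>''\<index>\<close>)
  symmetry :: "'o \<Rightarrow> 'o \<Rightarrow> 'm"  (\<open>\<sigma>\<index>\<close>)

definition hom_set :: "('o, 'm, 'z) smc_scheme \<Rightarrow> 'o \<Rightarrow> 'o \<Rightarrow> 'm set"  (\<open>hom\<index>\<close>)
  where "hom\<^bsub>C\<^esub> X Y = {f \<in> Arr C. Dom C f = X \<and> Cod C f = Y}"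

locale symmetric_monoidal_category =
  fixes C :: "('o, 'm, 'z) smc_scheme" (structure)
  assumes dom_in: "f \<in> Arr C \<Longrightarrow> Dom C f \<in> Obj C"
    and cod_in: "f \<in> Arr C \<Longrightarrow> Cod C f \<in> Obj C"
    and ide_in: "X \<in> Obj C \<Longrightarrow> \<i>\<d> X \<in> hom X X"
    and comp_in: "\<lbrakk>f \<in> hom X Y; g \<in> hom Y Z\<rbrakk> \<Longrightarrow> g \<cdot> f \<in> hom X Z"
    and comp_assoc: "\<lbrakk>f \<in> hom X Y; g \<in> hom Y Z; h \<in> hom Z U\<rbrakk> \<Longrightarrow> (h \<cdot> g) \<cdot> f = h \<cdot> (g \<cdot> f)"
    and ide_left: "f \<in> hom X Y \<Longrightarrow> \<i>\<d> Y \<cdot> f = f"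
    and ide_right: "f \<in> hom X Y \<Longrightarrow> f \<cdot> \<i>\<d> X = f"
    and unit_in: "\<I> \<in> Obj C"
    and tensor_obj_in: "\<lbrakk>X \<in> Obj C; Y \<in> Obj C\<rbrakk> \<Longrightarrow> X \<boxtimes> Y \<in> Obj C"
    and tensor_arr_in: "\<lbrakk>f \<in> hom X Y; g \<in> hom X' Y'\<rbrakk> \<Longrightarrow> f \<otimes> g \<in> hom (X \<boxtimes> X') (Y \<boxtimes> Y')"
    and tensor_ide: "\<lbrakk>X \<in> Obj C; Y \<in> Obj C\<rbrakk> \<Longrightarrow> \<i>\<d> X \<otimes> \<i>\<d> Y = \<i>\<d> (X \<boxtimes> Y)"
    and tensor_comp: "\<lbrakk>f \<in> hom X Y; g \<in> hom Y Z; f' \<in> hom X' Y'; g' \<in> hom Y' Z'\<rbrakk>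
        \<Longrightarrow> (g \<cdot> f) \<otimes> (g' \<cdot> f') = (g \<otimes> g') \<cdot> (f \<otimes> f')"
    and associator_in: "\<lbrakk>X \<in> Obj C; Y \<in> Obj C; Z \<in> Obj C\<rbrakk>
        \<Longrightarrow> \<alpha> X Y Z \<in> hom ((X \<boxtimes> Y) \<boxtimes> Z) (X \<boxtimes> (Y \<boxtimes> Z))"
    and associator_inv_in: "\<lbrakk>X \<in> Obj C; Y \<in> Obj C; Z \<in> Obj C\<rbrakk>
        \<Longrightarrow> \<alpha>' X Y Z \<in> hom (X \<boxtimes> (Y \<boxtimes> Z)) ((X \<boxtimes> Y) \<boxtimes> Z)"
    and associator_iso: "\<lbrakk>X \<in> Obj C; Y \<in> Obj C; Z \<in> Obj C\<rbrakk>
        \<Longrightarrow> \<alpha>' X Y Z \<cdot> \<alpha> X Y Z = \<i>\<d> ((X \<boxtimes> Y) \<boxtimes> Z) \<and> \<alpha> X Y Z \<cdot> \<alpha>' X Y Z = \<i>\<d> (X \<boxtimes> (Y \<boxtimes> Z))"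
    and associator_natural: "\<lbrakk>f \<in> hom X X'; g \<in> hom Y Y'; h \<in> hom Z Z'\<rbrakk>
        \<Longrightarrow> \<alpha> X' Y' Z' \<cdot> ((f \<otimes> g) \<otimes> h) = (f \<otimes> (g \<otimes> h)) \<cdot> \<alpha> X Y Z"
    and left_unitor_in: "X \<in> Obj C \<Longrightarrow> \<l> X \<in> hom (\<I> \<boxtimes> X) X"
    and left_unitor_inv_in: "X \<in> Obj C \<Longrightarrow> \<l>' X \<in> hom X (\<I> \<boxtimes> X)"
    and left_unitor_iso: "X \<in> Obj C \<Longrightarrow> \<l>' X \<cdot> \<l> X = \<i>\<d> (\<I> \<boxtimes> X) \<and> \<l> X \<cdot> \<l>' X = \<i>\<d> X"
    and left_unitor_natural: "f \<in> hom X Y \<Longrightarrow> \<l> Y \<cdot> (\<i>\<d> \<I> \<otimes> f) = f \<cdot> \<l> X"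
    and right_unitor_in: "X \<in> Obj C \<Longrightarrow> \<r> X \<in> hom (X \<boxtimes> \<I>) X"
    and right_unitor_inv_in: "X \<in> Obj C \<Longrightarrow> \<r>' X \<in> hom X (X \<boxtimes> \<I>)"
    and right_unitor_iso: "X \<in> Obj C \<Longrightarrow> \<r>' X \<cdot> \<r> X = \<i>\<d> (X \<boxtimes> \<I>) \<and> \<r> X \<cdot> \<r>' X = \<i>\<d> X"
    and right_unitor_natural: "f \<in> hom X Y \<Longrightarrow> \<r> Y \<cdot> (f \<otimes> \<i>\<d> \<I>) = f \<cdot> \<r> X"
    and symmetry_in: "\<lbrakk>X \<in> Obj C; Y \<in> Obj C\<rbrakk> \<Longrightarrow> \<sigma> X Y \<in> hom (X \<boxtimes> Y) (Y \<boxtimes> X)"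
    and symmetry_involutive: "\<lbrakk>X \<in> Obj C; Y \<in> Obj C\<rbrakk> \<Longrightarrow> \<sigma> Y X \<cdot> \<sigma> X Y = \<i>\<d> (X \<boxtimes> Y)"
    and symmetry_natural: "\<lbrakk>f \<in> hom X X'; g \<in> hom Y Y'\<rbrakk>
        \<Longrightarrow> \<sigma> X' Y' \<cdot> (f \<otimes> g) = (g \<otimes> f) \<cdot> \<sigma> X Y"
    and pentagon: "\<lbrakk>X \<in> Obj C; Y \<in> Obj C; Z \<in> Obj C; U \<in> Obj C\<rbrakk>
        \<Longrightarrow> (\<i>\<d> X \<otimes> \<alpha> Y Z U) \<cdot> \<alpha> X (Y \<boxtimes> Z) U \<cdot> (\<alpha> X Y Z \<otimes> \<i>\<d> U)
          = \<alpha> X Y (Z \<boxtimes> U) \<cdot> \<alpha> (X \<boxtimes> Y) Z U"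
    and triangle: "\<lbrakk>X \<in> Obj C; Y \<in> Obj C\<rbrakk>
        \<Longrightarrow> (\<i>\<d> X \<otimes> \<l> Y) \<cdot> \<alpha> X \<I> Y = \<r> X \<otimes> \<i>\<d> Y"
    and hexagon: "\<lbrakk>X \<in> Obj C; Y \<in> Obj C; Z \<in> Obj C\<rbrakk>
        \<Longrightarrow> \<alpha> Y Z X \<cdot> \<sigma> X (Y \<boxtimes> Z) \<cdot> \<alpha> X Y Z
          = (\<i>\<d> Y \<otimes> \<sigma> X Z) \<cdot> \<alpha> Y X Z \<cdot> (\<sigma> X Y \<otimes> \<i>\<d> Z)"

text \<open>The map written \<open>id \<otimes> \<sigma> \<otimes> id\<close> in a strict category, of type
  \<open>(X \<otimes> Y) \<otimes> (Z \<otimes> U) \<rightarrow> (X \<otimes> Z) \<otimes> (Y \<otimes> U)\<close>.\<close>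

definition mid_swap :: "('o, 'm, 'z) smc_scheme \<Rightarrow> 'o \<Rightarrow> 'o \<Rightarrow> 'o \<Rightarrow> 'o \<Rightarrow> 'm"
  where "mid_swap C X Y Z U =
    \<alpha>'\<^bsub>C\<^esub> X Z (Y \<boxtimes>\<^bsub>C\<^esub> U) \<cdot>\<^bsub>C\<^esub>
    (\<i>\<d>\<^bsub>C\<^esub> X \<otimes>\<^bsub>C\<^esub> (\<alpha>\<^bsub>C\<^esub> Z Y U \<cdot>\<^bsub>C\<^esub> (\<sigma>\<^bsub>C\<^esub> Y Z \<otimes>\<^bsub>C\<^esub> \<i>\<d>\<^bsub>C\<^esub> U) \<cdot>\<^bsub>C\<^esub> \<alpha>'\<^bsub>C\<^esub> Y Z U)) \<cdot>\<^bsub>C\<^esub>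
    \<alpha>\<^bsub>C\<^esub> X Y (Z \<boxtimes>\<^bsub>C\<^esub> U)"


section \<open>cd-categories\<close>

record ('o, 'm) cd = "('o, 'm) smc" +
  copy :: "'o \<Rightarrow> 'm"  (\<open>\<Delta>\<index>\<close>)
  discard :: "'o \<Rightarrow> 'm"  (\<open>\<epsilon>\<index>\<close>)

locale cd_category = symmetric_monoidal_category C
  for C :: "('o, 'm, 'z) cd_scheme" (structure) +
  assumes copy_in: "X \<in> Obj C \<Longrightarrow> \<Delta> X \<in> hom X (X \<boxtimes> X)"
    and discard_in: "X \<in> Obj C \<Longrightarrow> \<epsilon> X \<in> hom X \<I>"
    and copy_assoc: "X \<in> Obj C
        \<Longrightarrow> \<alpha> X X X \<cdot> (\<Delta> X \<otimes> \<i>\<d> X) \<cdot> \<Delta> X = (\<i>\<d> X \<otimes> \<Delta> X) \<cdot> \<Delta> X"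
    and copy_comm: "X \<in> Obj C \<Longrightarrow> \<sigma> X X \<cdot> \<Delta> X = \<Delta> X"
    and copy_discard_left: "X \<in> Obj C \<Longrightarrow> \<l> X \<cdot> (\<epsilon> X \<otimes> \<i>\<d> X) \<cdot> \<Delta> X = \<i>\<d> X"
    and copy_discard_right: "X \<in> Obj C \<Longrightarrow> \<r> X \<cdot> (\<i>\<d> X \<otimes> \<epsilon> X) \<cdot> \<Delta> X = \<i>\<d> X"
    and copy_tensor: "\<lbrakk>X \<in> Obj C; Y \<in> Obj C\<rbrakk>
        \<Longrightarrow> \<Delta> (X \<boxtimes> Y) = mid_swap C X X Y Y \<cdot> (\<Delta> X \<otimes> \<Delta> Y)"
    and discard_tensor: "\<lbrakk>X \<in> Obj C; Y \<in> Obj C\<rbrakk>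
        \<Longrightarrow> \<epsilon> (X \<boxtimes> Y) = \<l> \<I> \<cdot> (\<epsilon> X \<otimes> \<epsilon> Y)"
    and copy_unit: "\<Delta> \<I> = \<l>' \<I>"
    and discard_unit: "\<epsilon> \<I> = \<i>\<d> \<I>"

definition is_channel :: "('o, 'm, 'z) cd_scheme \<Rightarrow> 'm \<Rightarrow> bool"
  where "is_channel C f \<longleftrightarrow> f \<in> Arr C \<and> \<epsilon>\<^bsub>C\<^esub> (Cod C f) \<cdot>\<^bsub>C\<^esub> f = \<epsilon>\<^bsub>C\<^esub> (Dom C f)"

definition is_partial_channel :: "('o, 'm, 'z) cd_scheme \<Rightarrow> 'm \<Rightarrow> bool"
  where "is_partial_channel C f \<longleftrightarrow> f \<in> Arr C \<and>
    f = \<r>\<^bsub>C\<^esub> (Cod C f) \<cdot>\<^bsub>C\<^esub> (f \<otimes>\<^bsub>C\<^esub> (\<epsilon>\<^bsub>C\<^esub> (Cod C f) \<cdot>\<^bsub>C\<^esub> f)) \<cdot>\<^bsub>C\<^esub> \<Delta>\<^bsub>C\<^esub> (Dom C f)"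

definition normalised_state :: "('o, 'm, 'z) cd_scheme \<Rightarrow> 'o \<Rightarrow> 'm \<Rightarrow> bool"
  where "normalised_state C X \<omega> \<longleftrightarrow>
    \<omega> \<in> hom\<^bsub>C\<^esub> \<I>\<^bsub>C\<^esub> X \<and> \<epsilon>\<^bsub>C\<^esub> X \<cdot>\<^bsub>C\<^esub> \<omega> = \<i>\<d>\<^bsub>C\<^esub> \<I>\<^bsub>C\<^esub>"


section \<open>Effect conditioning\<close>

record ('o, 'm) cd_ec = "('o, 'm) cd" +
  normalisation :: "'m \<Rightarrow> 'm"  (\<open>norm\<index>\<close>)
  cap_effect :: "'o \<Rightarrow> 'm"  (\<open>cap\<index>\<close>)

text \<open>\<open>cap_right C B X f : A \<otimes> X \<rightarrow> B\<close> is \<open>(id\<^sub>B \<otimes> cap\<^sub>X) \<circ> (f \<otimes> id\<^sub>X)\<close> for \<open>f : A \<rightarrow> B \<otimes> X\<close>.\<close>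

definition cap_right :: "('o, 'm, 'z) cd_ec_scheme \<Rightarrow> 'o \<Rightarrow> 'o \<Rightarrow> 'm \<Rightarrow> 'm"
  where "cap_right C B X f =
    \<r>\<^bsub>C\<^esub> B \<cdot>\<^bsub>C\<^esub> (\<i>\<d>\<^bsub>C\<^esub> B \<otimes>\<^bsub>C\<^esub> cap\<^bsub>C\<^esub> X) \<cdot>\<^bsub>C\<^esub> \<alpha>\<^bsub>C\<^esub> B X X \<cdot>\<^bsub>C\<^esub> (f \<otimes>\<^bsub>C\<^esub> \<i>\<d>\<^bsub>C\<^esub> X)"

text \<open>The axioms \<open>norm_left_unitor\<close> and \<open>norm_right_unitor\<close> are trivial in a strict category.
  They express that normalisation respects the identification of \<open>I \<otimes> Y\<close> and \<open>Y \<otimes> I\<close> with \<open>Y\<close>,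
  which is implicit in the usual strict notation: there, for instance, \<open>norm_tensor\<close> for an
  effect \<open>g\<close> is a statement about a morphism into \<open>Y\<close> and not into \<open>Y \<otimes> I\<close>.\<close>

locale effect_conditioning = cd_category C
  for C :: "('o, 'm, 'z) cd_ec_scheme" (structure) +
  assumes norm_in: "f \<in> hom X Y \<Longrightarrow> norm f \<in> hom X Y"
    and norm_partial_channel: "f \<in> Arr C \<Longrightarrow> is_partial_channel C (norm f)"
    and norm_factor: "f \<in> hom X Y \<Longrightarrow> f = \<r> Y \<cdot> (norm f \<otimes> (\<epsilon> Y \<cdot> f)) \<cdot> \<Delta> X"
    and norm_of_partial_channel: "is_partial_channel C f \<Longrightarrow> norm f = f"
    and norm_tensor: "\<lbrakk>f \<in> Arr C; g \<in> Arr C\<rbrakk> \<Longrightarrow> norm (f \<otimes> g) = norm f \<otimes> norm g"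
    and norm_discard: "f \<in> hom X Y \<Longrightarrow> norm (\<epsilon> Y \<cdot> f) = \<epsilon> Y \<cdot> norm f"
    and norm_copy: "\<lbrakk>X \<in> Obj C; f \<in> hom (X \<boxtimes> X) Y\<rbrakk> \<Longrightarrow> norm (f \<cdot> \<Delta> X) = norm f \<cdot> \<Delta> X"
    and norm_left_unitor: "\<lbrakk>Y \<in> Obj C; f \<in> hom X (\<I> \<boxtimes> Y)\<rbrakk> \<Longrightarrow> norm (\<l> Y \<cdot> f) = \<l> Y \<cdot> norm f"
    and norm_right_unitor: "\<lbrakk>Y \<in> Obj C; f \<in> hom X (Y \<boxtimes> \<I>)\<rbrakk> \<Longrightarrow> norm (\<r> Y \<cdot> f) = \<r> Y \<cdot> norm f"
    and cap_in: "X \<in> Obj C \<Longrightarrow> cap X \<in> hom (X \<boxtimes> X) \<I>"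
    and cap_symmetric: "X \<in> Obj C \<Longrightarrow> cap X \<cdot> \<sigma> X X = cap X"
    and cap_copy: "X \<in> Obj C \<Longrightarrow> cap X \<cdot> \<Delta> X = \<epsilon> X"
    and cap_copy_slide: "X \<in> Obj C
        \<Longrightarrow> \<l> X \<cdot> (cap X \<otimes> \<i>\<d> X) \<cdot> \<alpha>' X X X \<cdot> (\<i>\<d> X \<otimes> \<Delta> X)
          = \<r> X \<cdot> (\<i>\<d> X \<otimes> cap X) \<cdot> \<alpha> X X X \<cdot> (\<Delta> X \<otimes> \<i>\<d> X)"
    and cap_tensor: "\<lbrakk>X \<in> Obj C; Y \<in> Obj C\<rbrakk>
        \<Longrightarrow> cap (X \<boxtimes> Y) = \<l> \<I> \<cdot> (cap X \<otimes> cap Y) \<cdot> mid_swap C X Y X Y"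
    and cap_unit: "cap \<I> = \<l> \<I>"
    and cap_cancellative: "\<lbrakk>A \<in> Obj C; B \<in> Obj C; X \<in> Obj C; f \<in> hom A (B \<boxtimes> X);
        g \<in> hom A (B \<boxtimes> X); cap_right C B X f = cap_right C B X g\<rbrakk> \<Longrightarrow> f = g"

definition conditional :: "('o, 'm, 'z) cd_ec_scheme \<Rightarrow> 'o \<Rightarrow> 'o \<Rightarrow> 'm \<Rightarrow> 'm"
  where "conditional C Y Z f = norm\<^bsub>C\<^esub> (cap_right C Y Z f)"

definition state_conditional :: "('o, 'm, 'z) cd_ec_scheme \<Rightarrow> 'o \<Rightarrow> 'o \<Rightarrow> 'm \<Rightarrow> 'm"
  where "state_conditional C Y Z \<omega> = conditional C Y Z \<omega> \<cdot>\<^bsub>C\<^esub> \<l>'\<^bsub>C\<^esub> Z"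


section \<open>Tensor products of families of objects\<close>

text \<open>A family of objects \<open>ob v\<close>, with \<open>v\<close> ranging over a finite set, is tensored along a
  duplicate-free list enumerating the set. Tensors are nested to the left and lists are read from
  right to left: \<open>tensor_list C ob [v\<^sub>n, \<dots>, v\<^sub>1] = ((I \<otimes> ob v\<^sub>1) \<otimes> \<dots>) \<otimes> ob v\<^sub>n\<close>.\<close>

primrec tensor_list :: "('o, 'm, 'z) smc_scheme \<Rightarrow> ('v \<Rightarrow> 'o) \<Rightarrow> 'v list \<Rightarrow> 'o" where
  "tensor_list C ob [] = \<I>\<^bsub>C\<^esub>"
| "tensor_list C ob (x # xs) = tensor_list C ob xs \<boxtimes>\<^bsub>C\<^esub> ob x"

text \<open>For \<open>y\<close> occurring in \<open>xs\<close>, \<open>extract_factor C ob y xs\<close> uses symmetries to move the factor \<open>y\<close> to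
  the last position:
  \<open>tensor_list C ob xs \<rightarrow> tensor_list C ob (remove1 y xs) \<otimes> ob y\<close>.\<close>

primrec extract_factor :: "('o, 'm, 'z) smc_scheme \<Rightarrow> ('v \<Rightarrow> 'o) \<Rightarrow> 'v \<Rightarrow> 'v list \<Rightarrow> 'm" where
  "extract_factor C ob y [] = undefined"
| "extract_factor C ob y (x # xs) =
    (if x = y then \<i>\<d>\<^bsub>C\<^esub> (tensor_list C ob (x # xs))
     else let R = tensor_list C ob (remove1 y xs) in
       \<alpha>'\<^bsub>C\<^esub> R (ob x) (ob y) \<cdot>\<^bsub>C\<^esub> (\<i>\<d>\<^bsub>C\<^esub> R \<otimes>\<^bsub>C\<^esub> \<sigma>\<^bsub>C\<^esub> (ob y) (ob x)) \<cdot>\<^bsub>C\<^esub> \<alpha>\<^bsub>C\<^esub> R (ob y) (ob x) \<cdot>\<^bsub>C\<^esub>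
       (extract_factor C ob y xs \<otimes>\<^bsub>C\<^esub> \<i>\<d>\<^bsub>C\<^esub> (ob x)))"

text \<open>For duplicate-free \<open>xs\<close>, \<open>ys\<close> with \<open>set ys \<subseteq> set xs\<close>, \<open>rearrange C ob ys xs\<close> discards the
  factors of \<open>xs\<close> not in \<open>ys\<close> and permutes the remaining ones into the order of \<open>ys\<close>:
  \<open>tensor_list C ob xs \<rightarrow> tensor_list C ob ys\<close>. If \<open>set ys = set xs\<close> this is a pure reordering.\<close>

primrec rearrange :: "('o, 'm, 'z) cd_scheme \<Rightarrow> ('v \<Rightarrow> 'o) \<Rightarrow> 'v list \<Rightarrow> 'v list \<Rightarrow> 'm" where
  "rearrange C ob [] xs = \<epsilon>\<^bsub>C\<^esub> (tensor_list C ob xs)"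
| "rearrange C ob (y # ys) xs =
    (rearrange C ob ys (remove1 y xs) \<otimes>\<^bsub>C\<^esub> \<i>\<d>\<^bsub>C\<^esub> (ob y)) \<cdot>\<^bsub>C\<^esub> extract_factor C ob y xs"

text \<open>The rebracketing isomorphism
  \<open>tensor_list C ob (ys @ xs) \<rightarrow> tensor_list C ob xs \<otimes> tensor_list C ob ys\<close>.\<close>

primrec split_tensor :: "('o, 'm, 'z) smc_scheme \<Rightarrow> ('v \<Rightarrow> 'o) \<Rightarrow> 'v list \<Rightarrow> 'v list \<Rightarrow> 'm" where
  "split_tensor C ob xs [] = \<r>'\<^bsub>C\<^esub> (tensor_list C ob xs)"
| "split_tensor C ob xs (y # ys) =
    \<alpha>\<^bsub>C\<^esub> (tensor_list C ob xs) (tensor_list C ob ys) (ob y) \<cdot>\<^bsub>C\<^esub>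
    (split_tensor C ob xs ys \<otimes>\<^bsub>C\<^esub> \<i>\<d>\<^bsub>C\<^esub> (ob y))"

text \<open>In what follows \<open>vs\<close> enumerates the set \<open>V\<close> of all vertices, and \<open>restrict_list vs S\<close> is the
  induced enumeration of \<open>S \<subseteq> V\<close>; the object \<open>X\<^sub>S\<close> is \<open>tensor_set C ob vs S\<close>.\<close>

definition restrict_list :: "'v list \<Rightarrow> 'v set \<Rightarrow> 'v list"
  where "restrict_list vs S = filter (\<lambda>v. v \<in> S) vs"

definition tensor_set :: "('o, 'm, 'z) smc_scheme \<Rightarrow> ('v \<Rightarrow> 'o) \<Rightarrow> 'v list \<Rightarrow> 'v set \<Rightarrow> 'o"
  where "tensor_set C ob vs S = tensor_list C ob (restrict_list vs S)"


section \<open>Conditional independence\<close>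

text \<open>Marginals of a state over \<open>vs\<close> on disjoint sets of vertices, as states of \<open>X\<^sub>S \<otimes> X\<^sub>T\<close> and
  of \<open>(X\<^sub>Y \<otimes> X\<^sub>Z) \<otimes> X\<^sub>W\<close>.\<close>

definition marginal2 ::
  "('o, 'm, 'z) cd_scheme \<Rightarrow> ('v \<Rightarrow> 'o) \<Rightarrow> 'v list \<Rightarrow> 'v set \<Rightarrow> 'v set \<Rightarrow> 'm \<Rightarrow> 'm"
  where "marginal2 C ob vs S T \<omega> =
    (let ss = restrict_list vs S; ts = restrict_list vs T in
      split_tensor C ob ss ts \<cdot>\<^bsub>C\<^esub> rearrange C ob (ts @ ss) vs \<cdot>\<^bsub>C\<^esub> \<omega>)"

definition marginal3 ::
  "('o, 'm, 'z) cd_scheme \<Rightarrow> ('v \<Rightarrow> 'o) \<Rightarrow> 'v list \<Rightarrow> 'v set \<Rightarrow> 'v set \<Rightarrow> 'v set \<Rightarrow> 'm \<Rightarrow> 'm"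
  where "marginal3 C ob vs Y Z W \<omega> =
    (let ys = restrict_list vs Y; zs = restrict_list vs Z; ws = restrict_list vs W in
      (split_tensor C ob ys zs \<otimes>\<^bsub>C\<^esub> \<i>\<d>\<^bsub>C\<^esub> (tensor_list C ob ws)) \<cdot>\<^bsub>C\<^esub>
      split_tensor C ob (zs @ ys) ws \<cdot>\<^bsub>C\<^esub> rearrange C ob (ws @ zs @ ys) vs \<cdot>\<^bsub>C\<^esub> \<omega>)"

text \<open>\<open>cond_dist C ob vs \<omega> S T : X\<^sub>T \<rightarrow> X\<^sub>S\<close> is the conditional of the marginal on \<open>S \<union> T\<close> given \<open>T\<close>.
  For a disjoint union \<open>S = Y \<union> Z\<close> the object \<open>X\<^sub>S\<close> is taken to be \<open>X\<^sub>Y \<otimes> X\<^sub>Z\<close>, the reading required by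
  the equation that defines conditional independence; this is \<open>cond_dist_pair\<close>. The factors are
  put in this order before normalising.\<close>

definition cond_dist ::
  "('o, 'm, 'z) cd_ec_scheme \<Rightarrow> ('v \<Rightarrow> 'o) \<Rightarrow> 'v list \<Rightarrow> 'm \<Rightarrow> 'v set \<Rightarrow> 'v set \<Rightarrow> 'm"
  where "cond_dist C ob vs \<omega> S T =
    state_conditional C (tensor_set C ob vs S) (tensor_set C ob vs T) (marginal2 C ob vs S T \<omega>)"

definition cond_dist_pair ::
  "('o, 'm, 'z) cd_ec_scheme \<Rightarrow> ('v \<Rightarrow> 'o) \<Rightarrow> 'v list \<Rightarrow> 'm \<Rightarrow> 'v set \<Rightarrow> 'v set \<Rightarrow> 'v set \<Rightarrow> 'm"
  where "cond_dist_pair C ob vs \<omega> Y Z W =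
    state_conditional C (tensor_set C ob vs Y \<boxtimes>\<^bsub>C\<^esub> tensor_set C ob vs Z) (tensor_set C ob vs W)
      (marginal3 C ob vs Y Z W \<omega>)"

definition cond_indep ::
  "('o, 'm, 'z) cd_ec_scheme \<Rightarrow> ('v \<Rightarrow> 'o) \<Rightarrow> 'v list \<Rightarrow> 'm \<Rightarrow> 'v set \<Rightarrow> 'v set \<Rightarrow> 'v set \<Rightarrow> bool"
  where "cond_indep C ob vs \<omega> Y Z W \<longleftrightarrow>
    cond_dist_pair C ob vs \<omega> Y Z W =
    (cond_dist C ob vs \<omega> Y W \<otimes>\<^bsub>C\<^esub> cond_dist C ob vs \<omega> Z W) \<cdot>\<^bsub>C\<^esub> \<Delta>\<^bsub>C\<^esub> (tensor_set C ob vs W)"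


section \<open>Directed acyclic graphs\<close>

definition finite_dag :: "'v set \<Rightarrow> ('v \<times> 'v) set \<Rightarrow> bool"
  where "finite_dag V E \<longleftrightarrow> finite V \<and> E \<subseteq> V \<times> V \<and> acyclic E"

definition parents :: "('v \<times> 'v) set \<Rightarrow> 'v \<Rightarrow> 'v set"
  where "parents E v = {u. (u, v) \<in> E}"

definition topological_ordering :: "'v set \<Rightarrow> ('v \<times> 'v) set \<Rightarrow> 'v list \<Rightarrow> bool"
  where "topological_ordering V E xs \<longleftrightarrow>
    distinct xs \<and> set xs = V \<and> sorted_wrt (\<lambda>x y. (y, x) \<notin> E) xs"

text \<open>The states \<open>\<omega>\<^sub>k\<close> for the list \<open>[X\<^sub>k, \<dots>, X\<^sub>1]\<close>, a reversed initial segment of a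
  topological ordering.\<close>

primrec network_state ::
  "('o, 'm, 'z) cd_scheme \<Rightarrow> ('v \<Rightarrow> 'o) \<Rightarrow> ('v \<times> 'v) set \<Rightarrow> 'v list \<Rightarrow> ('v \<Rightarrow> 'm) \<Rightarrow> 'v list \<Rightarrow> 'm"
where
  "network_state C ob E vs c [] = \<i>\<d>\<^bsub>C\<^esub> \<I>\<^bsub>C\<^esub>"
| "network_state C ob E vs c (x # xs) =
    (let A = tensor_list C ob xs in
      (\<i>\<d>\<^bsub>C\<^esub> A \<otimes>\<^bsub>C\<^esub> (c x \<cdot>\<^bsub>C\<^esub> rearrange C ob (restrict_list vs (parents E x)) xs)) \<cdot>\<^bsub>C\<^esub>
      \<Delta>\<^bsub>C\<^esub> A \<cdot>\<^bsub>C\<^esub> network_state C ob E vs c xs)"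

definition factorises ::
  "('o, 'm, 'z) cd_scheme \<Rightarrow> ('v \<Rightarrow> 'o) \<Rightarrow> 'v set \<Rightarrow> ('v \<times> 'v) set \<Rightarrow> 'v list \<Rightarrow> 'm \<Rightarrow> bool"
  where "factorises C ob V E vs \<omega> \<longleftrightarrow>
    (\<exists>c xs.
      (\<forall>v\<in>V. is_channel C (c v) \<and> c v \<in> hom\<^bsub>C\<^esub> (tensor_set C ob vs (parents E v)) (ob v)) \<and>
      topological_ordering V E xs \<and>
      \<omega> = rearrange C ob vs (rev xs) \<cdot>\<^bsub>C\<^esub> network_state C ob E vs c (rev xs))"

text \<open>In a directed acyclic graph given by a relation, a sequence of adjacent vertices determines
  the edges between them. As usual, paths do not repeat vertices.\<close>

definition undirected_path :: "('v \<times> 'v) set \<Rightarrow> 'v list \<Rightarrow> bool"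
  where "undirected_path E p \<longleftrightarrow>
    p \<noteq> [] \<and> distinct p \<and> successively (\<lambda>a b. (a, b) \<in> E \<or> (b, a) \<in> E) p"

definition chain_or_fork :: "('v \<times> 'v) set \<Rightarrow> 'v \<Rightarrow> 'v \<Rightarrow> 'v \<Rightarrow> bool"
  where "chain_or_fork E a m b \<longleftrightarrow>
    (a, m) \<in> E \<and> (m, b) \<in> E \<or> (b, m) \<in> E \<and> (m, a) \<in> E \<or> (m, a) \<in> E \<and> (m, b) \<in> E"

definition collider :: "('v \<times> 'v) set \<Rightarrow> 'v \<Rightarrow> 'v \<Rightarrow> 'v \<Rightarrow> bool"
  where "collider E a m b \<longleftrightarrow> (a, m) \<in> E \<and> (b, m) \<in> E"

definition blocked :: "('v \<times> 'v) set \<Rightarrow> 'v set \<Rightarrow> 'v list \<Rightarrow> bool"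
  where "blocked E W p \<longleftrightarrow>
    (\<exists>i. i + 2 < length p \<and>
      (chain_or_fork E (p ! i) (p ! (i + 1)) (p ! (i + 2)) \<and> p ! (i + 1) \<in> W \<or>
       collider E (p ! i) (p ! (i + 1)) (p ! (i + 2)) \<and> (\<forall>d. (p ! (i + 1), d) \<in> E\<^sup>* \<longrightarrow> d \<notin> W)))"

definition d_separated :: "('v \<times> 'v) set \<Rightarrow> 'v set \<Rightarrow> 'v set \<Rightarrow> 'v set \<Rightarrow> bool"
  where "d_separated E Y Z W \<longleftrightarrow>
    (\<forall>p. undirected_path E p \<and> hd p \<in> Y \<and> last p \<in> Z \<longrightarrow> blocked E W p)"

end

theory Submission
  imports Defs
begin

text \<open>
  A copyable and discardable morphism is called deterministic. Every structural morphism acts on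
  pairs \<open>\<langle>f, g\<rangle> = (f \<otimes> g) \<cdot> \<Delta>\<close> of arbitrary morphisms in the obvious way, and the deterministic
  morphisms form a cartesian category, so coherence questions reduce to comparing projections.

  Let \<open>W\<close> d-separate \<open>Y\<close> and \<open>Z\<close>. The ancestors of \<open>Y \<union> Z \<union> W\<close> outside \<open>W\<close> split into
  \<open>A \<supseteq> Y\<close> and \<open>B \<supseteq> Z\<close> such that the parents of a vertex in \<open>A\<close> lie in \<open>A \<union> W\<close>, those of a vertex
  in \<open>B\<close> lie in \<open>B \<union> W\<close>, and those of a vertex in \<open>W\<close> lie in one of the two sets. Capping off the
  factors in \<open>W\<close> turns the state of the network into a morphism \<open>X\<^sub>W \<rightarrow> X\<^sub>A \<otimes> X\<^sub>B\<close>. In the presence of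
  a cap, an observed factor may be replaced by the value fed into the cap, so adding the vertices
  one at a time in topological order preserves the shape \<open>\<langle>\<phi>, \<psi>\<rangle>\<close> of this morphism: a new vertex
  changes only \<open>\<phi>\<close> or only \<open>\<psi>\<close>, and vertices outside \<open>A \<union> B \<union> W\<close> are discarded. Normalising
  \<open>\<langle>\<phi>, \<psi>\<rangle>\<close> and its two marginals gives the claim, because the domain weight of a partial channel is
  absorbed by the partial channel itself.
\<close>

text \<open>Arbitrary morphisms need not be copyable, so a map precomposed with a pair cannot in
  general be pushed into the components. Identities are therefore proved on projections and
  reordering maps, which are deterministic, and only afterwards is a state or a channel inserted.

  The induction runs on unnormalised conditionals because \<open>norm\<close> is assumed to respect
  tensors, copying and discarding, but not composition, and so cannot follow the growth of the
  network. An unnormalised product survives each step: an unobserved vertex extends one component,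
  an observed one weights one component by an effect. Normalisation happens once, at the end.

  The two sides come from walks. Call a vertex reached if some walk from \<open>Z\<close> to it is
  not blocked by \<open>W\<close>; \<open>B\<close> consists of the reached ancestors outside
  \<open>W\<close>, and \<open>A\<close> of the unreached ones. Since d-separation speaks of paths
  without repetition, loops have to be cut out of walks to see that \<open>Y\<close> is unreached.
  Only ancestors are divided, because a collider with no descendant in \<open>W\<close> may have
  parents on both sides.\<close>

section \<open>Symmetric monoidal categories\<close>

context symmetric_monoidal_category
begin

section \<open>Typing and rewriting rules for composites\<close>

lemma hom_iff: "f \<in> hom X Y \<longleftrightarrow> f \<in> Arr C \<and> Dom C f = X \<and> Cod C f = Y"
  by (simp add: hom_set_def)

lemma comp_arr [simp]:
  assumes "f \<in> Arr C" "g \<in> Arr C" "Dom C g = Cod C f"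
  shows "g \<cdot> f \<in> Arr C" "Dom C (g \<cdot> f) = Dom C f" "Cod C (g \<cdot> f) = Cod C g"
  using comp_in[of f "Dom C f" "Cod C f" g "Cod C g"] assms by (simp_all add: hom_iff)

lemma ide_arr [simp]:
  assumes "X \<in> Obj C"
  shows "\<i>\<d> X \<in> Arr C" "Dom C (\<i>\<d> X) = X" "Cod C (\<i>\<d> X) = X"
  using ide_in[OF assms] by (simp_all add: hom_iff)

lemma tensor_arr [simp]:
  assumes "f \<in> Arr C" "g \<in> Arr C"
  shows "f \<otimes> g \<in> Arr C" "Dom C (f \<otimes> g) = Dom C f \<boxtimes> Dom C g" "Cod C (f \<otimes> g) = Cod C f \<boxtimes> Cod C g"
  using tensor_arr_in[of f "Dom C f" "Cod C f" g "Dom C g" "Cod C g"] assms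
  by (simp_all add: hom_iff)

lemma associator_arr [simp]:
  assumes "X \<in> Obj C" "Y \<in> Obj C" "Z \<in> Obj C"
  shows "\<alpha> X Y Z \<in> Arr C" "Dom C (\<alpha> X Y Z) = (X \<boxtimes> Y) \<boxtimes> Z" "Cod C (\<alpha> X Y Z) = X \<boxtimes> Y \<boxtimes> Z"
    "\<alpha>' X Y Z \<in> Arr C" "Dom C (\<alpha>' X Y Z) = X \<boxtimes> Y \<boxtimes> Z" "Cod C (\<alpha>' X Y Z) = (X \<boxtimes> Y) \<boxtimes> Z"
  using associator_in[OF assms] associator_inv_in[OF assms] by (simp_all add: hom_iff)

lemma unitor_arr [simp]:
  assumes "X \<in> Obj C"
  shows "\<l> X \<in> Arr C" "Dom C (\<l> X) = \<I> \<boxtimes> X" "Cod C (\<l> X) = X"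
    "\<l>' X \<in> Arr C" "Dom C (\<l>' X) = X" "Cod C (\<l>' X) = \<I> \<boxtimes> X"
    "\<r> X \<in> Arr C" "Dom C (\<r> X) = X \<boxtimes> \<I>" "Cod C (\<r> X) = X"
    "\<r>' X \<in> Arr C" "Dom C (\<r>' X) = X" "Cod C (\<r>' X) = X \<boxtimes> \<I>"
  using left_unitor_in[OF assms] left_unitor_inv_in[OF assms]
    right_unitor_in[OF assms] right_unitor_inv_in[OF assms] by (simp_all add: hom_iff)

lemma symmetry_arr [simp]:
  assumes "X \<in> Obj C" "Y \<in> Obj C"
  shows "\<sigma> X Y \<in> Arr C" "Dom C (\<sigma> X Y) = X \<boxtimes> Y" "Cod C (\<sigma> X Y) = Y \<boxtimes> X"
  using symmetry_in[OF assms] by (simp_all add: hom_iff)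

lemmas obj_closed [simp] = dom_in cod_in unit_in tensor_obj_in

lemma assoc [simp]:
  assumes "f \<in> Arr C" "g \<in> Arr C" "h \<in> Arr C" "Dom C g = Cod C f" "Dom C h = Cod C g"
  shows "(h \<cdot> g) \<cdot> f = h \<cdot> g \<cdot> f"
  using comp_assoc[of f _ _ g _ h] assms by (simp add: hom_iff)

lemma ide_comp [simp]:
  assumes "f \<in> Arr C"
  shows "Cod C f = X \<Longrightarrow> \<i>\<d> X \<cdot> f = f" "Dom C f = X \<Longrightarrow> f \<cdot> \<i>\<d> X = f"
  using assms ide_left[of f] ide_right[of f] by (simp_all add: hom_iff)

lemma interchange [simp]:
  assumes "f \<in> Arr C" "g \<in> Arr C" "f' \<in> Arr C" "g' \<in> Arr C"
    "Dom C g = Cod C f" "Dom C g' = Cod C f'"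
  shows "(g \<otimes> g') \<cdot> (f \<otimes> f') = (g \<cdot> f) \<otimes> (g' \<cdot> f')"
  using tensor_comp[of f _ _ g _ f' _ _ g'] assms by (simp add: hom_iff)

lemma comp_eqI:
  assumes "h \<cdot> g = k" "f \<in> Arr C" "g \<in> Arr C" "h \<in> Arr C" "Dom C g = Cod C f" "Dom C h = Cod C g"
  shows "h \<cdot> g \<cdot> f = k \<cdot> f"
  using assms assoc[of f g h] by simp

lemma comp_cong:
  assumes "h \<cdot> g = k \<cdot> m" "f \<in> Arr C" "g \<in> Arr C" "h \<in> Arr C" "k \<in> Arr C" "m \<in> Arr C"
    "Dom C g = Cod C f" "Dom C h = Cod C g" "Dom C m = Cod C f" "Dom C k = Cod C m"
  shows "h \<cdot> g \<cdot> f = k \<cdot> m \<cdot> f"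
  using assms assoc[of f g h] assoc[of f m k] by simp

lemma interchange' [simp]:
  assumes "f \<in> Arr C" "g \<in> Arr C" "f' \<in> Arr C" "g' \<in> Arr C" "h \<in> Arr C"
    "Dom C g = Cod C f" "Dom C g' = Cod C f'" "Cod C h = Dom C f \<boxtimes> Dom C f'"
  shows "(g \<otimes> g') \<cdot> (f \<otimes> f') \<cdot> h = ((g \<cdot> f) \<otimes> (g' \<cdot> f')) \<cdot> h"
  using assms by (intro comp_eqI) simp_all

lemmas [simp] = tensor_ide

lemma iso_cancel [simp]:
  assumes "X \<in> Obj C"
  shows "\<l>' X \<cdot> \<l> X = \<i>\<d> (\<I> \<boxtimes> X)" "\<l> X \<cdot> \<l>' X = \<i>\<d> X"
    "\<r>' X \<cdot> \<r> X = \<i>\<d> (X \<boxtimes> \<I>)" "\<r> X \<cdot> \<r>' X = \<i>\<d> X"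
    "Y \<in> Obj C \<Longrightarrow> \<sigma> Y X \<cdot> \<sigma> X Y = \<i>\<d> (X \<boxtimes> Y)"
    "\<lbrakk>Y \<in> Obj C; Z \<in> Obj C\<rbrakk> \<Longrightarrow> \<alpha>' X Y Z \<cdot> \<alpha> X Y Z = \<i>\<d> ((X \<boxtimes> Y) \<boxtimes> Z)"
    "\<lbrakk>Y \<in> Obj C; Z \<in> Obj C\<rbrakk> \<Longrightarrow> \<alpha> X Y Z \<cdot> \<alpha>' X Y Z = \<i>\<d> (X \<boxtimes> Y \<boxtimes> Z)"
  using assms associator_iso left_unitor_iso right_unitor_iso symmetry_involutive by simp_all

lemma iso_cancel' [simp]:
  assumes "f \<in> Arr C" "X \<in> Obj C"
  shows "Cod C f = \<I> \<boxtimes> X \<Longrightarrow> \<l>' X \<cdot> \<l> X \<cdot> f = f" "Cod C f = X \<Longrightarrow> \<l> X \<cdot> \<l>' X \<cdot> f = f"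
    "Cod C f = X \<boxtimes> \<I> \<Longrightarrow> \<r>' X \<cdot> \<r> X \<cdot> f = f" "Cod C f = X \<Longrightarrow> \<r> X \<cdot> \<r>' X \<cdot> f = f"
    "\<lbrakk>Y \<in> Obj C; Cod C f = X \<boxtimes> Y\<rbrakk> \<Longrightarrow> \<sigma> Y X \<cdot> \<sigma> X Y \<cdot> f = f"
    "\<lbrakk>Y \<in> Obj C; Z \<in> Obj C; Cod C f = (X \<boxtimes> Y) \<boxtimes> Z\<rbrakk> \<Longrightarrow> \<alpha>' X Y Z \<cdot> \<alpha> X Y Z \<cdot> f = f"
    "\<lbrakk>Y \<in> Obj C; Z \<in> Obj C; Cod C f = X \<boxtimes> Y \<boxtimes> Z\<rbrakk> \<Longrightarrow> \<alpha> X Y Z \<cdot> \<alpha>' X Y Z \<cdot> f = f"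
  using assms by (simp_all add: comp_eqI)

lemma associator_nat:
  assumes "f \<in> Arr C" "g \<in> Arr C" "h \<in> Arr C" "Cod C f = X" "Cod C g = Y" "Cod C h = Z"
  shows "\<alpha> X Y Z \<cdot> ((f \<otimes> g) \<otimes> h) = (f \<otimes> g \<otimes> h) \<cdot> \<alpha> (Dom C f) (Dom C g) (Dom C h)"
  using associator_natural[of f _ _ g _ _ h] assms by (simp add: hom_iff)

lemma associator_inv_nat:
  assumes "f \<in> Arr C" "g \<in> Arr C" "h \<in> Arr C" "Cod C f = X" "Cod C g = Y" "Cod C h = Z"
  shows "\<alpha>' X Y Z \<cdot> (f \<otimes> g \<otimes> h) = ((f \<otimes> g) \<otimes> h) \<cdot> \<alpha>' (Dom C f) (Dom C g) (Dom C h)"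
    (is "?L = ?R")
proof -
  have obj: "X \<in> Obj C" "Y \<in> Obj C" "Z \<in> Obj C" using assms by auto
  have "?L = \<alpha>' X Y Z \<cdot> ((f \<otimes> g \<otimes> h) \<cdot> \<alpha> (Dom C f) (Dom C g) (Dom C h))
      \<cdot> \<alpha>' (Dom C f) (Dom C g) (Dom C h)"
    using assms obj by simp
  also have "\<dots> = \<alpha>' X Y Z \<cdot> (\<alpha> X Y Z \<cdot> ((f \<otimes> g) \<otimes> h)) \<cdot> \<alpha>' (Dom C f) (Dom C g) (Dom C h)"
    using assms by (simp only: associator_nat)
  also have "\<dots> = ?R"
    using assms obj by simp
  finally show ?thesis .
qed

lemma symmetry_nat:
  assumes "f \<in> Arr C" "g \<in> Arr C" "Cod C f = X" "Cod C g = Y"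
  shows "\<sigma> X Y \<cdot> (f \<otimes> g) = (g \<otimes> f) \<cdot> \<sigma> (Dom C f) (Dom C g)"
  using symmetry_natural[of f _ _ g] assms by (simp add: hom_iff)

lemma left_unitor_nat:
  assumes "f \<in> Arr C"
  shows "\<l> (Cod C f) \<cdot> (\<i>\<d> \<I> \<otimes> f) = f \<cdot> \<l> (Dom C f)"
  using left_unitor_natural[of f] assms by (simp add: hom_iff)

lemma right_unitor_nat:
  assumes "f \<in> Arr C"
  shows "\<r> (Cod C f) \<cdot> (f \<otimes> \<i>\<d> \<I>) = f \<cdot> \<r> (Dom C f)"
  using right_unitor_natural[of f] assms by (simp add: hom_iff)

section \<open>Cancellation and coherence of the unitors\<close>

lemma right_cancel:
  assumes "f \<cdot> h = g \<cdot> h" "h \<cdot> k = \<i>\<d> (Dom C f)" "f \<in> Arr C" "g \<in> Arr C" "h \<in> Arr C" "k \<in> Arr C"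
    "Dom C f = Dom C g" "Cod C h = Dom C f" "Cod C k = Dom C h" 
  shows "f = g"
proof -
  have "f = (f \<cdot> h) \<cdot> k" "g = (g \<cdot> h) \<cdot> k" using assms(2-) by simp_all
  then show ?thesis using assms(1) by metis
qed

lemma left_cancel:
  assumes "h \<cdot> f = h \<cdot> g" "k \<cdot> h = \<i>\<d> (Cod C f)" "f \<in> Arr C" "g \<in> Arr C" "h \<in> Arr C" "k \<in> Arr C"
    "Cod C f = Cod C g" "Dom C h = Cod C f" "Dom C k = Cod C h" 
  shows "f = g"
proof -
  have "f = k \<cdot> h \<cdot> f" "g = k \<cdot> h \<cdot> g"
    using assms(2-) by (simp_all add: comp_eqI)
  then show ?thesis using assms(1) by metis
qed

lemma tensor_unit_left_faithful:
  assumes "\<i>\<d> \<I> \<otimes> f = \<i>\<d> \<I> \<otimes> g" "f \<in> Arr C" "g \<in> Arr C" "Dom C f = Dom C g" "Cod C f = Cod C g"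
  shows "f = g"
proof (rule right_cancel[where h="\<l> (Dom C f)" and k="\<l>' (Dom C f)"])
  show "f \<cdot> \<l> (Dom C f) = g \<cdot> \<l> (Dom C f)"
    using left_unitor_nat[of f] left_unitor_nat[of g] assms by simp
qed (use assms in simp_all)

lemma tensor_unit_right_faithful:
  assumes "f \<otimes> \<i>\<d> \<I> = g \<otimes> \<i>\<d> \<I>" "f \<in> Arr C" "g \<in> Arr C" "Dom C f = Dom C g" "Cod C f = Cod C g"
  shows "f = g"
proof (rule right_cancel[where h="\<r> (Dom C f)" and k="\<r>' (Dom C f)"])
  show "f \<cdot> \<r> (Dom C f) = g \<cdot> \<r> (Dom C f)"
    using right_unitor_nat[of f] right_unitor_nat[of g] assms by simp
qed (use assms in simp_all)

text \<open>A classical coherence law. After tensoring with \<open>\<I>\<close> on the left, the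
  pentagon at \<open>\<I>\<close>, \<open>\<I>\<close>, \<open>X\<close>, \<open>Y\<close> and two
  triangles connect both sides; \<open>tensor_unit_left_faithful\<close> then removes the extra
  \<open>\<I>\<close>.\<close>

lemma left_unitor_tensor:
  assumes X: "X \<in> Obj C" "Y \<in> Obj C"
  shows "\<l> (X \<boxtimes> Y) \<cdot> \<alpha> \<I> X Y = \<l> X \<otimes> \<i>\<d> Y"
proof (rule tensor_unit_left_faithful)
  let ?i = "\<i>\<d> \<I>"
  have "(?i \<otimes> (\<l> (X \<boxtimes> Y) \<cdot> \<alpha> \<I> X Y)) \<cdot> \<alpha> \<I> (\<I> \<boxtimes> X) Y \<cdot> (\<alpha> \<I> \<I> X \<otimes> \<i>\<d> Y)
     = (?i \<otimes> \<l> (X \<boxtimes> Y)) \<cdot> (?i \<otimes> \<alpha> \<I> X Y) \<cdot> \<alpha> \<I> (\<I> \<boxtimes> X) Y \<cdot> (\<alpha> \<I> \<I> X \<otimes> \<i>\<d> Y)"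
    using X by simp
  also have "\<dots> = (?i \<otimes> \<l> (X \<boxtimes> Y)) \<cdot> \<alpha> \<I> \<I> (X \<boxtimes> Y) \<cdot> \<alpha> (\<I> \<boxtimes> \<I>) X Y"
    using pentagon[of \<I> \<I> X Y] X by simp
  also have "\<dots> = (\<r> \<I> \<otimes> \<i>\<d> X \<otimes> \<i>\<d> Y) \<cdot> \<alpha> (\<I> \<boxtimes> \<I>) X Y"
    using triangle[of \<I> "X \<boxtimes> Y"] X by (simp add: comp_eqI)
  also have "\<dots> = \<alpha> \<I> X Y \<cdot> ((\<r> \<I> \<otimes> \<i>\<d> X) \<otimes> \<i>\<d> Y)"
    using X by (subst associator_nat) simp_all
  also have "\<dots> = \<alpha> \<I> X Y \<cdot> (((?i \<otimes> \<l> X) \<cdot> \<alpha> \<I> \<I> X) \<otimes> \<i>\<d> Y)"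
    using X triangle[of \<I> X] by simp
  also have "\<dots> = \<alpha> \<I> X Y \<cdot> ((?i \<otimes> \<l> X) \<otimes> \<i>\<d> Y) \<cdot> (\<alpha> \<I> \<I> X \<otimes> \<i>\<d> Y)"
    using X by simp
  also have "\<dots> = ((?i \<otimes> \<l> X \<otimes> \<i>\<d> Y) \<cdot> \<alpha> \<I> (\<I> \<boxtimes> X) Y) \<cdot> (\<alpha> \<I> \<I> X \<otimes> \<i>\<d> Y)"
    using X by (subst comp_eqI[OF associator_nat]) simp_all
  finally have eq: "(?i \<otimes> (\<l> (X \<boxtimes> Y) \<cdot> \<alpha> \<I> X Y)) \<cdot> \<alpha> \<I> (\<I> \<boxtimes> X) Y \<cdot> (\<alpha> \<I> \<I> X \<otimes> \<i>\<d> Y)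
      = (?i \<otimes> \<l> X \<otimes> \<i>\<d> Y) \<cdot> \<alpha> \<I> (\<I> \<boxtimes> X) Y \<cdot> (\<alpha> \<I> \<I> X \<otimes> \<i>\<d> Y)"
    using X by simp
  show "?i \<otimes> (\<l> (X \<boxtimes> Y) \<cdot> \<alpha> \<I> X Y) = ?i \<otimes> \<l> X \<otimes> \<i>\<d> Y"
    by (rule right_cancel[OF eq, where k="(\<alpha>' \<I> \<I> X \<otimes> \<i>\<d> Y) \<cdot> \<alpha>' \<I> (\<I> \<boxtimes> X) Y"])
      (use X in simp_all)
qed (use X in simp_all)

text \<open>The mirror image: the pentagon at \<open>X\<close>, \<open>Y\<close>,
  \<open>\<I>\<close>, \<open>\<I>\<close>, after tensoring with \<open>\<I>\<close> on the
  right.\<close>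

lemma right_unitor_tensor:
  assumes X: "X \<in> Obj C" "Y \<in> Obj C"
  shows "(\<i>\<d> X \<otimes> \<r> Y) \<cdot> \<alpha> X Y \<I> = \<r> (X \<boxtimes> Y)"
proof (rule tensor_unit_right_faithful)
  let ?i = "\<i>\<d> \<I>"
  have "\<alpha> X Y \<I> \<cdot> (((\<i>\<d> X \<otimes> \<r> Y) \<cdot> \<alpha> X Y \<I>) \<otimes> ?i)
      = \<alpha> X Y \<I> \<cdot> ((\<i>\<d> X \<otimes> \<r> Y) \<otimes> ?i) \<cdot> (\<alpha> X Y \<I> \<otimes> ?i)"
    using X by simp
  also have "\<dots> = ((\<i>\<d> X \<otimes> (\<r> Y \<otimes> ?i)) \<cdot> \<alpha> X (Y \<boxtimes> \<I>) \<I>) \<cdot> (\<alpha> X Y \<I> \<otimes> ?i)"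
    using X by (subst comp_eqI[OF associator_nat]) simp_all
  also have "\<dots> = (\<i>\<d> X \<otimes> ((\<i>\<d> Y \<otimes> \<l> \<I>) \<cdot> \<alpha> Y \<I> \<I>)) \<cdot> \<alpha> X (Y \<boxtimes> \<I>) \<I> \<cdot> (\<alpha> X Y \<I> \<otimes> ?i)"
    using X triangle[of Y \<I>] by simp
  also have "\<dots> = (\<i>\<d> X \<otimes> (\<i>\<d> Y \<otimes> \<l> \<I>)) \<cdot> (\<i>\<d> X \<otimes> \<alpha> Y \<I> \<I>) \<cdot> \<alpha> X (Y \<boxtimes> \<I>) \<I> \<cdot> (\<alpha> X Y \<I> \<otimes> ?i)"
    using X by simp
  also have "\<dots> = (\<i>\<d> X \<otimes> (\<i>\<d> Y \<otimes> \<l> \<I>)) \<cdot> \<alpha> X Y (\<I> \<boxtimes> \<I>) \<cdot> \<alpha> (X \<boxtimes> Y) \<I> \<I>"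
    using X pentagon[of X Y \<I> \<I>] by simp
  also have "\<dots> = (\<alpha> X Y \<I> \<cdot> ((\<i>\<d> X \<otimes> \<i>\<d> Y) \<otimes> \<l> \<I>)) \<cdot> \<alpha> (X \<boxtimes> Y) \<I> \<I>"
    using X by (subst associator_nat) (simp_all del: tensor_ide)
  also have "\<dots> = \<alpha> X Y \<I> \<cdot> (\<r> (X \<boxtimes> Y) \<otimes> ?i)"
    using X triangle[of "X \<boxtimes> Y" \<I>] by simp
  finally have eq: "\<alpha> X Y \<I> \<cdot> (((\<i>\<d> X \<otimes> \<r> Y) \<cdot> \<alpha> X Y \<I>) \<otimes> ?i) = \<alpha> X Y \<I> \<cdot> (\<r> (X \<boxtimes> Y) \<otimes> ?i)" .
  show "((\<i>\<d> X \<otimes> \<r> Y) \<cdot> \<alpha> X Y \<I>) \<otimes> ?i = \<r> (X \<boxtimes> Y) \<otimes> ?i"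
    by (rule left_cancel[OF eq, where k="\<alpha>' X Y \<I>"]) (use X in simp_all)
qed (use X in simp_all)

end

section \<open>Deterministic morphisms\<close>

context cd_category
begin

section \<open>Pairing through the copy maps\<close>

lemma copy_arr [simp]:
  assumes "X \<in> Obj C"
  shows "\<Delta> X \<in> Arr C" "Dom C (\<Delta> X) = X" "Cod C (\<Delta> X) = X \<boxtimes> X"
    "\<epsilon> X \<in> Arr C" "Dom C (\<epsilon> X) = X" "Cod C (\<epsilon> X) = \<I>"
  using copy_in[OF assms] discard_in[OF assms] by (simp_all add: hom_iff)

definition pair :: "'m \<Rightarrow> 'm \<Rightarrow> 'm"  (\<open>\<langle>_, _\<rangle>\<close>)
  where "\<langle>f, g\<rangle> = (f \<otimes> g) \<cdot> \<Delta> (Dom C f)"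

lemma pair_arr [simp]:
  assumes "f \<in> Arr C" "g \<in> Arr C" "Dom C f = Dom C g"
  shows "\<langle>f, g\<rangle> \<in> Arr C" "Dom C \<langle>f, g\<rangle> = Dom C g" "Cod C \<langle>f, g\<rangle> = Cod C f \<boxtimes> Cod C g"
  using assms by (simp_all add: pair_def)

lemma tensor_pair [simp]:
  assumes "f \<in> Arr C" "g \<in> Arr C" "Dom C f = Dom C g"
    "h \<in> Arr C" "k \<in> Arr C" "Dom C h = Cod C f" "Dom C k = Cod C g"
  shows "(h \<otimes> k) \<cdot> \<langle>f, g\<rangle> = \<langle>h \<cdot> f, k \<cdot> g\<rangle>"
  using assms by (simp add: pair_def)

text \<open>Copying takes place at the common domain, before any component acts. Hence naturality of
  \<alpha> and coassociativity at that one object cover arbitrary \<open>f\<close>,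
  \<open>g\<close>, \<open>h\<close>.\<close>

lemma associator_pair [simp]:
  assumes "f \<in> Arr C" "g \<in> Arr C" "h \<in> Arr C" "Dom C f = Dom C h" "Dom C g = Dom C h"
    "Cod C f = X" "Cod C g = Y" "Cod C h = Z"
  shows "\<alpha> X Y Z \<cdot> \<langle>\<langle>f, g\<rangle>, h\<rangle> = \<langle>f, \<langle>g, h\<rangle>\<rangle>"
    "\<alpha>' X Y Z \<cdot> \<langle>f, \<langle>g, h\<rangle>\<rangle> = \<langle>\<langle>f, g\<rangle>, h\<rangle>"
proof -
  let ?D = "Dom C h"
  have obj: "X \<in> Obj C" "Y \<in> Obj C" "Z \<in> Obj C" "?D \<in> Obj C" using assms by auto
  have "\<alpha> X Y Z \<cdot> \<langle>\<langle>f, g\<rangle>, h\<rangle>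
      = \<alpha> X Y Z \<cdot> ((f \<otimes> g) \<otimes> h) \<cdot> (\<Delta> ?D \<otimes> \<i>\<d> ?D) \<cdot> \<Delta> ?D"
    using assms(1-5) obj by (simp add: pair_def)
  also have "\<dots> = ((f \<otimes> g \<otimes> h) \<cdot> \<alpha> ?D ?D ?D) \<cdot> (\<Delta> ?D \<otimes> \<i>\<d> ?D) \<cdot> \<Delta> ?D"
    using assms obj by (subst comp_eqI[OF associator_nat]) simp_all
  also have "\<dots> = (f \<otimes> g \<otimes> h) \<cdot> \<alpha> ?D ?D ?D \<cdot> (\<Delta> ?D \<otimes> \<i>\<d> ?D) \<cdot> \<Delta> ?D"
    using assms(1-5) obj by simp
  also have "\<dots> = (f \<otimes> g \<otimes> h) \<cdot> (\<i>\<d> ?D \<otimes> \<Delta> ?D) \<cdot> \<Delta> ?D"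
    using obj by (simp only: copy_assoc)
  also have "\<dots> = \<langle>f, \<langle>g, h\<rangle>\<rangle>"
    using assms(1-5) obj by (simp add: pair_def)
  finally show "\<alpha> X Y Z \<cdot> \<langle>\<langle>f, g\<rangle>, h\<rangle> = \<langle>f, \<langle>g, h\<rangle>\<rangle>" .
  then have "\<alpha>' X Y Z \<cdot> \<alpha> X Y Z \<cdot> \<langle>\<langle>f, g\<rangle>, h\<rangle> = \<alpha>' X Y Z \<cdot> \<langle>f, \<langle>g, h\<rangle>\<rangle>" by simp
  then show "\<alpha>' X Y Z \<cdot> \<langle>f, \<langle>g, h\<rangle>\<rangle> = \<langle>\<langle>f, g\<rangle>, h\<rangle>"
    using assms obj by simp
qed

lemma symmetry_pair [simp]:
  assumes "f \<in> Arr C" "g \<in> Arr C" "Dom C f = Dom C g" "Cod C f = X" "Cod C g = Y"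
  shows "\<sigma> X Y \<cdot> \<langle>f, g\<rangle> = \<langle>g, f\<rangle>"
proof -
  have "\<sigma> X Y \<cdot> \<langle>f, g\<rangle> = ((g \<otimes> f) \<cdot> \<sigma> (Dom C g) (Dom C g)) \<cdot> \<Delta> (Dom C g)"
    unfolding pair_def using assms by (subst comp_eqI[OF symmetry_nat]) auto
  also have "\<dots> = \<langle>g, f\<rangle>"
    using assms by (simp add: pair_def copy_comm)
  finally show ?thesis .
qed

lemma unitor_pair [simp]:
  assumes "f \<in> Arr C" "Dom C f = X" "Cod C f = Y"
  shows "\<l> Y \<cdot> \<langle>\<epsilon> X, f\<rangle> = f" "\<r> Y \<cdot> \<langle>f, \<epsilon> X\<rangle> = f"
proof -
  have obj: "X \<in> Obj C" "Y \<in> Obj C" using assms by auto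
  have "\<l> Y \<cdot> \<langle>\<epsilon> X, f\<rangle> = \<l> Y \<cdot> (\<i>\<d> \<I> \<otimes> f) \<cdot> (\<epsilon> X \<otimes> \<i>\<d> X) \<cdot> \<Delta> X"
    using assms obj by (simp add: pair_def)
  also have "\<dots> = (f \<cdot> \<l> X) \<cdot> (\<epsilon> X \<otimes> \<i>\<d> X) \<cdot> \<Delta> X"
    using assms obj left_unitor_nat[of f] by (subst comp_eqI[where k="f \<cdot> \<l> X"]) auto
  also have "\<dots> = f"
    using assms obj by (simp add: copy_discard_left)
  finally show "\<l> Y \<cdot> \<langle>\<epsilon> X, f\<rangle> = f" .
  have "\<r> Y \<cdot> \<langle>f, \<epsilon> X\<rangle> = \<r> Y \<cdot> (f \<otimes> \<i>\<d> \<I>) \<cdot> (\<i>\<d> X \<otimes> \<epsilon> X) \<cdot> \<Delta> X"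
    using assms obj by (simp add: pair_def)
  also have "\<dots> = (f \<cdot> \<r> X) \<cdot> (\<i>\<d> X \<otimes> \<epsilon> X) \<cdot> \<Delta> X"
    using assms obj right_unitor_nat[of f] by (subst comp_eqI[where k="f \<cdot> \<r> X"]) auto
  also have "\<dots> = f"
    using assms obj by (simp add: copy_discard_right)
  finally show "\<r> Y \<cdot> \<langle>f, \<epsilon> X\<rangle> = f" .
qed

lemma mid_swap_arr [simp]:
  assumes "X \<in> Obj C" "Y \<in> Obj C" "Z \<in> Obj C" "U \<in> Obj C"
  shows "mid_swap C X Y Z U \<in> Arr C"
    "Dom C (mid_swap C X Y Z U) = (X \<boxtimes> Y) \<boxtimes> (Z \<boxtimes> U)"
    "Cod C (mid_swap C X Y Z U) = (X \<boxtimes> Z) \<boxtimes> (Y \<boxtimes> U)"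
  using assms by (simp_all add: mid_swap_def)

lemma mid_swap_pair [simp]:
  assumes "f \<in> Arr C" "g \<in> Arr C" "h \<in> Arr C" "k \<in> Arr C"
    "Dom C f = Dom C k" "Dom C g = Dom C k" "Dom C h = Dom C k"
    "Cod C f = X" "Cod C g = Y" "Cod C h = Z" "Cod C k = U"
  shows "mid_swap C X Y Z U \<cdot> \<langle>\<langle>f, g\<rangle>, \<langle>h, k\<rangle>\<rangle> = \<langle>\<langle>f, h\<rangle>, \<langle>g, k\<rangle>\<rangle>"
proof -
  have "X \<in> Obj C" "Y \<in> Obj C" "Z \<in> Obj C" "U \<in> Obj C" using assms by auto
  then show ?thesis using assms by (simp add: mid_swap_def)
qed

lemma mid_swap_nat:
  assumes "f \<in> Arr C" "g \<in> Arr C" "h \<in> Arr C" "k \<in> Arr C"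
    "Cod C f = X" "Cod C g = Y" "Cod C h = Z" "Cod C k = U"
  shows "mid_swap C X Y Z U \<cdot> ((f \<otimes> g) \<otimes> (h \<otimes> k))
    = ((f \<otimes> h) \<otimes> (g \<otimes> k)) \<cdot> mid_swap C (Dom C f) (Dom C g) (Dom C h) (Dom C k)"
proof -
  let ?f = "Dom C f" and ?g = "Dom C g" and ?h = "Dom C h" and ?k = "Dom C k"
  have obj: "X \<in> Obj C" "Y \<in> Obj C" "Z \<in> Obj C" "U \<in> Obj C" using assms by auto
  have inner: "(\<alpha> Z Y U \<cdot> (\<sigma> Y Z \<otimes> \<i>\<d> U) \<cdot> \<alpha>' Y Z U) \<cdot> (g \<otimes> h \<otimes> k)
      = (h \<otimes> g \<otimes> k) \<cdot> \<alpha> ?h ?g ?k \<cdot> (\<sigma> ?g ?h \<otimes> \<i>\<d> ?k) \<cdot> \<alpha>' ?g ?h ?k"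
  proof -
    have "(\<alpha> Z Y U \<cdot> (\<sigma> Y Z \<otimes> \<i>\<d> U) \<cdot> \<alpha>' Y Z U) \<cdot> (g \<otimes> h \<otimes> k)
      = \<alpha> Z Y U \<cdot> (\<sigma> Y Z \<otimes> \<i>\<d> U) \<cdot> ((g \<otimes> h) \<otimes> k) \<cdot> \<alpha>' ?g ?h ?k"
      using assms obj by (simp add: associator_inv_nat)
    also have "\<dots> = \<alpha> Z Y U \<cdot> ((h \<otimes> g) \<otimes> k) \<cdot> (\<sigma> ?g ?h \<otimes> \<i>\<d> ?k) \<cdot> \<alpha>' ?g ?h ?k"
      using assms obj by (simp add: symmetry_nat)
    also have "\<dots> = ((h \<otimes> g \<otimes> k) \<cdot> \<alpha> ?h ?g ?k) \<cdot> (\<sigma> ?g ?h \<otimes> \<i>\<d> ?k) \<cdot> \<alpha>' ?g ?h ?k"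
      using assms obj by (subst comp_eqI[OF associator_nat]) auto
    finally show ?thesis using assms obj by simp
  qed
  have "mid_swap C X Y Z U \<cdot> ((f \<otimes> g) \<otimes> (h \<otimes> k))
    = \<alpha>' X Z (Y \<boxtimes> U) \<cdot> (\<i>\<d> X \<otimes> (\<alpha> Z Y U \<cdot> (\<sigma> Y Z \<otimes> \<i>\<d> U) \<cdot> \<alpha>' Y Z U))
      \<cdot> (f \<otimes> g \<otimes> h \<otimes> k) \<cdot> \<alpha> ?f ?g (?h \<boxtimes> ?k)"
    using assms obj by (simp add: mid_swap_def associator_nat)
  also have "\<dots> = \<alpha>' X Z (Y \<boxtimes> U)
      \<cdot> (f \<otimes> ((\<alpha> Z Y U \<cdot> (\<sigma> Y Z \<otimes> \<i>\<d> U) \<cdot> \<alpha>' Y Z U) \<cdot> (g \<otimes> h \<otimes> k))) \<cdot> \<alpha> ?f ?g (?h \<boxtimes> ?k)"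
    using assms obj by simp
  also have "\<dots> = \<alpha>' X Z (Y \<boxtimes> U) \<cdot> (f \<otimes> h \<otimes> g \<otimes> k)
      \<cdot> (\<i>\<d> ?f \<otimes> (\<alpha> ?h ?g ?k \<cdot> (\<sigma> ?g ?h \<otimes> \<i>\<d> ?k) \<cdot> \<alpha>' ?g ?h ?k)) \<cdot> \<alpha> ?f ?g (?h \<boxtimes> ?k)"
    unfolding inner using assms obj by simp
  also have "\<dots> = (((f \<otimes> h) \<otimes> (g \<otimes> k)) \<cdot> \<alpha>' ?f ?h (?g \<boxtimes> ?k))
      \<cdot> (\<i>\<d> ?f \<otimes> (\<alpha> ?h ?g ?k \<cdot> (\<sigma> ?g ?h \<otimes> \<i>\<d> ?k) \<cdot> \<alpha>' ?g ?h ?k)) \<cdot> \<alpha> ?f ?g (?h \<boxtimes> ?k)"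
    using assms obj by (subst comp_eqI[OF associator_inv_nat]) auto
  also have "\<dots> = ((f \<otimes> h) \<otimes> (g \<otimes> k)) \<cdot> mid_swap C ?f ?g ?h ?k"
    unfolding mid_swap_def using assms obj by simp
  finally show ?thesis .
qed

text \<open>The comonoid laws at \<open>\<I>\<close> yield unit coherence at once: copying there is
  \<open>\<l>' \<I>\<close> and discarding is the identity, so the right counit law reads
  \<open>\<r> \<I> \<cdot> \<l>' \<I> = \<i>\<d> \<I>\<close>. Cocommutativity gives
  \<open>symmetry_unit\<close> in the same way.\<close>

lemma left_eq_right_unitor: "\<r> \<I> = \<l> \<I>"
proof (rule right_cancel[where h="\<l>' \<I>" and k="\<l> \<I>"])
  show "\<r> \<I> \<cdot> \<l>' \<I> = \<l> \<I> \<cdot> \<l>' \<I>"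
    using copy_discard_right[of \<I>] by (simp add: copy_unit discard_unit)
qed simp_all

lemma symmetry_unit: "\<sigma> \<I> \<I> = \<i>\<d> (\<I> \<boxtimes> \<I>)"
proof (rule right_cancel[where h="\<l>' \<I>" and k="\<l> \<I>"])
  show "\<sigma> \<I> \<I> \<cdot> \<l>' \<I> = \<i>\<d> (\<I> \<boxtimes> \<I>) \<cdot> \<l>' \<I>"
    using copy_comm[of \<I>] by (simp add: copy_unit)
qed simp_all

section \<open>Projections and surjective pairing\<close>

definition fst_arr :: "'o \<Rightarrow> 'o \<Rightarrow> 'm"  (\<open>\<p>\<^sub>1\<close>)
  where "\<p>\<^sub>1 X Y = \<r> X \<cdot> (\<i>\<d> X \<otimes> \<epsilon> Y)"

definition snd_arr :: "'o \<Rightarrow> 'o \<Rightarrow> 'm"  (\<open>\<p>\<^sub>2\<close>)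
  where "\<p>\<^sub>2 X Y = \<l> Y \<cdot> (\<epsilon> X \<otimes> \<i>\<d> Y)"

lemma proj_arr [simp]:
  assumes "X \<in> Obj C" "Y \<in> Obj C"
  shows "\<p>\<^sub>1 X Y \<in> Arr C" "Dom C (\<p>\<^sub>1 X Y) = X \<boxtimes> Y" "Cod C (\<p>\<^sub>1 X Y) = X"
    "\<p>\<^sub>2 X Y \<in> Arr C" "Dom C (\<p>\<^sub>2 X Y) = X \<boxtimes> Y" "Cod C (\<p>\<^sub>2 X Y) = Y"
  using assms by (simp_all add: fst_arr_def snd_arr_def)

lemma fst_pair [simp]:
  assumes "f \<in> Arr C" "is_channel C g" "Dom C f = Dom C g" "Cod C f = X" "Cod C g = Y"
  shows "\<p>\<^sub>1 X Y \<cdot> \<langle>f, g\<rangle> = f"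
proof -
  have "X \<in> Obj C" "Y \<in> Obj C" "g \<in> Arr C" using assms by (auto simp: is_channel_def)
  then show ?thesis using assms by (simp add: fst_arr_def is_channel_def)
qed

lemma snd_pair [simp]:
  assumes "g \<in> Arr C" "is_channel C f" "Dom C f = Dom C g" "Cod C f = X" "Cod C g = Y"
  shows "\<p>\<^sub>2 X Y \<cdot> \<langle>f, g\<rangle> = g"
proof -
  have "X \<in> Obj C" "Y \<in> Obj C" "f \<in> Arr C" using assms by (auto simp: is_channel_def)
  then show ?thesis using assms by (simp add: snd_arr_def is_channel_def)
qed

lemma unitor_inv_eq_pair:
  assumes "X \<in> Obj C"
  shows "\<l>' X = \<langle>\<epsilon> X, \<i>\<d> X\<rangle>" "\<r>' X = \<langle>\<i>\<d> X, \<epsilon> X\<rangle>"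
proof -
  show "\<l>' X = \<langle>\<epsilon> X, \<i>\<d> X\<rangle>"
    by (rule left_cancel[where h="\<l> X" and k="\<l>' X"]) (use assms in simp_all)
  show "\<r>' X = \<langle>\<i>\<d> X, \<epsilon> X\<rangle>"
    by (rule left_cancel[where h="\<r> X" and k="\<r>' X"]) (use assms in simp_all)
qed

text \<open>Pairing the projections copies both factors and discards the crossed copies. Naturality
  of \<open>mid_swap\<close> lets the discarding happen before the swap, whose middle objects become
  \<open>\<I>\<close>; the swap is then trivial and the counit laws finish.\<close>

lemma pair_proj [simp]:
  assumes "X \<in> Obj C" "Y \<in> Obj C"
  shows "\<langle>\<p>\<^sub>1 X Y, \<p>\<^sub>2 X Y\<rangle> = \<i>\<d> (X \<boxtimes> Y)"
proof -
  have swap: "mid_swap C X \<I> \<I> Y = \<i>\<d> ((X \<boxtimes> \<I>) \<boxtimes> (\<I> \<boxtimes> Y))"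
    using assms by (simp add: mid_swap_def symmetry_unit)
  have "\<langle>\<p>\<^sub>1 X Y, \<p>\<^sub>2 X Y\<rangle> = (\<r> X \<otimes> \<l> Y) \<cdot> (((\<i>\<d> X \<otimes> \<epsilon> Y) \<otimes> (\<epsilon> X \<otimes> \<i>\<d> Y)) \<cdot> mid_swap C X X Y Y)
      \<cdot> (\<Delta> X \<otimes> \<Delta> Y)"
    using assms by (simp add: pair_def fst_arr_def snd_arr_def copy_tensor)
  also have "\<dots> = (\<r> X \<otimes> \<l> Y) \<cdot> (mid_swap C X \<I> \<I> Y \<cdot> ((\<i>\<d> X \<otimes> \<epsilon> X) \<otimes> (\<epsilon> Y \<otimes> \<i>\<d> Y)))
      \<cdot> (\<Delta> X \<otimes> \<Delta> Y)"
    using assms by (subst mid_swap_nat) simp_all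
  also have "\<dots> = \<i>\<d> (X \<boxtimes> Y)"
    using assms by (simp add: swap copy_discard_left copy_discard_right)
  finally show ?thesis .
qed

lemma fst_right_unit: "X \<in> Obj C \<Longrightarrow> \<p>\<^sub>1 X \<I> = \<r> X"
  and snd_left_unit: "X \<in> Obj C \<Longrightarrow> \<p>\<^sub>2 \<I> X = \<l> X"
  by (simp_all add: fst_arr_def snd_arr_def discard_unit)

lemma snd_right_unit: "X \<in> Obj C \<Longrightarrow> \<p>\<^sub>2 X \<I> = \<epsilon> (X \<boxtimes> \<I>)"
  by (simp add: snd_arr_def discard_tensor discard_unit)

lemma fst_left_unit: "X \<in> Obj C \<Longrightarrow> \<p>\<^sub>1 \<I> X = \<epsilon> (\<I> \<boxtimes> X)"
  by (simp add: fst_arr_def discard_tensor discard_unit left_eq_right_unitor)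

text \<open>By \<open>pair_proj\<close> the identity of a tensor with \<open>\<I>\<close> is a pair
  of a unitor and a discard, and the symmetry merely exchanges the two components.\<close>

lemma left_unitor_symmetry:
  assumes "X \<in> Obj C"
  shows "\<l> X \<cdot> \<sigma> X \<I> = \<r> X" "\<r> X \<cdot> \<sigma> \<I> X = \<l> X"
proof -
  have "\<i>\<d> (X \<boxtimes> \<I>) = \<langle>\<r> X, \<epsilon> (X \<boxtimes> \<I>)\<rangle>"
    using assms by (metis pair_proj fst_right_unit snd_right_unit unit_in)
  then have "\<l> X \<cdot> \<sigma> X \<I> = \<l> X \<cdot> \<sigma> X \<I> \<cdot> \<langle>\<r> X, \<epsilon> (X \<boxtimes> \<I>)\<rangle>"
    using assms by (metis ide_comp(2) symmetry_arr(1,2) unit_in)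
  then show "\<l> X \<cdot> \<sigma> X \<I> = \<r> X" using assms by simp
  have "\<i>\<d> (\<I> \<boxtimes> X) = \<langle>\<epsilon> (\<I> \<boxtimes> X), \<l> X\<rangle>"
    using assms by (metis pair_proj snd_left_unit fst_left_unit unit_in)
  then have "\<r> X \<cdot> \<sigma> \<I> X = \<r> X \<cdot> \<sigma> \<I> X \<cdot> \<langle>\<epsilon> (\<I> \<boxtimes> X), \<l> X\<rangle>"
    using assms by (metis ide_comp(2) symmetry_arr(1,2) unit_in)
  then show "\<r> X \<cdot> \<sigma> \<I> X = \<l> X" using assms by simp
qed

text \<open>Projecting both copies of a tensor discards one factor twice and leaves this swap. The
  law and its mirror \<open>mid_swap_left_unit\<close> are what makes the projections
  copyable.\<close>

lemma mid_swap_right_unit: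
  assumes "X \<in> Obj C"
  shows "(\<r> X \<otimes> \<r> X) \<cdot> mid_swap C X X \<I> \<I> = \<r> (X \<boxtimes> X) \<cdot> (\<i>\<d> (X \<boxtimes> X) \<otimes> \<l> \<I>)"
proof -
  have rl: "(\<r> X \<otimes> \<r> X) \<cdot> \<alpha>' X \<I> (X \<boxtimes> \<I>) = \<i>\<d> X \<otimes> (\<r> X \<cdot> \<l> (X \<boxtimes> \<I>))"
  proof -
    have "(\<r> X \<otimes> \<r> X) \<cdot> \<alpha>' X \<I> (X \<boxtimes> \<I>)
        = (\<i>\<d> X \<otimes> \<r> X) \<cdot> (\<r> X \<otimes> \<i>\<d> (X \<boxtimes> \<I>)) \<cdot> \<alpha>' X \<I> (X \<boxtimes> \<I>)"
      using assms by simp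
    also have "\<dots> = (\<i>\<d> X \<otimes> \<r> X) \<cdot> ((\<i>\<d> X \<otimes> \<l> (X \<boxtimes> \<I>)) \<cdot> \<alpha> X \<I> (X \<boxtimes> \<I>)) \<cdot> \<alpha>' X \<I> (X \<boxtimes> \<I>)"
      using assms by (simp only: triangle tensor_obj_in unit_in)
    finally show ?thesis using assms by simp
  qed
  have inner: "\<r> X \<cdot> \<l> (X \<boxtimes> \<I>) \<cdot> \<alpha> \<I> X \<I> \<cdot> (\<sigma> X \<I> \<otimes> \<i>\<d> \<I>) \<cdot> \<alpha>' X \<I> \<I> = \<r> X \<cdot> (\<i>\<d> X \<otimes> \<l> \<I>)"
  proof -
    have "\<r> X \<cdot> \<l> (X \<boxtimes> \<I>) \<cdot> \<alpha> \<I> X \<I> \<cdot> (\<sigma> X \<I> \<otimes> \<i>\<d> \<I>) \<cdot> \<alpha>' X \<I> \<I>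
        = \<r> X \<cdot> (\<l> X \<otimes> \<i>\<d> \<I>) \<cdot> (\<sigma> X \<I> \<otimes> \<i>\<d> \<I>) \<cdot> \<alpha>' X \<I> \<I>"
      using assms by (subst comp_eqI[OF left_unitor_tensor]) simp_all
    also have "\<dots> = \<r> X \<cdot> (\<r> X \<otimes> \<i>\<d> \<I>) \<cdot> \<alpha>' X \<I> \<I>"
      using assms by (simp add: left_unitor_symmetry)
    also have "\<dots> = \<r> X \<cdot> ((\<i>\<d> X \<otimes> \<l> \<I>) \<cdot> \<alpha> X \<I> \<I>) \<cdot> \<alpha>' X \<I> \<I>"
      using assms by (simp only: triangle tensor_obj_in unit_in)
    finally show ?thesis using assms by simp
  qed
  have "(\<r> X \<otimes> \<r> X) \<cdot> mid_swap C X X \<I> \<I>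
      = (\<i>\<d> X \<otimes> (\<r> X \<cdot> \<l> (X \<boxtimes> \<I>))) \<cdot> (\<i>\<d> X \<otimes> (\<alpha> \<I> X \<I> \<cdot> (\<sigma> X \<I> \<otimes> \<i>\<d> \<I>) \<cdot> \<alpha>' X \<I> \<I>))
        \<cdot> \<alpha> X X (\<I> \<boxtimes> \<I>)"
    using assms unfolding mid_swap_def by (subst comp_eqI[OF rl]) simp_all
  also have "\<dots> = (\<i>\<d> X \<otimes> \<r> X) \<cdot> (\<i>\<d> X \<otimes> \<i>\<d> X \<otimes> \<l> \<I>) \<cdot> \<alpha> X X (\<I> \<boxtimes> \<I>)"
    using assms by (simp add: inner)
  also have "\<dots> = (\<i>\<d> X \<otimes> \<r> X) \<cdot> \<alpha> X X \<I> \<cdot> ((\<i>\<d> X \<otimes> \<i>\<d> X) \<otimes> \<l> \<I>)"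
    using assms by (subst associator_nat) simp_all
  also have "\<dots> = \<r> (X \<boxtimes> X) \<cdot> (\<i>\<d> (X \<boxtimes> X) \<otimes> \<l> \<I>)"
    using assms by (subst comp_eqI[OF right_unitor_tensor]) simp_all
  finally show ?thesis .
qed

lemma mid_swap_left_unit:
  assumes "X \<in> Obj C"
  shows "(\<l> X \<otimes> \<l> X) \<cdot> mid_swap C \<I> \<I> X X = \<l> (X \<boxtimes> X) \<cdot> (\<l> \<I> \<otimes> \<i>\<d> (X \<boxtimes> X))"
proof -
  have lX: "(\<l> X \<otimes> \<i>\<d> U) \<cdot> \<alpha>' \<I> X U = \<l> (X \<boxtimes> U)" if "U \<in> Obj C" for U
  proof -
    have "(\<l> X \<otimes> \<i>\<d> U) \<cdot> \<alpha>' \<I> X U = (\<l> (X \<boxtimes> U) \<cdot> \<alpha> \<I> X U) \<cdot> \<alpha>' \<I> X U"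
      using assms that by (simp only: left_unitor_tensor)
    then show ?thesis using assms that by simp
  qed
  have ll: "(\<l> X \<otimes> \<l> X) \<cdot> \<alpha>' \<I> X (\<I> \<boxtimes> X) = \<l> (X \<boxtimes> X) \<cdot> (\<i>\<d> \<I> \<otimes> \<i>\<d> X \<otimes> \<l> X)"
  proof -
    have "(\<l> X \<otimes> \<l> X) \<cdot> \<alpha>' \<I> X (\<I> \<boxtimes> X)
        = (\<i>\<d> X \<otimes> \<l> X) \<cdot> (\<l> X \<otimes> \<i>\<d> (\<I> \<boxtimes> X)) \<cdot> \<alpha>' \<I> X (\<I> \<boxtimes> X)"
      using assms by simp
    also have "\<dots> = (\<i>\<d> X \<otimes> \<l> X) \<cdot> \<l> (X \<boxtimes> \<I> \<boxtimes> X)"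
      using assms by (simp add: lX)
    also have "\<dots> = \<l> (X \<boxtimes> X) \<cdot> (\<i>\<d> \<I> \<otimes> \<i>\<d> X \<otimes> \<l> X)"
      using assms left_unitor_nat[of "\<i>\<d> X \<otimes> \<l> X"] by simp
    finally show ?thesis .
  qed
  have inner: "(\<i>\<d> X \<otimes> \<l> X) \<cdot> \<alpha> X \<I> X \<cdot> (\<sigma> \<I> X \<otimes> \<i>\<d> X) \<cdot> \<alpha>' \<I> X X = \<l> (X \<boxtimes> X)"
    using assms by (subst comp_eqI[OF triangle]) (simp_all add: left_unitor_symmetry lX)
  have "(\<l> X \<otimes> \<l> X) \<cdot> mid_swap C \<I> \<I> X X
      = (\<l> (X \<boxtimes> X) \<cdot> (\<i>\<d> \<I> \<otimes> \<i>\<d> X \<otimes> \<l> X))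
        \<cdot> (\<i>\<d> \<I> \<otimes> (\<alpha> X \<I> X \<cdot> (\<sigma> \<I> X \<otimes> \<i>\<d> X) \<cdot> \<alpha>' \<I> X X)) \<cdot> \<alpha> \<I> \<I> (X \<boxtimes> X)"
    using assms unfolding mid_swap_def by (subst comp_eqI[OF ll]) simp_all
  also have "\<dots> = \<l> (X \<boxtimes> X) \<cdot> (\<i>\<d> \<I> \<otimes> \<l> (X \<boxtimes> X)) \<cdot> \<alpha> \<I> \<I> (X \<boxtimes> X)"
    using assms by (simp add: inner)
  also have "\<dots> = \<l> (X \<boxtimes> X) \<cdot> (\<l> \<I> \<otimes> \<i>\<d> (X \<boxtimes> X))"
    using assms triangle[of \<I> "X \<boxtimes> X"] by (simp add: left_eq_right_unitor)
  finally show ?thesis .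
qed

section \<open>The cartesian calculus of deterministic morphisms\<close>

definition det :: "'m \<Rightarrow> bool"
  where "det f \<longleftrightarrow> is_channel C f \<and> \<Delta> (Cod C f) \<cdot> f = \<langle>f, f\<rangle>"

lemma det_channel [simp]: "det f \<Longrightarrow> is_channel C f"
  by (simp add: det_def)

lemma channel_arr: "is_channel C f \<Longrightarrow> f \<in> Arr C"
  by (simp add: is_channel_def)

lemma det_arr [simp]: "det f \<Longrightarrow> f \<in> Arr C"
  by (simp add: channel_arr)

lemma det_copy: "det f \<Longrightarrow> Cod C f = X \<Longrightarrow> \<Delta> X \<cdot> f = \<langle>f, f\<rangle>"
  by (auto simp: det_def)

lemma channel_discard [simp]: "is_channel C f \<Longrightarrow> Cod C f = X \<Longrightarrow> \<epsilon> X \<cdot> f = \<epsilon> (Dom C f)"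
  by (auto simp: is_channel_def)

lemma channel_comp [simp]: "is_channel C f \<Longrightarrow> is_channel C g \<Longrightarrow> Dom C g = Cod C f \<Longrightarrow> is_channel C (g \<cdot> f)"
  unfolding is_channel_def by (auto simp: comp_eqI simp del: channel_discard)

lemma det_fst [simp]:
  assumes "X \<in> Obj C" "Y \<in> Obj C"
  shows "det (\<p>\<^sub>1 X Y)"
proof -
  have "\<langle>\<p>\<^sub>1 X Y, \<p>\<^sub>1 X Y\<rangle> = (\<r> X \<otimes> \<r> X) \<cdot> (((\<i>\<d> X \<otimes> \<epsilon> Y) \<otimes> (\<i>\<d> X \<otimes> \<epsilon> Y)) \<cdot> mid_swap C X X Y Y)
      \<cdot> (\<Delta> X \<otimes> \<Delta> Y)"
    using assms by (simp add: pair_def fst_arr_def copy_tensor)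
  also have "\<dots> = (\<r> X \<otimes> \<r> X) \<cdot> (mid_swap C X X \<I> \<I> \<cdot> ((\<i>\<d> X \<otimes> \<i>\<d> X) \<otimes> (\<epsilon> Y \<otimes> \<epsilon> Y)))
      \<cdot> (\<Delta> X \<otimes> \<Delta> Y)"
    using assms by (subst mid_swap_nat) simp_all
  also have "\<dots> = ((\<r> X \<otimes> \<r> X) \<cdot> mid_swap C X X \<I> \<I>) \<cdot> (\<Delta> X \<otimes> ((\<epsilon> Y \<otimes> \<epsilon> Y) \<cdot> \<Delta> Y))"
    using assms by simp
  also have "\<dots> = \<r> (X \<boxtimes> X) \<cdot> (\<Delta> X \<otimes> (\<l> \<I> \<cdot> \<langle>\<epsilon> Y, \<epsilon> Y\<rangle>))"
    unfolding mid_swap_right_unit[OF assms(1)] pair_def using assms by simp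
  also have "\<dots> = \<r> (X \<boxtimes> X) \<cdot> (\<Delta> X \<otimes> \<i>\<d> \<I>) \<cdot> (\<i>\<d> X \<otimes> \<epsilon> Y)"
    using assms by simp
  also have "\<dots> = (\<Delta> X \<cdot> \<r> X) \<cdot> (\<i>\<d> X \<otimes> \<epsilon> Y)"
    using assms right_unitor_nat[of "\<Delta> X"] by (subst comp_eqI[where k="\<Delta> X \<cdot> \<r> X"]) simp_all
  also have "\<dots> = \<Delta> X \<cdot> \<p>\<^sub>1 X Y"
    using assms by (simp add: fst_arr_def)
  finally have copy: "\<langle>\<p>\<^sub>1 X Y, \<p>\<^sub>1 X Y\<rangle> = \<Delta> X \<cdot> \<p>\<^sub>1 X Y" .
  have "\<epsilon> X \<cdot> \<p>\<^sub>1 X Y = (\<epsilon> X \<cdot> \<r> X) \<cdot> (\<i>\<d> X \<otimes> \<epsilon> Y)"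
    using assms by (simp add: fst_arr_def)
  also have "\<dots> = (\<r> \<I> \<cdot> (\<epsilon> X \<otimes> \<i>\<d> \<I>)) \<cdot> (\<i>\<d> X \<otimes> \<epsilon> Y)"
    using assms right_unitor_nat[of "\<epsilon> X"] by simp
  also have "\<dots> = \<epsilon> (X \<boxtimes> Y)"
    using assms by (simp add: discard_tensor left_eq_right_unitor)
  finally show ?thesis
    using assms copy unfolding det_def is_channel_def by (simp del: channel_discard)
qed

lemma det_snd [simp]:
  assumes "X \<in> Obj C" "Y \<in> Obj C"
  shows "det (\<p>\<^sub>2 X Y)"
proof -
  have "\<langle>\<p>\<^sub>2 X Y, \<p>\<^sub>2 X Y\<rangle> = (\<l> Y \<otimes> \<l> Y) \<cdot> (((\<epsilon> X \<otimes> \<i>\<d> Y) \<otimes> (\<epsilon> X \<otimes> \<i>\<d> Y)) \<cdot> mid_swap C X X Y Y)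
      \<cdot> (\<Delta> X \<otimes> \<Delta> Y)"
    using assms by (simp add: pair_def snd_arr_def copy_tensor)
  also have "\<dots> = (\<l> Y \<otimes> \<l> Y) \<cdot> (mid_swap C \<I> \<I> Y Y \<cdot> ((\<epsilon> X \<otimes> \<epsilon> X) \<otimes> (\<i>\<d> Y \<otimes> \<i>\<d> Y)))
      \<cdot> (\<Delta> X \<otimes> \<Delta> Y)"
    using assms by (subst mid_swap_nat) simp_all
  also have "\<dots> = ((\<l> Y \<otimes> \<l> Y) \<cdot> mid_swap C \<I> \<I> Y Y) \<cdot> (((\<epsilon> X \<otimes> \<epsilon> X) \<cdot> \<Delta> X) \<otimes> \<Delta> Y)"
    using assms by simp
  also have "\<dots> = \<l> (Y \<boxtimes> Y) \<cdot> ((\<l> \<I> \<cdot> \<langle>\<epsilon> X, \<epsilon> X\<rangle>) \<otimes> \<Delta> Y)"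
    unfolding mid_swap_left_unit[OF assms(2)] pair_def using assms by simp
  also have "\<dots> = \<l> (Y \<boxtimes> Y) \<cdot> (\<i>\<d> \<I> \<otimes> \<Delta> Y) \<cdot> (\<epsilon> X \<otimes> \<i>\<d> Y)"
    using assms by simp
  also have "\<dots> = (\<Delta> Y \<cdot> \<l> Y) \<cdot> (\<epsilon> X \<otimes> \<i>\<d> Y)"
    using assms left_unitor_nat[of "\<Delta> Y"] by (subst comp_eqI[where k="\<Delta> Y \<cdot> \<l> Y"]) simp_all
  also have "\<dots> = \<Delta> Y \<cdot> \<p>\<^sub>2 X Y"
    using assms by (simp add: snd_arr_def)
  finally have copy: "\<langle>\<p>\<^sub>2 X Y, \<p>\<^sub>2 X Y\<rangle> = \<Delta> Y \<cdot> \<p>\<^sub>2 X Y" .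
  have "\<epsilon> Y \<cdot> \<p>\<^sub>2 X Y = (\<epsilon> Y \<cdot> \<l> Y) \<cdot> (\<epsilon> X \<otimes> \<i>\<d> Y)"
    using assms by (simp add: snd_arr_def)
  also have "\<dots> = (\<l> \<I> \<cdot> (\<i>\<d> \<I> \<otimes> \<epsilon> Y)) \<cdot> (\<epsilon> X \<otimes> \<i>\<d> Y)"
    using assms left_unitor_nat[of "\<epsilon> Y"] by simp
  also have "\<dots> = \<epsilon> (X \<boxtimes> Y)"
    using assms by (simp add: discard_tensor)
  finally show ?thesis
    using assms copy unfolding det_def is_channel_def by (simp del: channel_discard)
qed

text \<open>Precomposition has to move \<open>h\<close> across the copy map inside the pair, which
  is what copyability of \<open>h\<close> provides.\<close>

lemma pair_comp_det [simp]:
  assumes "f \<in> Arr C" "g \<in> Arr C" "Dom C f = Dom C g" "det h" "Dom C g = Cod C h"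
  shows "\<langle>f, g\<rangle> \<cdot> h = \<langle>f \<cdot> h, g \<cdot> h\<rangle>"
  using assms by (simp add: pair_def[of f] det_copy)

lemma copy_pair:
  assumes "det f" "det g" "Dom C f = Dom C g" "Cod C f = X" "Cod C g = Y"
  shows "\<Delta> (X \<boxtimes> Y) \<cdot> \<langle>f, g\<rangle> = \<langle>\<langle>f, g\<rangle>, \<langle>f, g\<rangle>\<rangle>"
proof -
  have "X \<in> Obj C" "Y \<in> Obj C" using assms by auto
  then show ?thesis using assms by (simp add: copy_tensor det_copy)
qed

lemma channel_pair [simp]:
  assumes "is_channel C f" "is_channel C g" "Dom C f = Dom C g"
  shows "is_channel C \<langle>f, g\<rangle>"
  using assms channel_arr[of f] channel_arr[of g] unfolding is_channel_def[of C "\<langle>f, g\<rangle>"]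
  by (simp add: discard_tensor)

lemma det_pair [simp]:
  assumes "det f" "det g" "Dom C f = Dom C g"
  shows "det \<langle>f, g\<rangle>"
  using assms unfolding det_def[of "\<langle>f, g\<rangle>"] by (simp add: copy_pair)

lemma det_comp [simp]:
  assumes "det f" "det g" "Dom C g = Cod C f"
  shows "det (g \<cdot> f)"
  using assms unfolding det_def[of "g \<cdot> f"] by (simp add: det_copy comp_eqI[OF det_copy])

lemma pair_eta:
  assumes "f \<in> Arr C" "Dom C f = X \<boxtimes> Y" "X \<in> Obj C" "Y \<in> Obj C"
  shows "f \<cdot> \<langle>\<p>\<^sub>1 X Y, \<p>\<^sub>2 X Y\<rangle> = f"
  using assms by simp

lemma tensor_eq_pair:
  assumes "f \<in> Arr C" "g \<in> Arr C"
  shows "f \<otimes> g = \<langle>f \<cdot> \<p>\<^sub>1 (Dom C f) (Dom C g), g \<cdot> \<p>\<^sub>2 (Dom C f) (Dom C g)\<rangle>"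
  using pair_eta[of "f \<otimes> g" "Dom C f" "Dom C g"] assms by (simp del: pair_proj)

lemma det_tensor [simp]: "det f \<Longrightarrow> det g \<Longrightarrow> det (f \<otimes> g)"
  by (simp add: tensor_eq_pair)

lemma det_ide [simp]: "X \<in> Obj C \<Longrightarrow> det (\<i>\<d> X)"
  unfolding det_def is_channel_def by (simp add: pair_def del: channel_discard)

lemma channel_unit: "is_channel C f \<Longrightarrow> Cod C f = \<I> \<Longrightarrow> Dom C f = X \<Longrightarrow> f = \<epsilon> X"
  using ide_comp(1)[of f \<I>] by (simp add: is_channel_def discard_unit)

lemma det_discard [simp]: "X \<in> Obj C \<Longrightarrow> det (\<epsilon> X)"
proof -
  assume X: "X \<in> Obj C"
  have "\<langle>\<epsilon> X, \<epsilon> X\<rangle> = \<l>' \<I> \<cdot> \<l> \<I> \<cdot> \<langle>\<epsilon> X, \<epsilon> X\<rangle>" using X by (intro iso_cancel'(1)[symmetric]) simp_all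
  also have "\<dots> = \<l>' \<I> \<cdot> \<epsilon> X" using X by simp
  finally show ?thesis using X unfolding det_def is_channel_def
    by (simp add: discard_unit copy_unit del: channel_discard)
qed

lemma pair_proj_comp:
  assumes "det f" "Cod C f = X \<boxtimes> Y" "X \<in> Obj C" "Y \<in> Obj C"
  shows "\<langle>\<p>\<^sub>1 X Y \<cdot> f, \<p>\<^sub>2 X Y \<cdot> f\<rangle> = f"
  using pair_comp_det[of "\<p>\<^sub>1 X Y" "\<p>\<^sub>2 X Y" f] assms by simp

lemma structural_eq_pair:
  assumes "X \<in> Obj C" "Y \<in> Obj C"
  shows "\<sigma> X Y = \<langle>\<p>\<^sub>2 X Y, \<p>\<^sub>1 X Y\<rangle>"
    "Z \<in> Obj C \<Longrightarrow> \<alpha> X Y Z = \<langle>\<p>\<^sub>1 X Y \<cdot> \<p>\<^sub>1 (X \<boxtimes> Y) Z, \<langle>\<p>\<^sub>2 X Y \<cdot> \<p>\<^sub>1 (X \<boxtimes> Y) Z, \<p>\<^sub>2 (X \<boxtimes> Y) Z\<rangle>\<rangle>"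
    "Z \<in> Obj C \<Longrightarrow> \<alpha>' X Y Z = \<langle>\<langle>\<p>\<^sub>1 X (Y \<boxtimes> Z), \<p>\<^sub>1 Y Z \<cdot> \<p>\<^sub>2 X (Y \<boxtimes> Z)\<rangle>, \<p>\<^sub>2 Y Z \<cdot> \<p>\<^sub>2 X (Y \<boxtimes> Z)\<rangle>"
proof -
  show "\<sigma> X Y = \<langle>\<p>\<^sub>2 X Y, \<p>\<^sub>1 X Y\<rangle>"
    using pair_eta[of "\<sigma> X Y" X Y] assms by (simp del: pair_proj)
  show "\<alpha> X Y Z = \<langle>\<p>\<^sub>1 X Y \<cdot> \<p>\<^sub>1 (X \<boxtimes> Y) Z, \<langle>\<p>\<^sub>2 X Y \<cdot> \<p>\<^sub>1 (X \<boxtimes> Y) Z, \<p>\<^sub>2 (X \<boxtimes> Y) Z\<rangle>\<rangle>" if "Z \<in> Obj C"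
    using assms that associator_pair(1)[of "\<p>\<^sub>1 X Y \<cdot> \<p>\<^sub>1 (X \<boxtimes> Y) Z" "\<p>\<^sub>2 X Y \<cdot> \<p>\<^sub>1 (X \<boxtimes> Y) Z" "\<p>\<^sub>2 (X \<boxtimes> Y) Z" X Y Z]
    by (simp add: pair_proj_comp del: associator_pair)
  show "\<alpha>' X Y Z = \<langle>\<langle>\<p>\<^sub>1 X (Y \<boxtimes> Z), \<p>\<^sub>1 Y Z \<cdot> \<p>\<^sub>2 X (Y \<boxtimes> Z)\<rangle>, \<p>\<^sub>2 Y Z \<cdot> \<p>\<^sub>2 X (Y \<boxtimes> Z)\<rangle>" if "Z \<in> Obj C"
    using assms that associator_pair(2)[of "\<p>\<^sub>1 X (Y \<boxtimes> Z)" "\<p>\<^sub>1 Y Z \<cdot> \<p>\<^sub>2 X (Y \<boxtimes> Z)" "\<p>\<^sub>2 Y Z \<cdot> \<p>\<^sub>2 X (Y \<boxtimes> Z)" X Y Z]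
    by (simp add: pair_proj_comp del: associator_pair)
qed

lemma det_structural [simp]:
  assumes "X \<in> Obj C" "Y \<in> Obj C"
  shows "det (\<sigma> X Y)" "Z \<in> Obj C \<Longrightarrow> det (\<alpha> X Y Z)" "Z \<in> Obj C \<Longrightarrow> det (\<alpha>' X Y Z)"
  using assms by (simp_all add: structural_eq_pair del: pair_proj)

lemma det_unitor [simp]:
  assumes "X \<in> Obj C"
  shows "det (\<l> X)" "det (\<r> X)" "det (\<l>' X)" "det (\<r>' X)"
  using assms det_fst[of X \<I>] det_snd[of \<I> X]
  by (simp_all add: unitor_inv_eq_pair snd_left_unit fst_right_unit)

lemma det_ext:
  assumes "det f" "det g" "Dom C f = Dom C g" "Cod C f = X \<boxtimes> Y" "Cod C g = X \<boxtimes> Y"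
    "X \<in> Obj C" "Y \<in> Obj C"
    "\<p>\<^sub>1 X Y \<cdot> f = \<p>\<^sub>1 X Y \<cdot> g" "\<p>\<^sub>2 X Y \<cdot> f = \<p>\<^sub>2 X Y \<cdot> g"
  shows "f = g"
  using pair_proj_comp[of f X Y] pair_proj_comp[of g X Y] assms by metis

text \<open>Effects on a fixed object form a commutative monoid under copying, with discarding as
  unit; this is its action on the morphisms out of that object. Caps enter all later formulas as
  such weights.\<close>

definition scale :: "'m \<Rightarrow> 'm \<Rightarrow> 'm"
  where "scale e f = \<r> (Cod C f) \<cdot> \<langle>f, e\<rangle>"

lemma scale_arr [simp]:
  assumes "f \<in> Arr C" "e \<in> Arr C" "Dom C f = Dom C e" "Cod C e = \<I>"
  shows "scale e f \<in> Arr C" "Dom C (scale e f) = Dom C e" "Cod C (scale e f) = Cod C f"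
  using assms by (simp_all add: scale_def)

lemma comp_scale:
  assumes "f \<in> Arr C" "e \<in> Arr C" "Dom C f = Dom C e" "Cod C e = \<I>" "h \<in> Arr C" "Dom C h = Cod C f"
  shows "h \<cdot> scale e f = scale e (h \<cdot> f)"
proof -
  have "scale e (h \<cdot> f) = \<r> (Cod C h) \<cdot> (h \<otimes> \<i>\<d> \<I>) \<cdot> \<langle>f, e\<rangle>"
    using assms by (simp add: scale_def)
  also have "\<dots> = (h \<cdot> \<r> (Cod C f)) \<cdot> \<langle>f, e\<rangle>"
    using assms right_unitor_nat[of h] by (intro comp_eqI) simp_all
  finally show ?thesis using assms by (simp add: scale_def)
qed

lemma scale_comp_det:
  assumes "f \<in> Arr C" "e \<in> Arr C" "Dom C f = Dom C e" "Cod C e = \<I>" "det h" "Cod C h = Dom C e"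
  shows "scale e f \<cdot> h = scale (e \<cdot> h) (f \<cdot> h)"
  using assms by (simp add: scale_def)

lemma scale_pair_right:
  assumes "f \<in> Arr C" "g \<in> Arr C" "e \<in> Arr C" "Dom C f = Dom C e" "Dom C g = Dom C e" "Cod C e = \<I>"
  shows "\<langle>f, scale e g\<rangle> = scale e \<langle>f, g\<rangle>"
proof -
  have "scale e \<langle>f, g\<rangle> = ((\<i>\<d> (Cod C f) \<otimes> \<r> (Cod C g)) \<cdot> \<alpha> (Cod C f) (Cod C g) \<I>) \<cdot> \<langle>\<langle>f, g\<rangle>, e\<rangle>"
    using assms by (simp add: scale_def right_unitor_tensor del: assoc)
  also have "\<dots> = \<langle>f, scale e g\<rangle>"
    using assms by (simp add: scale_def)
  finally show ?thesis by simp
qed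

lemma scale_pair_left:
  assumes "f \<in> Arr C" "g \<in> Arr C" "e \<in> Arr C" "Dom C f = Dom C e" "Dom C g = Dom C e" "Cod C e = \<I>"
  shows "\<langle>scale e f, g\<rangle> = scale e \<langle>f, g\<rangle>"
proof -
  have "\<langle>scale e f, g\<rangle> = \<sigma> (Cod C g) (Cod C f) \<cdot> \<langle>g, scale e f\<rangle>"
    using assms by simp
  also have "\<dots> = scale e \<langle>f, g\<rangle>"
    using assms by (simp add: scale_pair_right comp_scale)
  finally show ?thesis .
qed

lemma scale_commute:
  assumes "d \<in> Arr C" "e \<in> Arr C" "Dom C d = Dom C e" "Cod C d = \<I>" "Cod C e = \<I>"
  shows "scale d e = scale e d"
proof -
  have "scale d e = \<r> \<I> \<cdot> \<sigma> \<I> \<I> \<cdot> \<langle>d, e\<rangle>"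
    using assms by (simp add: scale_def)
  then show ?thesis using assms by (simp add: symmetry_unit scale_def)
qed

lemma scale_scale:
  assumes "f \<in> Arr C" "d \<in> Arr C" "e \<in> Arr C" "Dom C f = Dom C e" "Dom C d = Dom C e"
    "Cod C d = \<I>" "Cod C e = \<I>"
  shows "scale (scale e d) f = scale e (scale d f)"
proof -
  have "scale (scale e d) f = \<r> (Cod C f) \<cdot> scale e \<langle>f, d\<rangle>"
    using assms by (simp add: scale_def[of "scale e d"] scale_pair_right)
  also have "\<dots> = scale e (scale d f)"
    using assms by (simp add: comp_scale scale_def[of d])
  finally show ?thesis .
qed

lemma scale_discard:
  assumes "f \<in> Arr C" "Dom C f = X"
  shows "scale (\<epsilon> X) f = f"
  using assms by (simp add: scale_def)

lemma scale_effect_discard: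
  assumes "e \<in> Arr C" "Dom C e = X" "Cod C e = \<I>"
  shows "scale e (\<epsilon> X) = e"
proof -
  have "X \<in> Obj C" using assms by auto
  then show ?thesis using assms scale_commute[of e "\<epsilon> X"] by (simp add: scale_discard)
qed

text \<open>Here \<open>u\<close> may fail to be copyable, so \<open>pair_comp_det\<close> does not
  apply. But \<open>\<p>\<^sub>2\<close> discards the first factor, so pairing with it only copies
  \<open>Y\<close>, and this copy meets only \<open>v\<close>.\<close>

lemma keep_snd_pair:
  assumes "h \<in> Arr C" "Dom C h = X \<boxtimes> Y" "X \<in> Obj C" "Y \<in> Obj C"
    "u \<in> Arr C" "det v" "Dom C u = Dom C v" "Cod C u = X" "Cod C v = Y"
  shows "\<langle>h, \<p>\<^sub>2 X Y\<rangle> \<cdot> \<langle>u, v\<rangle> = \<langle>h \<cdot> \<langle>u, v\<rangle>, v\<rangle>"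
proof -
  have "\<alpha>' X Y Y \<cdot> (\<i>\<d> X \<otimes> \<Delta> Y) = \<alpha>' X Y Y \<cdot> (\<i>\<d> X \<otimes> \<Delta> Y) \<cdot> \<langle>\<p>\<^sub>1 X Y, \<p>\<^sub>2 X Y\<rangle>"
    using assms(3,4) by simp
  also have "\<dots> = \<langle>\<i>\<d> (X \<boxtimes> Y), \<p>\<^sub>2 X Y\<rangle>"
    using assms(3,4) by (simp add: det_copy del: pair_proj) simp
  finally have dup: "\<langle>\<i>\<d> (X \<boxtimes> Y), \<p>\<^sub>2 X Y\<rangle> = \<alpha>' X Y Y \<cdot> (\<i>\<d> X \<otimes> \<Delta> Y)" by simp
  have "\<langle>h, \<p>\<^sub>2 X Y\<rangle> \<cdot> \<langle>u, v\<rangle> = (h \<otimes> \<i>\<d> Y) \<cdot> \<langle>\<i>\<d> (X \<boxtimes> Y), \<p>\<^sub>2 X Y\<rangle> \<cdot> \<langle>u, v\<rangle>"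
    using assms tensor_pair[of "\<i>\<d> (X \<boxtimes> Y)" "\<p>\<^sub>2 X Y" h "\<i>\<d> Y"]
    by (subst comp_eqI[where k="\<langle>h, \<p>\<^sub>2 X Y\<rangle>"]) simp_all
  also have "\<dots> = \<langle>h \<cdot> \<langle>u, v\<rangle>, v\<rangle>"
    unfolding dup using assms by (simp add: det_copy)
  finally show ?thesis .
qed

text \<open>Used to bring the observed object, or a newly sampled factor, next to the first of two
  factors, so that a map reading only these two can be tensored with an identity.\<close>

definition rotate :: "'o \<Rightarrow> 'o \<Rightarrow> 'o \<Rightarrow> 'm"
  where "rotate X Y Z = \<alpha>' X Z Y \<cdot> (\<i>\<d> X \<otimes> \<sigma> Y Z) \<cdot> \<alpha> X Y Z"

lemma rotate_arr [simp]:
  assumes "X \<in> Obj C" "Y \<in> Obj C" "Z \<in> Obj C"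
  shows "rotate X Y Z \<in> Arr C" "Dom C (rotate X Y Z) = (X \<boxtimes> Y) \<boxtimes> Z"
    "Cod C (rotate X Y Z) = (X \<boxtimes> Z) \<boxtimes> Y"
  using assms by (simp_all add: rotate_def)

lemma rotate_pair [simp]:
  assumes "f \<in> Arr C" "g \<in> Arr C" "h \<in> Arr C" "Dom C f = Dom C h" "Dom C g = Dom C h"
    "Cod C f = X" "Cod C g = Y" "Cod C h = Z"
  shows "rotate X Y Z \<cdot> \<langle>\<langle>f, g\<rangle>, h\<rangle> = \<langle>\<langle>f, h\<rangle>, g\<rangle>"
proof -
  have "X \<in> Obj C" "Y \<in> Obj C" "Z \<in> Obj C" using assms by auto
  then show ?thesis using assms by (simp add: rotate_def)
qed

lemma rotate_eq_pair:
  assumes "X \<in> Obj C" "Y \<in> Obj C" "Z \<in> Obj C"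
  shows "rotate X Y Z = \<langle>\<langle>\<p>\<^sub>1 X Y \<cdot> \<p>\<^sub>1 (X \<boxtimes> Y) Z, \<p>\<^sub>2 (X \<boxtimes> Y) Z\<rangle>, \<p>\<^sub>2 X Y \<cdot> \<p>\<^sub>1 (X \<boxtimes> Y) Z\<rangle>"
  unfolding rotate_def structural_eq_pair(2)[OF assms] using assms by simp

end

section \<open>Conditioning by caps\<close>

context effect_conditioning
begin

section \<open>Caps as weights that compare two values\<close>

lemma cap_arr [simp]:
  assumes "X \<in> Obj C"
  shows "cap X \<in> Arr C" "Dom C (cap X) = X \<boxtimes> X" "Cod C (cap X) = \<I>"
  using cap_in[OF assms] by (simp_all add: hom_iff)

text \<open>The slide axiom evaluated at \<open>\<langle>u, v\<rangle>\<close>: its left side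
  outputs the copy of \<open>v\<close>, its right side the copy of \<open>u\<close>, both with the
  weight that compares the two.\<close>

lemma cap_scale_slide:
  assumes "det u" "det v" "Dom C u = Dom C v" "Cod C u = X" "Cod C v = X"
  shows "scale (cap X \<cdot> \<langle>u, v\<rangle>) u = scale (cap X \<cdot> \<langle>u, v\<rangle>) v"
proof -
  have X: "X \<in> Obj C" using assms by auto
  let ?e = "cap X \<cdot> \<langle>u, v\<rangle>"
  have "scale ?e v = \<r> X \<cdot> \<sigma> \<I> X \<cdot> \<langle>?e, v\<rangle>"
    using assms X by (simp add: scale_def)
  also have "\<dots> = \<l> X \<cdot> \<langle>?e, v\<rangle>"
    using assms X left_unitor_symmetry(2)[OF X] by (intro comp_eqI) simp_all
  also have "\<dots> = (\<l> X \<cdot> (cap X \<otimes> \<i>\<d> X) \<cdot> \<alpha>' X X X \<cdot> (\<i>\<d> X \<otimes> \<Delta> X)) \<cdot> \<langle>u, v\<rangle>"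
    using assms X by (simp add: det_copy)
  also have "\<dots> = (\<r> X \<cdot> (\<i>\<d> X \<otimes> cap X) \<cdot> \<alpha> X X X \<cdot> (\<Delta> X \<otimes> \<i>\<d> X)) \<cdot> \<langle>u, v\<rangle>"
    using X by (simp only: cap_copy_slide)
  also have "\<dots> = scale ?e u"
    using assms X by (simp add: det_copy scale_def)
  finally show ?thesis by simp
qed

lemma cap_slide:
  assumes "det u" "det v" "Dom C u = Dom C v" "Cod C u = X" "Cod C v = X"
    "f \<in> Arr C" "Dom C f = Dom C v" "h \<in> Arr C" "Dom C h = Cod C f \<boxtimes> X"
  shows "scale (cap X \<cdot> \<langle>u, v\<rangle>) (h \<cdot> \<langle>f, u\<rangle>) = scale (cap X \<cdot> \<langle>u, v\<rangle>) (h \<cdot> \<langle>f, v\<rangle>)"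
proof -
  have X: "X \<in> Obj C" using assms by auto
  let ?e = "cap X \<cdot> \<langle>u, v\<rangle>"
  have "scale ?e (h \<cdot> \<langle>f, u\<rangle>) = h \<cdot> \<langle>f, scale ?e u\<rangle>"
    using assms X by (simp add: comp_scale scale_pair_right)
  also have "\<dots> = h \<cdot> \<langle>f, scale ?e v\<rangle>"
    using cap_scale_slide[OF assms(1-5)] by simp
  also have "\<dots> = scale ?e (h \<cdot> \<langle>f, v\<rangle>)"
    using assms X by (simp add: comp_scale scale_pair_right)
  finally show ?thesis .
qed

text \<open>Both sides are cap effects, and caps are unique: by the slide law each of two such effects
  absorbs the other, so both equal their product.\<close>

lemma cap_iso:
  assumes p: "det p" "det q" "p \<cdot> q = \<i>\<d> X" "q \<cdot> p = \<i>\<d> Y"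
    and obj: "Dom C p = Y" "Cod C p = X" "Dom C q = X" "Cod C q = Y"
    and uv: "det u" "det v" "Dom C u = Dom C v" "Cod C u = Y" "Cod C v = X"
  shows "cap X \<cdot> \<langle>p \<cdot> u, v\<rangle> = cap Y \<cdot> \<langle>u, q \<cdot> v\<rangle>"
proof -
  let ?d = "cap X \<cdot> \<langle>p \<cdot> u, v\<rangle>" and ?e = "cap Y \<cdot> \<langle>u, q \<cdot> v\<rangle>"
  have X: "X \<in> Obj C" "Y \<in> Obj C" using obj p by auto
  have qp: "q \<cdot> p \<cdot> u = u" and pq: "p \<cdot> q \<cdot> v = v"
    using comp_eqI[OF p(4), of u] comp_eqI[OF p(3), of v] p obj uv by simp_all
  \<comment> \<open>Under the weight \<open>?d\<close> the value \<open>v\<close> may be replaced by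
    \<open>p \<cdot> u\<close>. This puts \<open>u\<close> in both arguments of
    \<open>cap Y\<close>, and a cap on a copied value is a discard.\<close>
  have "scale ?d ?e = scale ?d (((cap Y) \<cdot> (\<i>\<d> Y \<otimes> q)) \<cdot> \<langle>u, v\<rangle>)"
    using p obj uv X by simp
  also have "\<dots> = scale ?d ((cap Y \<cdot> (\<i>\<d> Y \<otimes> q)) \<cdot> \<langle>u, p \<cdot> u\<rangle>)"
    using p obj uv X by (intro cap_slide[symmetric]) simp_all
  also have "\<dots> = scale ?d (cap Y \<cdot> \<Delta> Y \<cdot> u)"
    using p(1-2) obj uv X by (simp add: qp det_copy)
  also have "\<dots> = ?d"
    using p obj uv X by (subst comp_eqI[OF cap_copy]) (simp_all add: scale_effect_discard)
  finally have d: "scale ?d ?e = ?d" .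
  have "scale ?e ?d = scale ?e ((cap X \<cdot> \<sigma> X X \<cdot> (\<i>\<d> X \<otimes> p)) \<cdot> \<langle>v, u\<rangle>)"
    using p obj uv X by simp
  also have "\<dots> = scale ?e ((cap X \<cdot> \<sigma> X X \<cdot> (\<i>\<d> X \<otimes> p)) \<cdot> \<langle>v, q \<cdot> v\<rangle>)"
    using p obj uv X by (intro cap_slide) simp_all
  also have "\<dots> = scale ?e (cap X \<cdot> \<Delta> X \<cdot> v)"
    using p(1-2) obj uv X by (simp add: pq det_copy)
  also have "\<dots> = ?e"
    using p obj uv X by (subst comp_eqI[OF cap_copy]) (simp_all add: scale_effect_discard)
  finally have e: "scale ?e ?d = ?e" .
  show ?thesis using d e scale_commute[of ?d ?e] p obj uv X by simp
qed

text \<open>The part of \<open>cap_right\<close> that comes after the state. Laws about densities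
  are proved for this map on the whole of \<open>(F \<boxtimes> W) \<boxtimes> W\<close>, whose
  projections are deterministic and so may be slid through the cap; the state, possibly not
  copyable, is inserted last by \<open>density_eq\<close>.\<close>

definition cap_join :: "'o \<Rightarrow> 'o \<Rightarrow> 'm"
  where "cap_join F W = \<r> F \<cdot> (\<i>\<d> F \<otimes> cap W) \<cdot> \<alpha> F W W"

text \<open>The conditional of a state of \<open>F \<otimes> W\<close> on \<open>W\<close> before normalisation.\<close>

definition density :: "'o \<Rightarrow> 'o \<Rightarrow> 'm \<Rightarrow> 'm"
  where "density F W N = cap_right C F W N \<cdot> \<l>' W"

lemma cap_join_arr [simp]:
  assumes "F \<in> Obj C" "W \<in> Obj C"
  shows "cap_join F W \<in> Arr C" "Dom C (cap_join F W) = (F \<boxtimes> W) \<boxtimes> W" "Cod C (cap_join F W) = F"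
  using assms by (simp_all add: cap_join_def)

lemma cap_join_pair:
  assumes "f \<in> Arr C" "u \<in> Arr C" "v \<in> Arr C" "Dom C f = Dom C v" "Dom C u = Dom C v"
    "Cod C f = F" "Cod C u = W" "Cod C v = W"
  shows "cap_join F W \<cdot> \<langle>\<langle>f, u\<rangle>, v\<rangle> = scale (cap W \<cdot> \<langle>u, v\<rangle>) f"
proof -
  have "F \<in> Obj C" "W \<in> Obj C" using assms by auto
  then show ?thesis using assms by (simp add: cap_join_def scale_def)
qed

lemma density_eq:
  assumes "N \<in> hom \<I> (F \<boxtimes> W)" "F \<in> Obj C" "W \<in> Obj C"
  shows "density F W N = cap_join F W \<cdot> \<langle>N \<cdot> \<epsilon> W, \<i>\<d> W\<rangle>"
  using assms by (simp add: density_def cap_right_def cap_join_def hom_iff unitor_inv_eq_pair)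

lemma density_in:
  assumes "N \<in> hom \<I> (F \<boxtimes> W)" "F \<in> Obj C" "W \<in> Obj C"
  shows "density F W N \<in> hom W F"
  using assms by (simp add: density_eq[OF assms] hom_iff)

lemma density_arr [simp]:
  assumes "N \<in> Arr C" "Dom C N = \<I>" "Cod C N = F \<boxtimes> W" "F \<in> Obj C" "W \<in> Obj C"
  shows "density F W N \<in> Arr C" "Dom C (density F W N) = W" "Cod C (density F W N) = F"
  using density_in[of N F W] assms by (simp_all add: hom_iff)

lemma density_post:
  assumes "N \<in> hom \<I> (F \<boxtimes> W)" "W \<in> Obj C" "h \<in> hom F F'"
  shows "density F' W ((h \<otimes> \<i>\<d> W) \<cdot> N) = h \<cdot> density F W N"
proof -
  have obj: "F \<in> Obj C" "F' \<in> Obj C" using assms(3) by (auto simp: hom_iff)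
  have "cap_join F' W \<cdot> ((h \<otimes> \<i>\<d> W) \<otimes> \<i>\<d> W) = \<r> F' \<cdot> (h \<otimes> \<i>\<d> \<I>) \<cdot> (\<i>\<d> F \<otimes> cap W) \<cdot> \<alpha> F W W"
    using assms obj by (simp add: cap_join_def hom_iff associator_nat)
  also have "\<dots> = (h \<cdot> \<r> F) \<cdot> (\<i>\<d> F \<otimes> cap W) \<cdot> \<alpha> F W W"
    using assms obj right_unitor_nat[of h] by (intro comp_eqI) (simp_all add: hom_iff)
  finally have join: "cap_join F' W \<cdot> ((h \<otimes> \<i>\<d> W) \<otimes> \<i>\<d> W) = h \<cdot> cap_join F W"
    using assms obj by (simp add: cap_join_def hom_iff)
  have "density F' W ((h \<otimes> \<i>\<d> W) \<cdot> N)
      = cap_join F' W \<cdot> ((h \<otimes> \<i>\<d> W) \<otimes> \<i>\<d> W) \<cdot> \<langle>N \<cdot> \<epsilon> W, \<i>\<d> W\<rangle>"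
    using assms obj by (simp add: density_eq hom_iff)
  also have "\<dots> = (h \<cdot> cap_join F W) \<cdot> \<langle>N \<cdot> \<epsilon> W, \<i>\<d> W\<rangle>"
    using assms obj by (intro comp_eqI join) (simp_all add: hom_iff)
  also have "\<dots> = h \<cdot> density F W N"
    using assms obj by (simp add: density_eq hom_iff)
  finally show ?thesis .
qed

text \<open>On the left \<open>h\<close> reads the observed factor inside the state. The slide law
  lets it read the value supplied to the cap instead, which is the argument of the density and thus
  still available outside.\<close>

lemma density_extend:
  assumes "N \<in> hom \<I> (F \<boxtimes> W)" "F \<in> Obj C" "W \<in> Obj C" "h \<in> hom (F \<boxtimes> W) F'"
  shows "density F' W (\<langle>h, \<p>\<^sub>2 F W\<rangle> \<cdot> N) = h \<cdot> \<langle>density F W N, \<i>\<d> W\<rangle>"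
proof -
  have obj: "F' \<in> Obj C" using assms(4) by (auto simp: hom_iff)
  let ?q = "\<p>\<^sub>1 (F \<boxtimes> W) W"
  let ?f = "\<p>\<^sub>1 F W \<cdot> ?q" and ?w = "\<p>\<^sub>2 F W \<cdot> ?q" and ?v = "\<p>\<^sub>2 (F \<boxtimes> W) W"
  let ?e = "cap W \<cdot> \<langle>?w, ?v\<rangle>"
  have q: "?q = \<langle>?f, ?w\<rangle>" using assms by (simp add: pair_proj_comp)
  have join: "cap_join F W = scale ?e ?f"
    using assms obj cap_join_pair[of ?f ?w ?v F W] by (simp add: pair_proj_comp)
  have "cap_join F' W \<cdot> (\<langle>h, \<p>\<^sub>2 F W\<rangle> \<otimes> \<i>\<d> W) = cap_join F' W \<cdot> \<langle>\<langle>h \<cdot> ?q, ?w\<rangle>, ?v\<rangle>"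
    using assms obj by (simp add: tensor_eq_pair hom_iff)
  also have "\<dots> = scale ?e (h \<cdot> ?q)"
    using assms obj by (intro cap_join_pair) (simp_all add: hom_iff)
  also have "\<dots> = scale ?e (h \<cdot> \<langle>?f, ?w\<rangle>)"
    using q by simp
  also have "\<dots> = scale ?e (h \<cdot> \<langle>?f, ?v\<rangle>)"
    using assms obj by (intro cap_slide) (simp_all add: hom_iff)
  also have "\<dots> = h \<cdot> \<langle>cap_join F W, ?v\<rangle>"
    unfolding join using assms obj by (simp add: hom_iff comp_scale scale_pair_left)
  finally have eq: "cap_join F' W \<cdot> (\<langle>h, \<p>\<^sub>2 F W\<rangle> \<otimes> \<i>\<d> W) = h \<cdot> \<langle>cap_join F W, ?v\<rangle>" .
  have "density F' W (\<langle>h, \<p>\<^sub>2 F W\<rangle> \<cdot> N)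
      = cap_join F' W \<cdot> (\<langle>h, \<p>\<^sub>2 F W\<rangle> \<otimes> \<i>\<d> W) \<cdot> \<langle>N \<cdot> \<epsilon> W, \<i>\<d> W\<rangle>"
    using assms obj by (simp add: density_eq hom_iff)
  also have "\<dots> = (h \<cdot> \<langle>cap_join F W, ?v\<rangle>) \<cdot> \<langle>N \<cdot> \<epsilon> W, \<i>\<d> W\<rangle>"
    using assms obj by (intro comp_eqI eq) (simp_all add: hom_iff)
  also have "\<dots> = h \<cdot> \<langle>density F W N, \<i>\<d> W\<rangle>"
    using assms obj by (simp add: density_eq hom_iff keep_snd_pair)
  finally show ?thesis .
qed

text \<open>The network lists the observed vertices in topological order, the claim in the order of
  the given enumeration. By \<open>cap_iso\<close>, relabelling the observed object by
  \<open>p\<close> amounts to relabelling the supplied value by its inverse.\<close>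

lemma density_iso:
  assumes "N \<in> hom \<I> (F \<boxtimes> W)" "F \<in> Obj C"
    and p: "det p" "det q" "p \<cdot> q = \<i>\<d> W'" "q \<cdot> p = \<i>\<d> W" "p \<in> hom W W'" "q \<in> hom W' W"
  shows "density F W' ((\<i>\<d> F \<otimes> p) \<cdot> N) = density F W N \<cdot> q"
proof -
  have W: "W \<in> Obj C" "W' \<in> Obj C" using p(5) by (auto simp: hom_iff)
  let ?q = "\<p>\<^sub>1 (F \<boxtimes> W) W'"
  let ?f = "\<p>\<^sub>1 F W \<cdot> ?q" and ?w = "\<p>\<^sub>2 F W \<cdot> ?q" and ?v = "\<p>\<^sub>2 (F \<boxtimes> W) W'"
  have q: "\<langle>?f, ?w\<rangle> = ?q" using assms W by (simp add: pair_proj_comp)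
  have "cap_join F W' \<cdot> ((\<i>\<d> F \<otimes> p) \<otimes> \<i>\<d> W') = cap_join F W' \<cdot> \<langle>\<langle>?f, p \<cdot> ?w\<rangle>, ?v\<rangle>"
    using assms W by (simp add: tensor_eq_pair hom_iff)
  also have "\<dots> = scale (cap W' \<cdot> \<langle>p \<cdot> ?w, ?v\<rangle>) ?f"
    using assms W by (intro cap_join_pair) (simp_all add: hom_iff)
  also have "\<dots> = scale (cap W \<cdot> \<langle>?w, q \<cdot> ?v\<rangle>) ?f"
    using assms W by (subst cap_iso[OF p(1-4)]) (simp_all add: hom_iff)
  also have "\<dots> = cap_join F W \<cdot> \<langle>\<langle>?f, ?w\<rangle>, q \<cdot> ?v\<rangle>"
    using assms W by (intro cap_join_pair[symmetric]) (simp_all add: hom_iff)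
  also have "\<dots> = cap_join F W \<cdot> (\<i>\<d> (F \<boxtimes> W) \<otimes> q)"
    unfolding q using assms W by (simp add: tensor_eq_pair hom_iff)
  finally have eq: "cap_join F W' \<cdot> ((\<i>\<d> F \<otimes> p) \<otimes> \<i>\<d> W') = cap_join F W \<cdot> (\<i>\<d> (F \<boxtimes> W) \<otimes> q)" .
  have "density F W' ((\<i>\<d> F \<otimes> p) \<cdot> N)
      = cap_join F W' \<cdot> ((\<i>\<d> F \<otimes> p) \<otimes> \<i>\<d> W') \<cdot> \<langle>N \<cdot> \<epsilon> W', \<i>\<d> W'\<rangle>"
    using assms W by (simp add: density_eq hom_iff)
  also have "\<dots> = (cap_join F W \<cdot> (\<i>\<d> (F \<boxtimes> W) \<otimes> q)) \<cdot> \<langle>N \<cdot> \<epsilon> W', \<i>\<d> W'\<rangle>"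
    using assms W by (intro comp_eqI eq) (simp_all add: hom_iff)
  also have "\<dots> = density F W N \<cdot> q"
    using assms W by (simp add: density_eq hom_iff)
  finally show ?thesis .
qed

lemma cap_tensor_pair:
  assumes "f \<in> Arr C" "g \<in> Arr C" "h \<in> Arr C" "k \<in> Arr C"
    "Dom C f = Dom C k" "Dom C g = Dom C k" "Dom C h = Dom C k"
    "Cod C f = X" "Cod C g = Y" "Cod C h = X" "Cod C k = Y"
  shows "cap (X \<boxtimes> Y) \<cdot> \<langle>\<langle>f, g\<rangle>, \<langle>h, k\<rangle>\<rangle> = scale (cap X \<cdot> \<langle>f, h\<rangle>) (cap Y \<cdot> \<langle>g, k\<rangle>)"
proof -
  have "X \<in> Obj C" "Y \<in> Obj C" using assms by auto
  then show ?thesis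
    using assms scale_commute[of "cap X \<cdot> \<langle>f, h\<rangle>" "cap Y \<cdot> \<langle>g, k\<rangle>"]
    by (simp add: cap_tensor scale_def left_eq_right_unitor)
qed

text \<open>Observing a newly computed \<open>X\<close> multiplies the density by the effect that
  compares the computed with the supplied value. The computation \<open>g\<close> reads the observed
  \<open>W\<close>, which the cap on \<open>W\<close> again lets one replace by the supplied
  one.\<close>

lemma density_extend_condition:
  assumes "N \<in> hom \<I> (F \<boxtimes> W)" "F \<in> Obj C" "W \<in> Obj C" "g \<in> hom (F \<boxtimes> W) X"
  shows "density F (W \<boxtimes> X) (\<langle>\<p>\<^sub>1 F W, \<langle>\<p>\<^sub>2 F W, g\<rangle>\<rangle> \<cdot> N)
    = scale (cap X \<cdot> (g \<otimes> \<i>\<d> X) \<cdot> \<alpha>' F W X) (\<p>\<^sub>1 F (W \<boxtimes> X))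
      \<cdot> \<langle>density F W N \<cdot> \<p>\<^sub>1 W X, \<i>\<d> (W \<boxtimes> X)\<rangle>"
proof -
  have X: "X \<in> Obj C" using assms(4) by (auto simp: hom_iff)
  have g: "g \<in> Arr C" "Dom C g = F \<boxtimes> W" "Cod C g = X" using assms(4) by (simp_all add: hom_iff)
  have N: "N \<in> Arr C" "Dom C N = \<I>" "Cod C N = F \<boxtimes> W" using assms(1) by (simp_all add: hom_iff)
  let ?U = "W \<boxtimes> X"
  let ?q = "\<p>\<^sub>1 (F \<boxtimes> W) ?U" and ?u = "\<p>\<^sub>2 (F \<boxtimes> W) ?U"
  let ?f = "\<p>\<^sub>1 F W \<cdot> ?q" and ?w = "\<p>\<^sub>2 F W \<cdot> ?q"
  let ?v = "\<p>\<^sub>1 W X \<cdot> ?u" and ?x = "\<p>\<^sub>2 W X \<cdot> ?u"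
  let ?e = "cap W \<cdot> \<langle>?w, ?v\<rangle>"
  define Q where "Q = scale (cap X \<cdot> (g \<otimes> \<i>\<d> X) \<cdot> \<alpha>' F W X) (\<p>\<^sub>1 F ?U)"
  have Q: "Q \<in> Arr C" "Dom C Q = F \<boxtimes> ?U" "Cod C Q = F"
    using assms X g by (simp_all add: Q_def)
  have q: "\<langle>?f, ?w\<rangle> = ?q" and u: "\<langle>?v, ?x\<rangle> = ?u" using assms X by (simp_all add: pair_proj_comp)
  have Qw: "scale (cap X \<cdot> \<langle>g \<cdot> ?q, ?x\<rangle>) ?f = Q \<cdot> \<langle>?f, \<langle>?w, ?x\<rangle>\<rangle>"
    unfolding Q_def using assms(2,3) X g by (simp add: scale_comp_det q)
  have "cap_join F ?U \<cdot> (\<langle>\<p>\<^sub>1 F W, \<langle>\<p>\<^sub>2 F W, g\<rangle>\<rangle> \<otimes> \<i>\<d> ?U)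
      = cap_join F ?U \<cdot> \<langle>\<langle>?f, \<langle>?w, g \<cdot> ?q\<rangle>\<rangle>, ?u\<rangle>"
    using assms(2,3) X g by (simp add: tensor_eq_pair)
  also have "\<dots> = scale (cap ?U \<cdot> \<langle>\<langle>?w, g \<cdot> ?q\<rangle>, ?u\<rangle>) ?f"
    using assms(2,3) X g by (intro cap_join_pair) simp_all
  also have "\<dots> = scale (cap ?U \<cdot> \<langle>\<langle>?w, g \<cdot> ?q\<rangle>, \<langle>?v, ?x\<rangle>\<rangle>) ?f"
    unfolding u ..
  also have "\<dots> = scale (scale ?e (cap X \<cdot> \<langle>g \<cdot> ?q, ?x\<rangle>)) ?f"
    using assms(2,3) X g by (subst cap_tensor_pair) simp_all
  also have "\<dots> = scale ?e (Q \<cdot> \<langle>?f, \<langle>?w, ?x\<rangle>\<rangle>)"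
    unfolding Qw[symmetric] using assms(2,3) X g by (intro scale_scale) simp_all
  \<comment> \<open>\<open>cap_slide\<close> exchanges only the last component of a pair, so
    \<open>?w\<close> is first moved there.\<close>
  also have "\<dots> = scale ?e ((Q \<cdot> (\<i>\<d> F \<otimes> \<sigma> X W) \<cdot> \<alpha> F X W) \<cdot> \<langle>\<langle>?f, ?x\<rangle>, ?w\<rangle>)"
    using assms(2,3) X g Q by simp
  also have "\<dots> = scale ?e ((Q \<cdot> (\<i>\<d> F \<otimes> \<sigma> X W) \<cdot> \<alpha> F X W) \<cdot> \<langle>\<langle>?f, ?x\<rangle>, ?v\<rangle>)"
    using assms(2,3) X g Q by (intro cap_slide) simp_all
  also have "\<dots> = scale ?e (Q \<cdot> \<langle>?f, ?u\<rangle>)"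
    using assms(2,3) X g Q by (simp add: u)
  also have "\<dots> = Q \<cdot> \<langle>scale ?e ?f, ?u\<rangle>"
    using assms(2,3) X g Q by (simp add: comp_scale scale_pair_left)
  also have "scale ?e ?f = cap_join F W \<cdot> \<langle>\<langle>?f, ?w\<rangle>, ?v\<rangle>"
    using assms(2,3) X g Q by (intro cap_join_pair[symmetric]) simp_all
  also have "\<dots> = cap_join F W \<cdot> (\<i>\<d> (F \<boxtimes> W) \<otimes> \<p>\<^sub>1 W X)"
    unfolding q using assms(2,3) X by (simp add: tensor_eq_pair)
  finally have eq: "cap_join F ?U \<cdot> (\<langle>\<p>\<^sub>1 F W, \<langle>\<p>\<^sub>2 F W, g\<rangle>\<rangle> \<otimes> \<i>\<d> ?U)
      = Q \<cdot> \<langle>cap_join F W \<cdot> (\<i>\<d> (F \<boxtimes> W) \<otimes> \<p>\<^sub>1 W X), ?u\<rangle>" .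
  have "density F ?U (\<langle>\<p>\<^sub>1 F W, \<langle>\<p>\<^sub>2 F W, g\<rangle>\<rangle> \<cdot> N)
      = cap_join F ?U \<cdot> (\<langle>\<p>\<^sub>1 F W, \<langle>\<p>\<^sub>2 F W, g\<rangle>\<rangle> \<otimes> \<i>\<d> ?U) \<cdot> \<langle>N \<cdot> \<epsilon> ?U, \<i>\<d> ?U\<rangle>"
    using assms(2,3) X g N by (simp add: density_eq hom_iff)
  also have "\<dots> = (Q \<cdot> \<langle>cap_join F W \<cdot> (\<i>\<d> (F \<boxtimes> W) \<otimes> \<p>\<^sub>1 W X), ?u\<rangle>) \<cdot> \<langle>N \<cdot> \<epsilon> ?U, \<i>\<d> ?U\<rangle>"
    using assms(2,3) X g N by (intro comp_eqI eq) simp_all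
  also have "\<dots> = Q \<cdot> \<langle>density F W N \<cdot> \<p>\<^sub>1 W X, \<i>\<d> ?U\<rangle>"
    using assms(1-3) X N Q by (simp add: density_eq keep_snd_pair)
  finally show ?thesis unfolding Q_def .
qed

text \<open>The invariant of the induction. It constrains the unnormalised conditional, since later
  steps compose it with maps that \<open>norm\<close> is not assumed to respect.\<close>

definition splits :: "'o \<Rightarrow> 'o \<Rightarrow> 'o \<Rightarrow> 'm \<Rightarrow> bool"
  where "splits A B W N \<longleftrightarrow> A \<in> Obj C \<and> B \<in> Obj C \<and> W \<in> Obj C \<and> N \<in> hom \<I> ((A \<boxtimes> B) \<boxtimes> W) \<and>
    (\<exists>\<phi>\<in>hom W A. \<exists>\<psi>\<in>hom W B. density (A \<boxtimes> B) W N = \<langle>\<phi>, \<psi>\<rangle>)"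

lemma splitsE:
  assumes "splits A B W N"
  obtains \<phi> \<psi> where "A \<in> Obj C" "B \<in> Obj C" "W \<in> Obj C"
    "N \<in> Arr C" "Dom C N = \<I>" "Cod C N = (A \<boxtimes> B) \<boxtimes> W"
    "\<phi> \<in> Arr C" "Dom C \<phi> = W" "Cod C \<phi> = A" "\<psi> \<in> Arr C" "Dom C \<psi> = W" "Cod C \<psi> = B"
    "density (A \<boxtimes> B) W N = \<langle>\<phi>, \<psi>\<rangle>"
  using assms by (auto simp: splits_def hom_iff)

lemma splitsI:
  assumes "N \<in> Arr C" "Dom C N = \<I>" "Cod C N = (A \<boxtimes> B) \<boxtimes> W" "A \<in> Obj C" "B \<in> Obj C" "W \<in> Obj C"
    "\<phi> \<in> Arr C" "Dom C \<phi> = W" "Cod C \<phi> = A" "\<psi> \<in> Arr C" "Dom C \<psi> = W" "Cod C \<psi> = B"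
    "density (A \<boxtimes> B) W N = \<langle>\<phi>, \<psi>\<rangle>"
  shows "splits A B W N"
  unfolding splits_def using assms by (intro conjI bexI[of _ \<phi>] bexI[of _ \<psi>]) (simp_all add: hom_iff)

lemma splits_post:
  assumes "splits A B W N" "f \<in> hom A A'" "g \<in> hom B B'"
  shows "splits A' B' W (((f \<otimes> g) \<otimes> \<i>\<d> W) \<cdot> N)"
proof -
  obtain \<phi> \<psi> where s: "A \<in> Obj C" "B \<in> Obj C" "W \<in> Obj C"
    "N \<in> Arr C" "Dom C N = \<I>" "Cod C N = (A \<boxtimes> B) \<boxtimes> W"
    "\<phi> \<in> Arr C" "Dom C \<phi> = W" "Cod C \<phi> = A" "\<psi> \<in> Arr C" "Dom C \<psi> = W" "Cod C \<psi> = B"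
    "density (A \<boxtimes> B) W N = \<langle>\<phi>, \<psi>\<rangle>" using splitsE[OF assms(1)] .
  have fg: "f \<in> Arr C" "Dom C f = A" "Cod C f = A'" "g \<in> Arr C" "Dom C g = B" "Cod C g = B'"
    using assms(2,3) by (simp_all add: hom_iff)
  then have obj: "A' \<in> Obj C" "B' \<in> Obj C" by auto
  have "density (A' \<boxtimes> B') W (((f \<otimes> g) \<otimes> \<i>\<d> W) \<cdot> N) = \<langle>f \<cdot> \<phi>, g \<cdot> \<psi>\<rangle>"
    using s fg obj by (subst density_post[where F="A \<boxtimes> B"]) (simp_all add: hom_iff)
  then show ?thesis using s fg obj by (intro splitsI) simp_all
qed

lemma splits_swap:
  assumes "splits A B W N"
  shows "splits B A W ((\<sigma> A B \<otimes> \<i>\<d> W) \<cdot> N)"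
proof -
  obtain \<phi> \<psi> where s: "A \<in> Obj C" "B \<in> Obj C" "W \<in> Obj C"
    "N \<in> Arr C" "Dom C N = \<I>" "Cod C N = (A \<boxtimes> B) \<boxtimes> W"
    "\<phi> \<in> Arr C" "Dom C \<phi> = W" "Cod C \<phi> = A" "\<psi> \<in> Arr C" "Dom C \<psi> = W" "Cod C \<psi> = B"
    "density (A \<boxtimes> B) W N = \<langle>\<phi>, \<psi>\<rangle>" using splitsE[OF assms(1)] .
  have "density (B \<boxtimes> A) W ((\<sigma> A B \<otimes> \<i>\<d> W) \<cdot> N) = \<langle>\<psi>, \<phi>\<rangle>"
    using s by (subst density_post[where F="A \<boxtimes> B"]) (simp_all add: hom_iff)
  then show ?thesis using s by (intro splitsI) simp_all
qed

lemma splits_iso: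
  assumes "splits A B W N"
    and p: "det p" "det q" "p \<cdot> q = \<i>\<d> W'" "q \<cdot> p = \<i>\<d> W" "p \<in> hom W W'" "q \<in> hom W' W"
  shows "splits A B W' ((\<i>\<d> (A \<boxtimes> B) \<otimes> p) \<cdot> N)"
proof -
  obtain \<phi> \<psi> where s: "A \<in> Obj C" "B \<in> Obj C" "W \<in> Obj C"
    "N \<in> Arr C" "Dom C N = \<I>" "Cod C N = (A \<boxtimes> B) \<boxtimes> W"
    "\<phi> \<in> Arr C" "Dom C \<phi> = W" "Cod C \<phi> = A" "\<psi> \<in> Arr C" "Dom C \<psi> = W" "Cod C \<psi> = B"
    "density (A \<boxtimes> B) W N = \<langle>\<phi>, \<psi>\<rangle>" using splitsE[OF assms(1)] .
  have pq: "p \<in> Arr C" "Dom C p = W" "Cod C p = W'" "q \<in> Arr C" "Dom C q = W'" "Cod C q = W"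
    using p(5,6) by (simp_all add: hom_iff)
  then have W': "W' \<in> Obj C" by auto
  have "density (A \<boxtimes> B) W' ((\<i>\<d> (A \<boxtimes> B) \<otimes> p) \<cdot> N) = \<langle>\<phi> \<cdot> q, \<psi> \<cdot> q\<rangle>"
    using s pq p(2) by (subst density_iso[OF _ _ p]) (simp_all add: hom_iff)
  then show ?thesis using s pq W' by (intro splitsI) simp_all
qed

lemma splits_extend:
  assumes "splits A B W N" "c \<in> hom (A \<boxtimes> W) X"
    and defs: "a = \<p>\<^sub>1 A B \<cdot> \<p>\<^sub>1 (A \<boxtimes> B) W" "b = \<p>\<^sub>2 A B \<cdot> \<p>\<^sub>1 (A \<boxtimes> B) W" "w = \<p>\<^sub>2 (A \<boxtimes> B) W"
  shows "splits (A \<boxtimes> X) B W (\<langle>\<langle>\<langle>a, c \<cdot> \<langle>a, w\<rangle>\<rangle>, b\<rangle>, w\<rangle> \<cdot> N)"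
proof -
  obtain \<phi> \<psi> where s: "A \<in> Obj C" "B \<in> Obj C" "W \<in> Obj C"
    "N \<in> Arr C" "Dom C N = \<I>" "Cod C N = (A \<boxtimes> B) \<boxtimes> W"
    "\<phi> \<in> Arr C" "Dom C \<phi> = W" "Cod C \<phi> = A" "\<psi> \<in> Arr C" "Dom C \<psi> = W" "Cod C \<psi> = B"
    "density (A \<boxtimes> B) W N = \<langle>\<phi>, \<psi>\<rangle>" using splitsE[OF assms(1)] .
  have c: "c \<in> Arr C" "Dom C c = A \<boxtimes> W" "Cod C c = X" using assms(2) by (simp_all add: hom_iff)
  then have X: "X \<in> Obj C" by auto
  \<comment> \<open>With \<open>W\<close> moved next to \<open>A\<close>, the update acts on these
    two alone and leaves the \<open>B\<close> component untouched.\<close>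
  have eq: "\<langle>\<langle>a, c \<cdot> \<langle>a, w\<rangle>\<rangle>, b\<rangle> = (\<langle>\<p>\<^sub>1 A W, c\<rangle> \<otimes> \<i>\<d> B) \<cdot> rotate A B W"
    using s c X by (simp add: rotate_eq_pair defs)
  have "density ((A \<boxtimes> X) \<boxtimes> B) W (\<langle>\<langle>\<langle>a, c \<cdot> \<langle>a, w\<rangle>\<rangle>, b\<rangle>, w\<rangle> \<cdot> N)
      = ((\<langle>\<p>\<^sub>1 A W, c\<rangle> \<otimes> \<i>\<d> B) \<cdot> rotate A B W) \<cdot> \<langle>\<langle>\<phi>, \<psi>\<rangle>, \<i>\<d> W\<rangle>"
    unfolding eq unfolding defs(3) using s c X by (subst density_extend[where F="A \<boxtimes> B"]) (simp_all add: hom_iff)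
  also have "\<dots> = \<langle>\<langle>\<p>\<^sub>1 A W, c\<rangle> \<cdot> \<langle>\<phi>, \<i>\<d> W\<rangle>, \<psi>\<rangle>"
    using s c X by simp
  finally show ?thesis
    using s c X by (intro splitsI[where \<phi>="\<langle>\<p>\<^sub>1 A W, c\<rangle> \<cdot> \<langle>\<phi>, \<i>\<d> W\<rangle>" and \<psi>=\<psi>]) (simp_all add: defs)
qed

lemma splits_condition:
  assumes "splits A B W N" "c \<in> hom (A \<boxtimes> W) X"
    and defs: "a = \<p>\<^sub>1 A B \<cdot> \<p>\<^sub>1 (A \<boxtimes> B) W" "w = \<p>\<^sub>2 (A \<boxtimes> B) W"
  shows "splits A B (W \<boxtimes> X) (\<langle>\<p>\<^sub>1 (A \<boxtimes> B) W, \<langle>w, c \<cdot> \<langle>a, w\<rangle>\<rangle>\<rangle> \<cdot> N)"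
proof -
  obtain \<phi> \<psi> where s: "A \<in> Obj C" "B \<in> Obj C" "W \<in> Obj C"
    "N \<in> Arr C" "Dom C N = \<I>" "Cod C N = (A \<boxtimes> B) \<boxtimes> W"
    "\<phi> \<in> Arr C" "Dom C \<phi> = W" "Cod C \<phi> = A" "\<psi> \<in> Arr C" "Dom C \<psi> = W" "Cod C \<psi> = B"
    "density (A \<boxtimes> B) W N = \<langle>\<phi>, \<psi>\<rangle>" using splitsE[OF assms(1)] .
  have c: "c \<in> Arr C" "Dom C c = A \<boxtimes> W" "Cod C c = X" using assms(2) by (simp_all add: hom_iff)
  then have X: "X \<in> Obj C" by auto
  let ?U = "W \<boxtimes> X"
  let ?f = "\<p>\<^sub>1 (A \<boxtimes> B) ?U" and ?u = "\<p>\<^sub>2 (A \<boxtimes> B) ?U"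
  let ?g = "c \<cdot> \<langle>a, w\<rangle>"
  let ?a = "\<p>\<^sub>1 A B \<cdot> ?f" and ?b = "\<p>\<^sub>2 A B \<cdot> ?f" and ?v = "\<p>\<^sub>1 W X \<cdot> ?u" and ?x = "\<p>\<^sub>2 W X \<cdot> ?u"
  \<comment> \<open>\<open>q\<close> weights its \<open>A\<close> argument by the comparison of the
    value computed by \<open>c\<close> with the supplied \<open>X\<close>. The weight does not
    involve \<open>B\<close>, so it can be absorbed entirely into the first component of the
    product.\<close>
  define q where "q = scale (cap X \<cdot> (c \<otimes> \<i>\<d> X) \<cdot> \<alpha>' A W X) (\<p>\<^sub>1 A ?U)"
  have q: "q \<in> Arr C" "Dom C q = A \<boxtimes> ?U" "Cod C q = A" using s c X by (simp_all add: q_def)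
  let ?e = "cap X \<cdot> \<langle>c \<cdot> \<langle>?a, ?v\<rangle>, ?x\<rangle>"
  have u: "\<langle>?v, ?x\<rangle> = ?u" and ab: "\<langle>?a, ?b\<rangle> = ?f" using s X by (simp_all add: pair_proj_comp)
  have "q \<cdot> \<langle>?a, \<langle>?v, ?x\<rangle>\<rangle> = scale ?e ?a"
    unfolding q_def using s c X by (simp add: scale_comp_det)
  then have "(q \<otimes> \<i>\<d> B) \<cdot> rotate A B ?U = \<langle>scale ?e ?a, ?b\<rangle>"
    using s c X q by (simp add: rotate_eq_pair u)
  also have "\<dots> = scale ?e \<langle>?a, ?b\<rangle>"
    using s c X by (intro scale_pair_left) simp_all
  also have "?e = (cap X \<cdot> (?g \<otimes> \<i>\<d> X) \<cdot> \<alpha>' (A \<boxtimes> B) W X) \<cdot> \<langle>?f, \<langle>?v, ?x\<rangle>\<rangle>"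
    using s c X by (simp add: defs)
  also have "\<dots> = cap X \<cdot> (?g \<otimes> \<i>\<d> X) \<cdot> \<alpha>' (A \<boxtimes> B) W X"
    using s c X by (simp add: u defs)
  finally have eq: "scale (cap X \<cdot> (?g \<otimes> \<i>\<d> X) \<cdot> \<alpha>' (A \<boxtimes> B) W X) ?f = (q \<otimes> \<i>\<d> B) \<cdot> rotate A B ?U"
    by (simp add: ab)
  have "density (A \<boxtimes> B) ?U (\<langle>\<p>\<^sub>1 (A \<boxtimes> B) W, \<langle>w, ?g\<rangle>\<rangle> \<cdot> N)
    = scale (cap X \<cdot> (?g \<otimes> \<i>\<d> X) \<cdot> \<alpha>' (A \<boxtimes> B) W X) ?f \<cdot> \<langle>\<langle>\<phi>, \<psi>\<rangle> \<cdot> \<p>\<^sub>1 W X, \<i>\<d> ?U\<rangle>"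
    unfolding defs(2) s(13)[symmetric]
    using s(1-12) c X by (intro density_extend_condition) (simp_all add: hom_iff defs)
  also have "\<dots> = \<langle>q \<cdot> \<langle>\<phi> \<cdot> \<p>\<^sub>1 W X, \<i>\<d> ?U\<rangle>, \<psi> \<cdot> \<p>\<^sub>1 W X\<rangle>"
    unfolding eq using s(1-12) c X q by simp
  finally show ?thesis
    using s c X q by (intro splitsI[where \<phi>="q \<cdot> \<langle>\<phi> \<cdot> \<p>\<^sub>1 W X, \<i>\<d> ?U\<rangle>" and \<psi>="\<psi> \<cdot> \<p>\<^sub>1 W X"])
      (simp_all add: defs)
qed

section \<open>Normalising a product\<close>

lemma norm_arr [simp]:
  assumes "f \<in> Arr C"
  shows "norm f \<in> Arr C" "Dom C (norm f) = Dom C f" "Cod C (norm f) = Cod C f"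
  using norm_in[of f "Dom C f" "Cod C f"] assms by (simp_all add: hom_iff)

lemma norm_ide: "X \<in> Obj C \<Longrightarrow> norm (\<i>\<d> X) = \<i>\<d> X"
  by (rule norm_of_partial_channel) (simp add: is_partial_channel_def copy_discard_right)

lemma norm_pair:
  assumes "f \<in> Arr C" "g \<in> Arr C" "Dom C f = Dom C g"
  shows "norm \<langle>f, g\<rangle> = \<langle>norm f, norm g\<rangle>"
  using assms norm_copy[of "Dom C g" "f \<otimes> g" "Cod C f \<boxtimes> Cod C g"]
  by (simp add: pair_def hom_iff norm_tensor)

text \<open>The axioms move \<open>norm\<close> past a unitor only on the codomain side, whereas
  \<open>state_conditional\<close> has one on the domain side. Naturality of the left unitor carries
  it across, at the price of a tensor factor \<open>\<i>\<d> \<I>\<close>, which is its own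
  normalisation.\<close>

lemma norm_left_unitor_inv:
  assumes "f \<in> Arr C" "Dom C f = \<I> \<boxtimes> W" "W \<in> Obj C"
  shows "norm f \<cdot> \<l>' W = norm (f \<cdot> \<l>' W)"
proof -
  have Y: "Cod C f \<in> Obj C" using assms by simp
  let ?f = "f \<cdot> \<l>' W"
  have "f = ?f \<cdot> \<l> W" using assms by simp
  also have "\<dots> = \<l> (Cod C f) \<cdot> (\<i>\<d> \<I> \<otimes> ?f)"
    using left_unitor_nat[of ?f] assms by simp
  finally have "norm f = norm (\<l> (Cod C f) \<cdot> (\<i>\<d> \<I> \<otimes> ?f))" by simp
  also have "\<dots> = \<l> (Cod C f) \<cdot> norm (\<i>\<d> \<I> \<otimes> ?f)"
    using assms Y norm_left_unitor[of "Cod C f" "\<i>\<d> \<I> \<otimes> ?f" "\<I> \<boxtimes> W"] by (simp add: hom_iff)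
  also have "\<dots> = \<l> (Cod C f) \<cdot> (\<i>\<d> \<I> \<otimes> norm ?f)"
    using assms by (simp add: norm_tensor norm_ide)
  also have "\<dots> = norm ?f \<cdot> \<l> W"
    using left_unitor_nat[of "norm ?f"] assms by simp
  finally have "norm f \<cdot> \<l>' W = (norm ?f \<cdot> \<l> W) \<cdot> \<l>' W" by simp
  then show ?thesis using assms by simp
qed

lemma state_conditional_eq:
  assumes "N \<in> hom \<I> (F \<boxtimes> W)" "F \<in> Obj C" "W \<in> Obj C"
  shows "state_conditional C F W N = norm (density F W N)"
  using assms norm_left_unitor_inv[of "cap_right C F W N" W]
  by (simp add: state_conditional_def conditional_def density_def cap_right_def hom_iff)

lemma norm_scale:
  assumes "f \<in> Arr C" "g \<in> Arr C" "Dom C f = Dom C g" "Cod C g = Y"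
  shows "norm (scale (\<epsilon> Y \<cdot> g) f) = scale (\<epsilon> Y \<cdot> norm g) (norm f)"
proof -
  have Y: "Y \<in> Obj C" using assms by auto
  have "norm (scale (\<epsilon> Y \<cdot> g) f) = \<r> (Cod C f) \<cdot> norm \<langle>f, \<epsilon> Y \<cdot> g\<rangle>"
    unfolding scale_def using assms Y by (intro norm_right_unitor[of _ _ "Dom C g"]) (simp_all add: hom_iff)
  also have "\<dots> = scale (\<epsilon> Y \<cdot> norm g) (norm f)"
    using assms Y norm_discard[of g "Dom C g" Y] by (simp add: norm_pair scale_def hom_iff)
  finally show ?thesis .
qed

lemma scale_norm_self:
  assumes "f \<in> Arr C" "Cod C f = Y"
  shows "scale (\<epsilon> Y \<cdot> norm f) (norm f) = norm f"
proof -
  have "Y \<in> Obj C" using assms by auto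
  then show ?thesis
    using norm_partial_channel[of f] assms by (simp add: is_partial_channel_def scale_def pair_def)
qed

text \<open>Marginalising a product leaves on each component the total weight of the other one.
  After normalisation these weights are the domain effects of the partial channels
  \<open>norm \<phi>\<close> and \<open>norm \<psi>\<close>.\<close>

lemma splits_state_conditional:
  assumes "splits A B W N"
  shows "state_conditional C (A \<boxtimes> B) W N =
    \<langle>state_conditional C A W ((\<p>\<^sub>1 A B \<otimes> \<i>\<d> W) \<cdot> N), state_conditional C B W ((\<p>\<^sub>2 A B \<otimes> \<i>\<d> W) \<cdot> N)\<rangle>"
proof -
  obtain \<phi> \<psi> where s: "A \<in> Obj C" "B \<in> Obj C" "W \<in> Obj C"
    "N \<in> Arr C" "Dom C N = \<I>" "Cod C N = (A \<boxtimes> B) \<boxtimes> W"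
    "\<phi> \<in> Arr C" "Dom C \<phi> = W" "Cod C \<phi> = A" "\<psi> \<in> Arr C" "Dom C \<psi> = W" "Cod C \<psi> = B"
    "density (A \<boxtimes> B) W N = \<langle>\<phi>, \<psi>\<rangle>" using splitsE[OF assms(1)] .
  let ?d = "\<epsilon> A \<cdot> norm \<phi>" and ?e = "\<epsilon> B \<cdot> norm \<psi>"
  have p1: "\<p>\<^sub>1 A B \<cdot> \<langle>\<phi>, \<psi>\<rangle> = scale (\<epsilon> B \<cdot> \<psi>) \<phi>"
    using s by (simp add: fst_arr_def scale_def)
  \<comment> \<open>The second projection ends in a left unitor while \<open>scale\<close> uses the
    right one; the symmetry converts between them.\<close>
  have "\<p>\<^sub>2 A B \<cdot> \<langle>\<phi>, \<psi>\<rangle> = (\<r> B \<cdot> \<sigma> \<I> B) \<cdot> \<langle>\<epsilon> A \<cdot> \<phi>, \<psi>\<rangle>"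
    using s by (simp add: snd_arr_def left_unitor_symmetry del: assoc) simp
  then have p2: "\<p>\<^sub>2 A B \<cdot> \<langle>\<phi>, \<psi>\<rangle> = scale (\<epsilon> A \<cdot> \<phi>) \<psi>"
    using s by (simp add: scale_def)
  have A: "state_conditional C A W ((\<p>\<^sub>1 A B \<otimes> \<i>\<d> W) \<cdot> N) = scale ?e (norm \<phi>)"
    using s by (simp add: state_conditional_eq hom_iff density_post[of _ "A \<boxtimes> B"] p1 norm_scale)
  have B: "state_conditional C B W ((\<p>\<^sub>2 A B \<otimes> \<i>\<d> W) \<cdot> N) = scale ?d (norm \<psi>)"
    using s by (simp add: state_conditional_eq hom_iff density_post[of _ "A \<boxtimes> B"] p2 norm_scale)
  \<comment> \<open>Weights move freely between the components of a pair, so each is transferred to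
    the component whose own domain effect it is and vanishes there by
    \<open>scale_norm_self\<close>.\<close>
  have "\<langle>scale ?e (norm \<phi>), scale ?d (norm \<psi>)\<rangle> = scale ?d (scale ?e \<langle>norm \<phi>, norm \<psi>\<rangle>)"
    using s by (simp add: scale_pair_right scale_pair_left)
  also have "\<dots> = scale ?d \<langle>norm \<phi>, scale ?e (norm \<psi>)\<rangle>"
    using s by (simp add: scale_pair_right)
  also have "\<dots> = \<langle>scale ?d (norm \<phi>), scale ?e (norm \<psi>)\<rangle>"
    using s by (simp add: scale_pair_left)
  also have "\<dots> = \<langle>norm \<phi>, norm \<psi>\<rangle>"
    using s by (simp add: scale_norm_self)
  finally show ?thesis
    unfolding A B using s by (simp add: state_conditional_eq hom_iff norm_pair)
qed

lemma splits_unit: "splits \<I> \<I> \<I> \<langle>\<langle>\<i>\<d> \<I>, \<i>\<d> \<I>\<rangle>, \<i>\<d> \<I>\<rangle>"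
proof (rule splitsI[where \<phi>="\<i>\<d> \<I>" and \<psi>="\<i>\<d> \<I>"])
  have "cap \<I> \<cdot> \<langle>\<i>\<d> \<I>, \<i>\<d> \<I>\<rangle> = \<i>\<d> \<I>"
    using unitor_pair(1)[of "\<i>\<d> \<I>" \<I> \<I>] by (simp add: cap_unit discard_unit)
  then have "cap_join (\<I> \<boxtimes> \<I>) \<I> \<cdot> \<langle>\<langle>\<langle>\<i>\<d> \<I>, \<i>\<d> \<I>\<rangle>, \<i>\<d> \<I>\<rangle>, \<i>\<d> \<I>\<rangle> = \<langle>\<i>\<d> \<I>, \<i>\<d> \<I>\<rangle>"
    using scale_discard[of "\<langle>\<i>\<d> \<I>, \<i>\<d> \<I>\<rangle>" \<I>] by (simp add: cap_join_pair discard_unit)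
  then show "density (\<I> \<boxtimes> \<I>) \<I> \<langle>\<langle>\<i>\<d> \<I>, \<i>\<d> \<I>\<rangle>, \<i>\<d> \<I>\<rangle> = \<langle>\<i>\<d> \<I>, \<i>\<d> \<I>\<rangle>"
    by (simp add: density_eq hom_iff discard_unit)
qed simp_all

end

section \<open>Tensor products of families of objects\<close>

locale object_family = cd_category C for C :: "('o, 'm, 'z) cd_scheme" (structure) +
  fixes ob :: "'v \<Rightarrow> 'o" and V :: "'v set"
  assumes ob_in [simp]: "v \<in> V \<Longrightarrow> ob v \<in> Obj C"
begin

abbreviation tlist :: "'v list \<Rightarrow> 'o"  (\<open>\<T>\<close>)
  where "\<T> xs \<equiv> tensor_list C ob xs"

lemma tensor_list_in [simp]: "set xs \<subseteq> V \<Longrightarrow> \<T> xs \<in> Obj C"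
  by (induction xs) simp_all

text \<open>The value at the empty list is arbitrary; the typing facts assume that \<open>y\<close>
  occurs in the list. For a duplicate-free list these maps play the role of the projections of a
  finite product.\<close>

primrec prj :: "'v \<Rightarrow> 'v list \<Rightarrow> 'm" where
  "prj y [] = undefined"
| "prj y (x # xs) = (if x = y then \<p>\<^sub>2 (\<T> xs) (ob x) else prj y xs \<cdot> \<p>\<^sub>1 (\<T> xs) (ob x))"

lemma prj_det:
  assumes "set xs \<subseteq> V" "y \<in> set xs"
  shows "det (prj y xs) \<and> Dom C (prj y xs) = \<T> xs \<and> Cod C (prj y xs) = ob y"
  using assms by (induction xs) auto

lemma prj_arr [simp]:
  assumes "set xs \<subseteq> V" "y \<in> set xs"
  shows "det (prj y xs)" "Dom C (prj y xs) = \<T> xs" "Cod C (prj y xs) = ob y"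
  using prj_det[OF assms] by simp_all

text \<open>The empty tensor is terminal among channels, and \<open>det_ext\<close> splits off one
  factor at a time. Every later identity between reorderings rests on this.\<close>

lemma prj_ext:
  assumes "det f" "det g" "Dom C f = Dom C g" "Cod C f = \<T> ys" "Cod C g = \<T> ys"
    "set ys \<subseteq> V" "distinct ys" "\<And>y. y \<in> set ys \<Longrightarrow> prj y ys \<cdot> f = prj y ys \<cdot> g"
  shows "f = g"
  using assms
proof (induction ys arbitrary: f g)
  case Nil
  then show ?case using channel_unit[of f] channel_unit[of g] by simp
next
  case (Cons y ys)
  let ?p = "\<p>\<^sub>1 (\<T> ys) (ob y)"
  note fg = Cons.prems(1-6)
  show ?case
  proof (rule det_ext[where X="\<T> ys" and Y="ob y"])
    show "\<p>\<^sub>2 (\<T> ys) (ob y) \<cdot> f = \<p>\<^sub>2 (\<T> ys) (ob y) \<cdot> g"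
      using Cons.prems(8)[of y] by simp
    show "?p \<cdot> f = ?p \<cdot> g"
    proof (rule Cons.IH)
      fix z assume z: "z \<in> set ys"
      then have "z \<noteq> y" using Cons.prems(7) by auto
      then show "prj z ys \<cdot> ?p \<cdot> f = prj z ys \<cdot> ?p \<cdot> g"
        using Cons.prems(8)[of z] z fg by simp
    qed (use fg Cons.prems(7) in simp_all)
  qed (use fg in simp_all)
qed

lemma remove1_subset [simp]: "set xs \<subseteq> V \<Longrightarrow> set (remove1 y xs) \<subseteq> V"
  using set_remove1_subset[of y xs] by blast

lemma extract_factor_det:
  assumes "set xs \<subseteq> V" "y \<in> set xs"
  shows "det (extract_factor C ob y xs) \<and> Dom C (extract_factor C ob y xs) = \<T> xs \<and>
    Cod C (extract_factor C ob y xs) = \<T> (remove1 y xs) \<boxtimes> ob y"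
proof -
  have "y \<in> V" using assms by blast
  then show ?thesis using assms by (induction xs) (auto simp: Let_def)
qed

lemma extract_factor_arr [simp]:
  assumes "set xs \<subseteq> V" "y \<in> set xs"
  shows "det (extract_factor C ob y xs)" "Dom C (extract_factor C ob y xs) = \<T> xs"
    "Cod C (extract_factor C ob y xs) = \<T> (remove1 y xs) \<boxtimes> ob y"
  using extract_factor_det[OF assms] by simp_all

lemma extract_factor_Cons:
  assumes "set (x # xs) \<subseteq> V" "y \<in> set xs" "x \<noteq> y"
  shows "extract_factor C ob y (x # xs) =
    (let R = \<T> (remove1 y xs); e = extract_factor C ob y xs \<cdot> \<p>\<^sub>1 (\<T> xs) (ob x) in
      \<langle>\<langle>\<p>\<^sub>1 R (ob y) \<cdot> e, \<p>\<^sub>2 (\<T> xs) (ob x)\<rangle>, \<p>\<^sub>2 R (ob y) \<cdot> e\<rangle>)"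
proof -
  let ?R = "\<T> (remove1 y xs)" and ?e = "extract_factor C ob y xs \<cdot> \<p>\<^sub>1 (\<T> xs) (ob x)"
  have y: "y \<in> V" using assms by auto
  have e: "?e = \<langle>\<p>\<^sub>1 ?R (ob y) \<cdot> ?e, \<p>\<^sub>2 ?R (ob y) \<cdot> ?e\<rangle>"
    using assms y by (intro pair_proj_comp[symmetric]) simp_all
  have "extract_factor C ob y xs \<otimes> \<i>\<d> (ob x) = \<langle>?e, \<p>\<^sub>2 (\<T> xs) (ob x)\<rangle>"
    using assms by (simp add: tensor_eq_pair)
  also have "\<dots> = \<langle>\<langle>\<p>\<^sub>1 ?R (ob y) \<cdot> ?e, \<p>\<^sub>2 ?R (ob y) \<cdot> ?e\<rangle>, \<p>\<^sub>2 (\<T> xs) (ob x)\<rangle>"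
    using e by simp
  finally show ?thesis using assms y by (simp add: Let_def)
qed

lemma prj_extract_factor:
  assumes "set xs \<subseteq> V" "y \<in> set xs"
  shows "\<p>\<^sub>2 (\<T> (remove1 y xs)) (ob y) \<cdot> extract_factor C ob y xs = prj y xs"
    and "\<lbrakk>z \<in> set xs; z \<noteq> y\<rbrakk> \<Longrightarrow>
      prj z (remove1 y xs) \<cdot> \<p>\<^sub>1 (\<T> (remove1 y xs)) (ob y) \<cdot> extract_factor C ob y xs = prj z xs"
proof -
  have y: "y \<in> V" using assms by auto
  show "\<p>\<^sub>2 (\<T> (remove1 y xs)) (ob y) \<cdot> extract_factor C ob y xs = prj y xs"
    using assms
  proof (induction xs)
    case (Cons x xs)
    show ?case
    proof (cases "x = y")
      case True
      then show ?thesis using Cons.prems by simp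
    next
      case False
      then have y': "y \<in> set xs" and xs: "set xs \<subseteq> V" and x: "x \<in> V" using Cons.prems by simp_all
      note IH = Cons.IH[OF xs y']
      show ?thesis
        using False x xs y y'
        by (simp add: extract_factor_Cons Let_def comp_eqI[OF IH] del: extract_factor.simps(2))
    qed
  qed simp
  show "prj z (remove1 y xs) \<cdot> \<p>\<^sub>1 (\<T> (remove1 y xs)) (ob y) \<cdot> extract_factor C ob y xs = prj z xs"
    if "z \<in> set xs" "z \<noteq> y"
    using assms that(1)
  proof (induction xs)
    case (Cons x xs)
    show ?case
    proof (cases "x = y")
      case True
      then show ?thesis using Cons.prems that(2) by simp
    next
      case False
      then have y': "y \<in> set xs" and xs: "set xs \<subseteq> V" and x: "x \<in> V" using Cons.prems by simp_all
      show ?thesis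
      proof (cases "x = z")
        case True
        then show ?thesis
          using False x xs y y'
          by (simp add: extract_factor_Cons Let_def del: extract_factor.simps(2))
      next
        case neq: False
        then have z: "z \<in> set xs" "z \<in> set (remove1 y xs)" using Cons.prems that(2) by simp_all
        let ?R = "\<T> (remove1 y xs)" and ?e = "extract_factor C ob y xs" and ?p = "\<p>\<^sub>1 (\<T> xs) (ob x)"
        have "prj z (remove1 y xs) \<cdot> \<p>\<^sub>1 ?R (ob y) \<cdot> ?e \<cdot> ?p = (prj z (remove1 y xs) \<cdot> \<p>\<^sub>1 ?R (ob y) \<cdot> ?e) \<cdot> ?p"
          using x xs y y' z by simp
        also have "\<dots> = prj z xs \<cdot> ?p" using Cons.IH[OF xs y' z(1)] by simp
        finally show ?thesis
          using False neq x xs y y' z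
          by (simp add: extract_factor_Cons Let_def del: extract_factor.simps(2))
      qed
    qed
  qed simp
qed

text \<open>Typing and projections share one induction, with \<open>xs\<close> arbitrary because
  each factor taken out shortens the source list. The projection clause determines the map by
  \<open>prj_ext\<close>.\<close>

lemma rearrange_det:
  assumes "set xs \<subseteq> V" "set ys \<subseteq> set xs" "distinct ys"
  shows "det (rearrange C ob ys xs) \<and> Dom C (rearrange C ob ys xs) = \<T> xs \<and>
    Cod C (rearrange C ob ys xs) = \<T> ys \<and>
    (\<forall>z\<in>set ys. prj z ys \<cdot> rearrange C ob ys xs = prj z xs)"
  using assms
proof (induction ys arbitrary: xs)
  case (Cons y ys)
  let ?zs = "remove1 y xs"
  have y: "y \<in> set xs" "y \<in> V" and sub: "set ys \<subseteq> set ?zs"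
    using Cons.prems by (auto intro: iffD2[OF in_set_remove1])
  have IH: "det (rearrange C ob ys ?zs)" "Dom C (rearrange C ob ys ?zs) = \<T> ?zs"
    "Cod C (rearrange C ob ys ?zs) = \<T> ys"
    "\<And>z. z \<in> set ys \<Longrightarrow> prj z ys \<cdot> rearrange C ob ys ?zs = prj z ?zs"
    using Cons.IH[of ?zs] Cons.prems sub by simp_all
  have ys: "set ys \<subseteq> V" using Cons.prems by auto
  have "prj z (y # ys) \<cdot> rearrange C ob (y # ys) xs = prj z xs" if z: "z \<in> set (y # ys)" for z
  proof (cases "z = y")
    case True
    then show ?thesis using y IH(1-3) ys Cons.prems(1)
      by (simp add: tensor_eq_pair prj_extract_factor)
  next
    case False
    then have "z \<in> set ys" "z \<in> set xs" using z Cons.prems by auto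
    then show ?thesis using False y IH ys Cons.prems(1)
      by (simp add: tensor_eq_pair comp_eqI[OF IH(4)] prj_extract_factor(2))
  qed
  then show ?case using IH(1-3) y Cons.prems(1) by simp
qed simp

lemma rearrange_arr [simp]:
  assumes "set xs \<subseteq> V" "set ys \<subseteq> set xs" "distinct ys"
  shows "det (rearrange C ob ys xs)" "Dom C (rearrange C ob ys xs) = \<T> xs"
    "Cod C (rearrange C ob ys xs) = \<T> ys"
    "z \<in> set ys \<Longrightarrow> prj z ys \<cdot> rearrange C ob ys xs = prj z xs"
  using rearrange_det[OF assms] by simp_all

lemma prj_rearrange_comp [simp]:
  assumes "set xs \<subseteq> V" "set ys \<subseteq> set xs" "distinct ys" "z \<in> set ys" "f \<in> Arr C" "Cod C f = \<T> xs"
  shows "prj z ys \<cdot> rearrange C ob ys xs \<cdot> f = prj z xs \<cdot> f"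
proof -
  have "set ys \<subseteq> V" using assms by auto
  then show ?thesis using assms by (intro comp_eqI) simp_all
qed

lemma rearrange_comp:
  assumes "set xs \<subseteq> V" "set ys \<subseteq> set xs" "set zs \<subseteq> set ys" "distinct ys" "distinct zs"
  shows "rearrange C ob zs ys \<cdot> rearrange C ob ys xs = rearrange C ob zs xs"
proof -
  have "set ys \<subseteq> V" "set zs \<subseteq> V" "set zs \<subseteq> set xs" using assms by auto
  then show ?thesis
    using assms by - (rule prj_ext[where ys=zs], auto)
qed

lemma rearrange_self:
  assumes "set xs \<subseteq> V" "distinct xs"
  shows "rearrange C ob xs xs = \<i>\<d> (\<T> xs)"
  using assms by - (rule prj_ext[where ys=xs], auto)

lemma rearrange_Cons:
  assumes "set xs \<subseteq> V" "set (y # ys) \<subseteq> set xs" "distinct (y # ys)"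
  shows "rearrange C ob (y # ys) xs = \<langle>rearrange C ob ys xs, prj y xs\<rangle>"
proof -
  have y: "y \<in> V" "set ys \<subseteq> V" using assms by auto
  show ?thesis
  proof (rule prj_ext[where ys="y # ys"])
    fix z assume z: "z \<in> set (y # ys)"
    show "prj z (y # ys) \<cdot> rearrange C ob (y # ys) xs = prj z (y # ys) \<cdot> \<langle>rearrange C ob ys xs, prj y xs\<rangle>"
      unfolding rearrange_arr(4)[OF assms z]
      using assms y z by (cases "z = y") auto
  qed (use assms y in \<open>simp_all del: rearrange.simps\<close>)
qed

lemma rearrange_skip:
  assumes "set (x # xs) \<subseteq> V" "set ys \<subseteq> set xs" "distinct ys" "x \<notin> set ys"
  shows "rearrange C ob ys (x # xs) = rearrange C ob ys xs \<cdot> \<p>\<^sub>1 (\<T> xs) (ob x)"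
proof -
  have ys: "set ys \<subseteq> V" "set ys \<subseteq> set (x # xs)" using assms by auto
  then show ?thesis
    using assms by - (rule prj_ext[where ys=ys], auto)
qed

text \<open>The trailing identity is what \<open>extract_factor\<close> yields when the wanted
  factor is already last; cancelling it would require typing assumptions.\<close>

lemma rearrange_keep:
  "rearrange C ob (x # ys) (x # xs) = (rearrange C ob ys xs \<otimes> \<i>\<d> (ob x)) \<cdot> \<i>\<d> (\<T> (x # xs))"
  by simp

lemma split_tensor_det:
  assumes "set xs \<subseteq> V" "set ys \<subseteq> V"
  shows "det (split_tensor C ob xs ys) \<and> Dom C (split_tensor C ob xs ys) = \<T> (ys @ xs) \<and>
    Cod C (split_tensor C ob xs ys) = \<T> xs \<boxtimes> \<T> ys"
  using assms by (induction ys) simp_all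

lemma split_tensor_arr [simp]:
  assumes "set xs \<subseteq> V" "set ys \<subseteq> V"
  shows "det (split_tensor C ob xs ys)" "Dom C (split_tensor C ob xs ys) = \<T> (ys @ xs)"
    "Cod C (split_tensor C ob xs ys) = \<T> xs \<boxtimes> \<T> ys"
  using split_tensor_det[OF assms] by simp_all

lemma split_tensor_eq_rearrange:
  assumes "set xs \<subseteq> V" "set ys \<subseteq> V" "distinct (ys @ xs)"
  shows "split_tensor C ob xs ys = \<langle>rearrange C ob xs (ys @ xs), rearrange C ob ys (ys @ xs)\<rangle>"
  using assms
proof (induction ys)
  case Nil
  then show ?case by (simp add: rearrange_self unitor_inv_eq_pair)
next
  case (Cons y ys)
  let ?a = "rearrange C ob xs (ys @ xs)" and ?b = "rearrange C ob ys (ys @ xs)"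
  let ?p = "\<p>\<^sub>1 (\<T> (ys @ xs)) (ob y)" and ?q = "\<p>\<^sub>2 (\<T> (ys @ xs)) (ob y)"
  have "split_tensor C ob xs ys \<otimes> \<i>\<d> (ob y) = \<langle>\<langle>?a \<cdot> ?p, ?b \<cdot> ?p\<rangle>, ?q\<rangle>"
    using Cons by (simp add: tensor_eq_pair)
  then have "split_tensor C ob xs (y # ys) = \<langle>?a \<cdot> ?p, \<langle>?b \<cdot> ?p, ?q\<rangle>\<rangle>"
    using Cons.prems by simp
  also have "?a \<cdot> ?p = rearrange C ob xs (y # ys @ xs)"
    using Cons.prems by (intro rearrange_skip[symmetric]) auto
  also have "\<langle>?b \<cdot> ?p, ?q\<rangle> = rearrange C ob (y # ys) (y # ys @ xs)"
    unfolding rearrange_keep using Cons.prems by (simp add: tensor_eq_pair)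
  finally show ?case by simp
qed

lemma split_tensor_rearrange:
  assumes "set vs \<subseteq> V" "set xs \<subseteq> set vs" "set ys \<subseteq> set vs" "distinct (ys @ xs)"
  shows "split_tensor C ob xs ys \<cdot> rearrange C ob (ys @ xs) vs = \<langle>rearrange C ob xs vs, rearrange C ob ys vs\<rangle>"
proof -
  have sub: "set xs \<subseteq> V" "set ys \<subseteq> V" using assms by auto
  have "split_tensor C ob xs ys \<cdot> rearrange C ob (ys @ xs) vs
      = \<langle>rearrange C ob xs (ys @ xs) \<cdot> rearrange C ob (ys @ xs) vs,
         rearrange C ob ys (ys @ xs) \<cdot> rearrange C ob (ys @ xs) vs\<rangle>"
    unfolding split_tensor_eq_rearrange[OF sub assms(4)]
    using assms sub by (intro pair_comp_det) auto
  also have "\<dots> = \<langle>rearrange C ob xs vs, rearrange C ob ys vs\<rangle>"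
    using assms by (simp add: rearrange_comp)
  finally show ?thesis .
qed

text \<open>Lets the channel of a vertex read its parents from two blocks of variables that together
  contain them. The map \<open>h\<close> is built from projections of the blocks, one parent at a
  time.\<close>

lemma rearrange_factor:
  assumes "set xs \<subseteq> V" "set as \<subseteq> set xs" "set bs \<subseteq> set xs" "set ps \<subseteq> set as \<union> set bs"
    "distinct as" "distinct bs" "distinct ps"
  shows "\<exists>h\<in>hom (\<T> as \<boxtimes> \<T> bs) (\<T> ps). h \<cdot> \<langle>rearrange C ob as xs, rearrange C ob bs xs\<rangle> = rearrange C ob ps xs"
proof -
  have ab: "set as \<subseteq> V" "set bs \<subseteq> V" using assms by auto
  let ?ab = "\<langle>rearrange C ob as xs, rearrange C ob bs xs\<rangle>"
  have "\<exists>h. det h \<and> Dom C h = \<T> as \<boxtimes> \<T> bs \<and> Cod C h = \<T> ps \<and> h \<cdot> ?ab = rearrange C ob ps xs"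
    using assms(4,7)
  proof (induction ps)
    case Nil
    then show ?case using assms ab by (intro exI[of _ "\<epsilon> (\<T> as \<boxtimes> \<T> bs)"]) simp
  next
    case (Cons y ps)
    then obtain h where h: "det h" "Dom C h = \<T> as \<boxtimes> \<T> bs" "Cod C h = \<T> ps" "h \<cdot> ?ab = rearrange C ob ps xs"
      by auto
    \<comment> \<open>Blocks may overlap; a common factor is read from the first.\<close>
    define k where "k = (if y \<in> set as then prj y as \<cdot> \<p>\<^sub>1 (\<T> as) (\<T> bs) else prj y bs \<cdot> \<p>\<^sub>2 (\<T> as) (\<T> bs))"
    have y: "y \<notin> set as \<Longrightarrow> y \<in> set bs" "y \<in> set xs" "set ps \<subseteq> set xs" using Cons.prems assms by auto
    have k: "det k" "Dom C k = \<T> as \<boxtimes> \<T> bs" "Cod C k = ob y" "k \<cdot> ?ab = prj y xs"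
      using assms ab y by (auto simp: k_def)
    have "\<langle>h, k\<rangle> \<cdot> ?ab = rearrange C ob (y # ps) xs"
      using assms ab y h k Cons.prems by (subst rearrange_Cons) auto
    then show ?case using h k by (intro exI[of _ "\<langle>h, k\<rangle>"]) simp
  qed
  then show ?thesis using det_arr by (auto simp: hom_iff)
qed

end

lemma restrict_list_simps [simp]:
  "restrict_list [] S = []"
  "restrict_list (x # xs) S = (if x \<in> S then x # restrict_list xs S else restrict_list xs S)"
  "set (restrict_list xs S) = set xs \<inter> S"
  "distinct xs \<Longrightarrow> distinct (restrict_list xs S)"
  by (auto simp: restrict_list_def)

locale variable_family = effect_conditioning C + object_family C ob V
  for C :: "('o, 'm, 'z) cd_ec_scheme" (structure) and ob :: "'v \<Rightarrow> 'o" and V :: "'v set"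
begin

text \<open>\<open>splits_extend\<close> transported to one step of the network. The rewriting is
  done on maps out of \<open>T\<close>, before the state \<open>s\<close> is composed.\<close>

lemma splits_sample:
  assumes "splits A B W (\<langle>\<langle>a, b\<rangle>, w\<rangle> \<cdot> s)" "s \<in> hom \<I> T" "det a" "det b" "det w"
    "a \<in> hom T A" "b \<in> hom T B" "w \<in> hom T W" "c \<in> hom (A \<boxtimes> W) X"
  shows "splits (A \<boxtimes> X) B W
    (\<langle>\<langle>a \<otimes> \<i>\<d> X, b \<cdot> \<p>\<^sub>1 T X\<rangle>, w \<cdot> \<p>\<^sub>1 T X\<rangle> \<cdot> \<langle>\<i>\<d> T, c \<cdot> \<langle>a, w\<rangle>\<rangle> \<cdot> s)"
proof -
  have arr: "s \<in> Arr C" "Dom C s = \<I>" "Cod C s = T" "Dom C a = T" "Cod C a = A" "Dom C b = T" "Cod C b = B"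
    "Dom C w = T" "Cod C w = W" "c \<in> Arr C" "Dom C c = A \<boxtimes> W" "Cod C c = X"
    using assms by (simp_all add: hom_iff)
  then have obj: "T \<in> Obj C" "A \<in> Obj C" "B \<in> Obj C" "W \<in> Obj C" "X \<in> Obj C"
    using assms(3-5) det_arr by auto
  let ?k = "c \<cdot> \<langle>a, w\<rangle>" and ?D = "(A \<boxtimes> B) \<boxtimes> W"
  let ?a = "\<p>\<^sub>1 A B \<cdot> \<p>\<^sub>1 (A \<boxtimes> B) W" and ?b = "\<p>\<^sub>2 A B \<cdot> \<p>\<^sub>1 (A \<boxtimes> B) W" and ?w = "\<p>\<^sub>2 (A \<boxtimes> B) W"
  \<comment> \<open>Since \<open>?k\<close> need not be copyable, the marginal cannot be distributed
    over \<open>\<langle>\<i>\<d> T, ?k\<rangle>\<close> by \<open>pair_comp_det\<close>. It is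
    factored into the old marginal tensored with an identity and two rotations, all of which act on
    arbitrary pairs.\<close>
  have "\<langle>\<langle>a \<otimes> \<i>\<d> X, b \<cdot> \<p>\<^sub>1 T X\<rangle>, w \<cdot> \<p>\<^sub>1 T X\<rangle>
      = (rotate A B X \<otimes> \<i>\<d> W) \<cdot> rotate (A \<boxtimes> B) W X \<cdot> (\<langle>\<langle>a, b\<rangle>, w\<rangle> \<otimes> \<i>\<d> X)"
    using arr obj assms(3-5) by (simp add: tensor_eq_pair[of a] tensor_eq_pair[of "\<langle>\<langle>a, b\<rangle>, w\<rangle>"])
  then have "\<langle>\<langle>a \<otimes> \<i>\<d> X, b \<cdot> \<p>\<^sub>1 T X\<rangle>, w \<cdot> \<p>\<^sub>1 T X\<rangle> \<cdot> \<langle>\<i>\<d> T, ?k\<rangle> = \<langle>\<langle>\<langle>a, ?k\<rangle>, b\<rangle>, w\<rangle>"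
    using arr obj assms(3-5) by simp
  also have "\<dots> = \<langle>\<langle>\<langle>?a, c \<cdot> \<langle>?a, ?w\<rangle>\<rangle>, ?b\<rangle>, ?w\<rangle> \<cdot> \<langle>\<langle>a, b\<rangle>, w\<rangle>"
    using arr obj assms(3-5) by simp
  finally have lm: "\<langle>\<langle>a \<otimes> \<i>\<d> X, b \<cdot> \<p>\<^sub>1 T X\<rangle>, w \<cdot> \<p>\<^sub>1 T X\<rangle> \<cdot> \<langle>\<i>\<d> T, ?k\<rangle>
      = \<langle>\<langle>\<langle>?a, c \<cdot> \<langle>?a, ?w\<rangle>\<rangle>, ?b\<rangle>, ?w\<rangle> \<cdot> \<langle>\<langle>a, b\<rangle>, w\<rangle>" .
  have eq: "\<langle>\<langle>a \<otimes> \<i>\<d> X, b \<cdot> \<p>\<^sub>1 T X\<rangle>, w \<cdot> \<p>\<^sub>1 T X\<rangle> \<cdot> \<langle>\<i>\<d> T, ?k\<rangle> \<cdot> s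
      = \<langle>\<langle>\<langle>?a, c \<cdot> \<langle>?a, ?w\<rangle>\<rangle>, ?b\<rangle>, ?w\<rangle> \<cdot> \<langle>\<langle>a, b\<rangle>, w\<rangle> \<cdot> s"
    by (rule comp_cong[OF lm]) (use arr obj assms(3-5) in simp_all)
  show ?thesis
    unfolding eq by (rule splits_extend[OF assms(1,9)]) simp_all
qed

lemma splits_observe:
  assumes "splits A B W (\<langle>\<langle>a, b\<rangle>, w\<rangle> \<cdot> s)" "s \<in> hom \<I> T" "det a" "det b" "det w"
    "a \<in> hom T A" "b \<in> hom T B" "w \<in> hom T W" "c \<in> hom (A \<boxtimes> W) X"
  shows "splits A B (W \<boxtimes> X)
    (\<langle>\<langle>a \<cdot> \<p>\<^sub>1 T X, b \<cdot> \<p>\<^sub>1 T X\<rangle>, w \<otimes> \<i>\<d> X\<rangle> \<cdot> \<langle>\<i>\<d> T, c \<cdot> \<langle>a, w\<rangle>\<rangle> \<cdot> s)"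
proof -
  have arr: "s \<in> Arr C" "Dom C s = \<I>" "Cod C s = T" "Dom C a = T" "Cod C a = A" "Dom C b = T" "Cod C b = B"
    "Dom C w = T" "Cod C w = W" "c \<in> Arr C" "Dom C c = A \<boxtimes> W" "Cod C c = X"
    using assms by (simp_all add: hom_iff)
  then have obj: "T \<in> Obj C" "A \<in> Obj C" "B \<in> Obj C" "W \<in> Obj C" "X \<in> Obj C"
    using assms(3-5) det_arr by auto
  let ?k = "c \<cdot> \<langle>a, w\<rangle>"
  let ?a = "\<p>\<^sub>1 A B \<cdot> \<p>\<^sub>1 (A \<boxtimes> B) W" and ?w = "\<p>\<^sub>2 (A \<boxtimes> B) W"
  have "\<langle>\<langle>a \<cdot> \<p>\<^sub>1 T X, b \<cdot> \<p>\<^sub>1 T X\<rangle>, w \<otimes> \<i>\<d> X\<rangle> = \<alpha> (A \<boxtimes> B) W X \<cdot> (\<langle>\<langle>a, b\<rangle>, w\<rangle> \<otimes> \<i>\<d> X)"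
    using arr obj assms(3-5) by (simp add: tensor_eq_pair[of w] tensor_eq_pair[of "\<langle>\<langle>a, b\<rangle>, w\<rangle>"])
  then have "\<langle>\<langle>a \<cdot> \<p>\<^sub>1 T X, b \<cdot> \<p>\<^sub>1 T X\<rangle>, w \<otimes> \<i>\<d> X\<rangle> \<cdot> \<langle>\<i>\<d> T, ?k\<rangle> = \<langle>\<langle>a, b\<rangle>, \<langle>w, ?k\<rangle>\<rangle>"
    using arr obj assms(3-5) by simp
  also have "\<dots> = \<langle>\<p>\<^sub>1 (A \<boxtimes> B) W, \<langle>?w, c \<cdot> \<langle>?a, ?w\<rangle>\<rangle>\<rangle> \<cdot> \<langle>\<langle>a, b\<rangle>, w\<rangle>"
    using arr obj assms(3-5) by simp
  finally have lm: "\<langle>\<langle>a \<cdot> \<p>\<^sub>1 T X, b \<cdot> \<p>\<^sub>1 T X\<rangle>, w \<otimes> \<i>\<d> X\<rangle> \<cdot> \<langle>\<i>\<d> T, ?k\<rangle>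
      = \<langle>\<p>\<^sub>1 (A \<boxtimes> B) W, \<langle>?w, c \<cdot> \<langle>?a, ?w\<rangle>\<rangle>\<rangle> \<cdot> \<langle>\<langle>a, b\<rangle>, w\<rangle>" .
  have eq: "\<langle>\<langle>a \<cdot> \<p>\<^sub>1 T X, b \<cdot> \<p>\<^sub>1 T X\<rangle>, w \<otimes> \<i>\<d> X\<rangle> \<cdot> \<langle>\<i>\<d> T, ?k\<rangle> \<cdot> s
      = \<langle>\<p>\<^sub>1 (A \<boxtimes> B) W, \<langle>?w, c \<cdot> \<langle>?a, ?w\<rangle>\<rangle>\<rangle> \<cdot> \<langle>\<langle>a, b\<rangle>, w\<rangle> \<cdot> s"
    by (rule comp_cong[OF lm]) (use arr obj assms(3-5) in simp_all)
  show ?thesis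
    unfolding eq by (rule splits_condition[OF assms(1,9)]) simp_all
qed

lemma splits_swap_state:
  assumes "splits A B W (\<langle>\<langle>a, b\<rangle>, w\<rangle> \<cdot> s)" "s \<in> hom \<I> T" "det a" "det b" "det w"
    "a \<in> hom T A" "b \<in> hom T B" "w \<in> hom T W"
  shows "splits B A W (\<langle>\<langle>b, a\<rangle>, w\<rangle> \<cdot> s)"
proof -
  have arr: "s \<in> Arr C" "Dom C s = \<I>" "Cod C s = T" "Dom C a = T" "Cod C a = A" "Dom C b = T" "Cod C b = B"
    "Dom C w = T" "Cod C w = W"
    using assms by (simp_all add: hom_iff)
  then have "A \<in> Obj C" "B \<in> Obj C" "W \<in> Obj C" using assms(3-5) det_arr by auto
  then have "(\<sigma> A B \<otimes> \<i>\<d> W) \<cdot> \<langle>\<langle>a, b\<rangle>, w\<rangle> \<cdot> s = \<langle>\<langle>b, a\<rangle>, w\<rangle> \<cdot> s"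
    using arr assms(3-5) by (intro comp_eqI) simp_all
  then show ?thesis using splits_swap[OF assms(1)] by simp
qed

text \<open>The point where it matters that the network is built from channels: a value that is
  sampled and then dropped leaves no weight behind.\<close>

lemma discard_last:
  assumes "s \<in> hom \<I> T" "det f" "Dom C f = T" "is_channel C k" "k \<in> hom T X"
  shows "f \<cdot> \<p>\<^sub>1 T X \<cdot> \<langle>\<i>\<d> T, k\<rangle> \<cdot> s = f \<cdot> s"
proof -
  have T: "T \<in> Obj C" "X \<in> Obj C" using assms by (auto simp: hom_iff)
  have "\<p>\<^sub>1 T X \<cdot> \<langle>\<i>\<d> T, k\<rangle> \<cdot> s = \<i>\<d> T \<cdot> s"
    using assms T by (intro comp_eqI) (simp_all add: hom_iff)
  then show ?thesis using assms by (simp add: hom_iff)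
qed

definition marginal :: "'v list \<Rightarrow> 'v list \<Rightarrow> 'v list \<Rightarrow> 'v list \<Rightarrow> 'm"
  where "marginal as bs ws xs = \<langle>\<langle>rearrange C ob as xs, rearrange C ob bs xs\<rangle>, rearrange C ob ws xs\<rangle>"

lemma marginal_arr [simp]:
  assumes "set xs \<subseteq> V" "set as \<subseteq> set xs" "set bs \<subseteq> set xs" "set ws \<subseteq> set xs"
    "distinct as" "distinct bs" "distinct ws"
  shows "det (marginal as bs ws xs)" "Dom C (marginal as bs ws xs) = \<T> xs"
    "Cod C (marginal as bs ws xs) = (\<T> as \<boxtimes> \<T> bs) \<boxtimes> \<T> ws"
  using assms by (simp_all add: marginal_def)

end

section \<open>Directed acyclic graphs\<close>

text \<open>The negation of \<open>blocked\<close> in recursive form, suited to walks that are built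
  edge by edge and may repeat vertices.\<close>

fun active :: "('v \<times> 'v) set \<Rightarrow> 'v set \<Rightarrow> 'v list \<Rightarrow> bool"
  where "active E W (a # m # b # p) \<longleftrightarrow>
    (chain_or_fork E a m b \<longrightarrow> m \<notin> W) \<and> (collider E a m b \<longrightarrow> (\<exists>d\<in>W. (m, d) \<in> E\<^sup>*)) \<and>
    active E W (m # b # p)"
  | "active E W _ \<longleftrightarrow> True"

lemma active_iff_not_blocked: "active E W p \<longleftrightarrow> \<not> blocked E W p"
proof (induction E W p rule: active.induct)
  case (1 E W a m b p)
  have "blocked E W (a # m # b # p) \<longleftrightarrow>
    chain_or_fork E a m b \<and> m \<in> W \<or> collider E a m b \<and> (\<forall>d. (m, d) \<in> E\<^sup>* \<longrightarrow> d \<notin> W) \<or>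
    blocked E W (m # b # p)" (is "?L \<longleftrightarrow> ?R")
  proof
    assume ?L
    then obtain i where i: "i + 2 < length (a # m # b # p)" and
      *: "let q = a # m # b # p in chain_or_fork E (q ! i) (q ! (i + 1)) (q ! (i + 2)) \<and> q ! (i + 1) \<in> W \<or>
        collider E (q ! i) (q ! (i + 1)) (q ! (i + 2)) \<and> (\<forall>d. (q ! (i + 1), d) \<in> E\<^sup>* \<longrightarrow> d \<notin> W)"
      unfolding blocked_def Let_def by blast
    show ?R
    proof (cases i)
      case 0
      then show ?thesis using * by (auto simp: Let_def)
    next
      case (Suc j)
      then have "blocked E W (m # b # p)"
        unfolding blocked_def using i * by (intro exI[of _ j]) (simp add: Let_def)
      then show ?thesis by blast
    qed
  next
    assume ?R
    then consider "chain_or_fork E a m b \<and> m \<in> W \<or> collider E a m b \<and> (\<forall>d. (m, d) \<in> E\<^sup>* \<longrightarrow> d \<notin> W)"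
      | "blocked E W (m # b # p)" by blast
    then show ?L
    proof cases
      case 1
      then show ?thesis unfolding blocked_def by (intro exI[of _ 0]) simp
    next
      case 2
      then obtain j where "j + 2 < length (m # b # p)" and
        "let q = m # b # p in chain_or_fork E (q ! j) (q ! (j + 1)) (q ! (j + 2)) \<and> q ! (j + 1) \<in> W \<or>
        collider E (q ! j) (q ! (j + 1)) (q ! (j + 2)) \<and> (\<forall>d. (q ! (j + 1), d) \<in> E\<^sup>* \<longrightarrow> d \<notin> W)"
        unfolding blocked_def Let_def by blast
      then show ?thesis unfolding blocked_def by (intro exI[of _ "Suc j"]) (simp add: Let_def)
    qed
  qed
  then show ?case using 1 by auto
qed (simp_all add: blocked_def)

lemma acyclic_asym: "acyclic E \<Longrightarrow> (a, b) \<in> E \<Longrightarrow> (b, a) \<notin> E"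
  unfolding acyclic_def by (meson r_into_trancl' trancl_trans)

text \<open>Joining two walks at \<open>v\<close> creates a single new triple, the one centred at
  \<open>v\<close>.\<close>

lemma active_append:
  "active E W (xs @ v # zs) \<longleftrightarrow> active E W (xs @ [v]) \<and> active E W (v # zs) \<and>
    (xs \<noteq> [] \<longrightarrow> zs \<noteq> [] \<longrightarrow> active E W [last xs, v, hd zs])"
proof (induction xs rule: induct_list012)
  case (2 x)
  then show ?case by (cases zs) auto
next
  case (3 x y xs)
  then show ?case by (cases xs) auto
qed simp

abbreviation adjacent :: "('v \<times> 'v) set \<Rightarrow> 'v \<Rightarrow> 'v \<Rightarrow> bool"
  where "adjacent E a b \<equiv> (a, b) \<in> E \<or> (b, a) \<in> E"

text \<open>A walk that starts along an edge can turn around only at a collider. Such a collider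
  lies below \<open>u\<close>, hence has no descendant in \<open>W\<close> and would block the
  walk.\<close>

lemma active_directed:
  assumes "active E W (u # n # p)" "successively (adjacent E) (u # n # p)" "(u, n) \<in> E"
    "\<forall>d\<in>W. (u, d) \<notin> E\<^sup>*"
  shows "(u, last (n # p)) \<in> E\<^sup>+"
  using assms
proof (induction p arbitrary: u n)
  case Nil
  then show ?case by auto
next
  case (Cons m p)
  have n: "\<forall>d\<in>W. (n, d) \<notin> E\<^sup>*"
    using Cons.prems(3,4) by (meson converse_rtrancl_into_rtrancl)
  then have "\<not> collider E u n m" using Cons.prems(1) by auto
  then have "(n, m) \<in> E" using Cons.prems(2,3) by (auto simp: collider_def)
  then have "(n, last (m # p)) \<in> E\<^sup>+"
    using Cons.prems(1,2) n by (intro Cons.IH) auto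
  then show ?case using Cons.prems(3) by auto
qed

text \<open>Cuts out the loop between two visits to a vertex and iterates on the length. Only the
  triple at the junction is new; were it blocking, it would conflict with the old triples at the two
  visits or with acyclicity.\<close>

lemma active_distinct:
  assumes E: "acyclic E"
    and p: "active E W p" "successively (adjacent E) p" "p \<noteq> []" "hd p \<notin> W"
  shows "\<exists>q. active E W q \<and> successively (adjacent E) q \<and> q \<noteq> [] \<and> hd q = hd p \<and> last q = last p \<and> distinct q"
  using p
proof (induction p rule: length_induct)
  case (1 p)
  show ?case
  proof (cases "distinct p")
    case True
    then show ?thesis using "1.prems" by blast
  next
    case False
    then obtain xs v ys zs where p: "p = xs @ [v] @ ys @ [v] @ zs"
      using not_distinct_decomp by blast
    let ?q = "xs @ v # zs"
    note asym = acyclic_asym[OF E]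
    have walk: "successively (adjacent E) (xs @ v # ys @ v # zs)" using "1.prems"(2) by (simp add: p)
    then have "successively (adjacent E) ((v # ys) @ v # zs)"
      and x: "successively (adjacent E) xs" "xs \<noteq> [] \<Longrightarrow> adjacent E (last xs) v"
      unfolding successively_append_iff[of _ xs] by simp_all
    then have y: "successively (adjacent E) (v # ys)" "adjacent E (last (v # ys)) v"
      and z: "successively (adjacent E) (v # zs)"
      unfolding successively_append_iff[of _ "v # ys"] by simp_all
    have y': "successively (adjacent E) (v # ys @ [v])"
      using y successively_append_iff[of "adjacent E" "v # ys" "[v]"] by simp
    have hd_y: "adjacent E v (hd (ys @ [v]))" using y' by (cases ys) auto
    have hd_z: "zs \<noteq> [] \<Longrightarrow> adjacent E v (hd zs)" using z by (cases zs) auto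
    have a: "active E W (xs @ v # ys @ v # zs)" using "1.prems"(1) by (simp add: p)
    have hd_ys: "hd (ys @ v # zs) = hd (ys @ [v])" by (cases ys) simp_all
    have a1: "active E W (xs @ [v])" and b: "active E W (v # ys @ v # zs)"
      and j1: "xs \<noteq> [] \<Longrightarrow> active E W [last xs, v, hd (ys @ [v])]"
      using a unfolding active_append[of E W xs v "ys @ v # zs"] hd_ys by blast+
    have a2: "active E W (v # ys @ [v])" and a3: "active E W (v # zs)"
      and j2: "zs \<noteq> [] \<Longrightarrow> active E W [last (v # ys), v, hd zs]"
      using b active_append[of E W "v # ys" v zs] unfolding append_Cons by blast+
    have "active E W [last xs, v, hd zs]" if ne: "xs \<noteq> []" "zs \<noteq> []"
    proof -
      have "v \<notin> W" if cf: "chain_or_fork E (last xs) v (hd zs)"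
      proof
        assume v: "v \<in> W"
        \<comment> \<open>On the old walk neither visit to \<open>v \<in> W\<close> is a chain or
          fork. Both are colliders, so the two edges that meet at the junction point into
          \<open>v\<close>.\<close>
        have "(last xs, v) \<in> E"
          using j1 v x(2) hd_y ne by (auto simp: chain_or_fork_def)
        moreover have "(hd zs, v) \<in> E"
          using j2 v y(2) hd_z ne by (auto simp: chain_or_fork_def)
        ultimately show False using cf asym by (auto simp: chain_or_fork_def)
      qed
      moreover have "\<exists>d\<in>W. (v, d) \<in> E\<^sup>*" if co: "collider E (last xs) v (hd zs)"
      proof (rule ccontr)
        assume no: "\<not> ?thesis"
        \<comment> \<open>The first visit being no collider, the loop leaves \<open>v\<close> along
          an edge. By \<open>active_directed\<close> it is then a directed cycle through
          \<open>v\<close>.\<close>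
        then have "\<not> collider E (last xs) v (hd (ys @ [v]))" using j1 ne by auto
        then have vn: "(v, hd (ys @ [v])) \<in> E" using co hd_y by (auto simp: collider_def)
        obtain n r where nr: "ys @ [v] = n # r" by (cases ys) auto
        have "last (n # r) = v" by (metis nr last_snoc)
        then have "(v, v) \<in> E\<^sup>+"
          using active_directed[of E W v n r] a2 y' vn no unfolding nr by simp
        then show False using E by (simp add: acyclic_def)
      qed
      ultimately show ?thesis by simp
    qed
    then have "active E W ?q" using a1 a3 active_append[of E W xs v zs] by blast
    moreover have "successively (adjacent E) ?q"
      using x z successively_append_iff[of "adjacent E" xs "v # zs"] by auto
    moreover have "hd ?q = hd p" "last ?q = last p" "?q \<noteq> []" "length ?q < length p"
      by (auto simp: p hd_append)
    ultimately show ?thesis using "1.IH"[rule_format, of ?q] "1.prems"(4) by simp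
  qed
qed

text \<open>\<open>reach E W Z d v\<close>: some active walk from \<open>Z\<close> ends in \<open>v\<close>. The tag \<open>d\<close> is \<open>True\<close> if the walk is
  trivial or traverses its last edge against the orientation, so that \<open>v\<close> is not a collider
  whichever way the walk continues.\<close>

inductive reach :: "('v \<times> 'v) set \<Rightarrow> 'v set \<Rightarrow> 'v set \<Rightarrow> bool \<Rightarrow> 'v \<Rightarrow> bool"
  for E W Z where
  start: "z \<in> Z \<Longrightarrow> reach E W Z True z"
| up_up: "reach E W Z True v \<Longrightarrow> v \<notin> W \<Longrightarrow> (p, v) \<in> E \<Longrightarrow> reach E W Z True p"
| down: "reach E W Z d v \<Longrightarrow> v \<notin> W \<Longrightarrow> (v, c) \<in> E \<Longrightarrow> reach E W Z False c"
| down_up: "reach E W Z False v \<Longrightarrow> w \<in> W \<Longrightarrow> (v, w) \<in> E\<^sup>* \<Longrightarrow> (p, v) \<in> E \<Longrightarrow> reach E W Z True p"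

text \<open>The walk is listed from \<open>v\<close> back to \<open>Z\<close>, so every rule conses
  one vertex. The tag records the direction of the first listed edge and thereby the kind of the new
  triple, centred at the old head.\<close>

lemma reach_walk:
  assumes E: "acyclic E" and "reach E W Z d v"
  shows "\<exists>p. active E W (v # p) \<and> successively (adjacent E) (v # p) \<and> last (v # p) \<in> Z \<and>
    (if d then p \<noteq> [] \<longrightarrow> (v, hd p) \<in> E else p \<noteq> [] \<and> (hd p, v) \<in> E)"
proof -
  note asym = acyclic_asym[OF E]
  show ?thesis using assms(2)
  proof (induction rule: reach.induct)
    case (start z)
    then show ?case by (intro exI[of _ "[]"]) simp
  next
    case (up_up v u)
    then obtain p where "active E W (v # p)" "successively (adjacent E) (v # p)" "last (v # p) \<in> Z"
      "p \<noteq> [] \<longrightarrow> (v, hd p) \<in> E" by auto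
    with up_up.hyps show ?case
      by (intro exI[of _ "v # p"], cases p) (auto simp: collider_def dest: asym)
  next
    case (down d v c)
    then obtain p where "active E W (v # p)" "successively (adjacent E) (v # p)" "last (v # p) \<in> Z"
      by auto
    with down.hyps show ?case
      by (intro exI[of _ "v # p"], cases p) (auto simp: collider_def dest: asym)
  next
    case (down_up v w u)
    then obtain p where "active E W (v # p)" "successively (adjacent E) (v # p)" "last (v # p) \<in> Z"
      "p \<noteq> []" "(hd p, v) \<in> E" by auto
    with down_up.hyps show ?case
      by (intro exI[of _ "v # p"], cases p) (auto simp: chain_or_fork_def dest: asym)
  qed
qed

text \<open>d-separation speaks of paths and \<open>reach\<close> of walks;
  \<open>active_distinct\<close> bridges the two.\<close>

lemma d_separated_reach:
  assumes "acyclic E" "d_separated E Y Z W" "Y \<inter> W = {}" "y \<in> Y"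
  shows "\<not> reach E W Z d y"
proof
  assume "reach E W Z d y"
  then obtain p where p: "active E W (y # p)" "successively (adjacent E) (y # p)" "last (y # p) \<in> Z"
    using reach_walk[OF assms(1)] by blast
  moreover have "y \<notin> W" using assms by blast
  ultimately obtain q where "active E W q" "successively (adjacent E) q" "q \<noteq> []"
    "hd q = y" "last q \<in> Z" "distinct q"
    using active_distinct[OF assms(1), of W "y # p"] by auto
  then show False
    using assms(2,4) active_iff_not_blocked[of E W q] unfolding d_separated_def undirected_path_def by blast
qed

text \<open>With no observed vertex at or below \<open>v\<close>, the walk may follow the directed
  path down by rule \<open>down\<close>. Together with \<open>reach_up\<close> this turns around a
  walk that enters an ancestor from above.\<close>

lemma reach_down:
  assumes "(v, x) \<in> E\<^sup>*" "reach E W Z d v" "\<forall>w\<in>W. (v, w) \<notin> E\<^sup>*"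
  shows "\<exists>d. reach E W Z d x"
  using assms
proof (induction arbitrary: d rule: converse_rtrancl_induct)
  case (step u v)
  have "u \<notin> W" using step.prems(2) by blast
  then have "reach E W Z False v" using step.hyps(1) step.prems(1) by (blast intro: reach.down)
  moreover have "\<forall>w\<in>W. (v, w) \<notin> E\<^sup>*" using step.prems(2) step.hyps(1)
    by (meson converse_rtrancl_into_rtrancl)
  ultimately show ?case using step.IH by blast
qed blast

lemma reach_up:
  assumes "(x, z) \<in> E\<^sup>*" "z \<in> Z" "\<forall>w\<in>W. (x, w) \<notin> E\<^sup>*"
  shows "reach E W Z True x"
  using assms
proof (induction rule: converse_rtrancl_induct)
  case base
  then show ?case by (simp add: reach.start)
next
  case (step u v)
  have v: "\<forall>w\<in>W. (v, w) \<notin> E\<^sup>*" using step.prems(2) step.hyps(1)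
    by (meson converse_rtrancl_into_rtrancl)
  then have "v \<notin> W" by blast
  then show ?case using step.IH step.prems(1) v step.hyps(1) by (blast intro: reach.up_up)
qed

text \<open>With \<open>D\<close> the ancestors and \<open>R\<close> the reached vertices, the sides
  are \<open>D - W - R\<close> and \<open>(D - W) \<inter> R\<close>. The parent conditions say that
  being reached does not change along edges within \<open>D - W\<close>, nor between the parents
  outside \<open>W\<close> of a common child in \<open>W\<close>.\<close>

lemma d_separated_partition:
  assumes E: "acyclic E" and sep: "d_separated E Y Z W"
    and disj: "Y \<inter> W = {}" "Z \<inter> W = {}"
  obtains A B where "Y \<subseteq> A" "Z \<subseteq> B" "A \<inter> B = {}" "A \<inter> W = {}" "B \<inter> W = {}"
    "\<And>v. v \<in> A \<Longrightarrow> parents E v \<subseteq> A \<union> W" "\<And>v. v \<in> B \<Longrightarrow> parents E v \<subseteq> B \<union> W"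
    "\<And>v. v \<in> W \<Longrightarrow> parents E v \<subseteq> A \<union> W \<or> parents E v \<subseteq> B \<union> W"
proof -
  define D where "D = {v. \<exists>u\<in>Y \<union> Z \<union> W. (v, u) \<in> E\<^sup>*}"
  define R where "R = {v. \<exists>d. reach E W Z d v}"
  note nY = d_separated_reach[OF E sep disj(1)]
  have D: "p \<in> D" if "(p, v) \<in> E" "v \<in> D" for p v
    using that unfolding D_def by (blast intro: converse_rtrancl_into_rtrancl)
  have R: "reach E W Z d v \<Longrightarrow> v \<in> R" for d v by (auto simp: R_def)
  have R_child: "v \<in> R" if p: "(p, v) \<in> E" "p \<in> R" "p \<notin> W" for p v
  proof -
    obtain d where "reach E W Z d p" using p by (auto simp: R_def)
    from R[OF reach.down[OF this p(3,1)]] show ?thesis .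
  qed
  text \<open>A reached ancestor \<open>v\<close> without descendants in \<open>W\<close> has a descendant in \<open>Z\<close>, as it cannot have
    one in \<open>Y\<close>; hence \<open>v\<close> is also reached from below, and the walk continues to its parents.\<close>
  have R_parent: "p \<in> R" if pv: "(p, v) \<in> E" and v: "v \<in> R" "v \<in> D" "v \<notin> W" for p v
  proof -
    obtain d where d: "reach E W Z d v" using v by (auto simp: R_def)
    show ?thesis
    proof (cases "\<exists>w\<in>W. (v, w) \<in> E\<^sup>*")
      case True
      then obtain w where w: "w \<in> W" "(v, w) \<in> E\<^sup>*" by blast
      show ?thesis
      proof (cases d)
        case True
        then show ?thesis using R[OF reach.up_up[OF _ v(3) pv]] d by simp
      next
        case False
        then show ?thesis using R[OF reach.down_up[OF _ w pv]] d by simp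
      qed
    next
      case False
      then have no: "\<forall>w\<in>W. (v, w) \<notin> E\<^sup>*" by blast
      have "(v, y) \<notin> E\<^sup>*" if "y \<in> Y" for y
        using reach_down[OF _ d no] nY[OF that] by metis
      then obtain z where "z \<in> Z" "(v, z) \<in> E\<^sup>*" using v(2) no by (auto simp: D_def)
      then have "reach E W Z True v" using reach_up no by metis
      then show ?thesis by (rule R[OF reach.up_up[OF _ v(3) pv]])
    qed
  qed
  \<comment> \<open>The walk goes from \<open>p\<close> down to \<open>v\<close> and up to
    \<open>q\<close>; the collider at \<open>v\<close> is open because \<open>v\<close> itself is
    observed.\<close>
  have R_coparent: "q \<in> R" if p: "(p, v) \<in> E" "(q, v) \<in> E" "v \<in> W" "p \<in> R" "p \<notin> W" for p q v
  proof -
    obtain d where "reach E W Z d p" using p by (auto simp: R_def)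
    then have "reach E W Z False v" using p(5,1) by (rule reach.down)
    from R[OF reach.down_up[OF this p(3) rtrancl.rtrancl_refl p(2)]] show ?thesis .
  qed
  have sub: "Y \<union> Z \<union> W \<subseteq> D" by (auto simp: D_def)
  show thesis
  proof (rule that[of "D - W - R" "(D - W) \<inter> R"])
    show "Y \<subseteq> D - W - R" using sub disj nY by (auto simp: R_def)
    show "Z \<subseteq> (D - W) \<inter> R" using sub disj by (auto simp: R_def intro: reach.start)
    show "parents E v \<subseteq> (D - W - R) \<union> W" if "v \<in> D - W - R" for v
      using that D[of _ v] R_child[of _ v] unfolding parents_def by blast
    show "parents E v \<subseteq> ((D - W) \<inter> R) \<union> W" if "v \<in> (D - W) \<inter> R" for v
      using that D[of _ v] R_parent[of _ v] unfolding parents_def by blast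
    show "parents E v \<subseteq> (D - W - R) \<union> W \<or> parents E v \<subseteq> ((D - W) \<inter> R) \<union> W" if "v \<in> W" for v
    \<comment> \<open>One reached parent outside \<open>W\<close> makes all parents reached;
      otherwise all parents outside \<open>W\<close> are unreached.\<close>
    proof (cases "\<exists>p\<in>R - W. (p, v) \<in> E")
      case True
      then obtain p where "p \<in> R" "p \<notin> W" "(p, v) \<in> E" by blast
      then show ?thesis using that sub D[of _ v] R_coparent[of p v] unfolding parents_def by blast
    next
      case False
      then show ?thesis using that sub D[of _ v] unfolding parents_def by blast
    qed
  qed auto
qed

section \<open>Networks\<close>

context variable_family
begin

text \<open>The list is a reversed initial segment of a topological ordering, so its head is sampled
  last and has no edge into the tail; this is why closure under parents passes to the tail.\<close>

lemma network_splits: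
  assumes E: "acyclic E" "E \<subseteq> V \<times> V" and vs: "distinct vs" "set vs = V"
    and c: "\<And>v. v \<in> V \<Longrightarrow> is_channel C (c v)"
      "\<And>v. v \<in> V \<Longrightarrow> c v \<in> hom (tensor_set C ob vs (parents E v)) (ob v)"
    and disj: "A \<inter> B = {}" "A \<inter> W = {}" "B \<inter> W = {}"
    and pa: "\<And>v. v \<in> A \<Longrightarrow> parents E v \<subseteq> A \<union> W" "\<And>v. v \<in> B \<Longrightarrow> parents E v \<subseteq> B \<union> W"
      "\<And>v. v \<in> W \<Longrightarrow> parents E v \<subseteq> A \<union> W \<or> parents E v \<subseteq> B \<union> W"
    and rs: "set rs \<subseteq> V" "distinct rs" "sorted_wrt (\<lambda>x y. (x, y) \<notin> E) rs"
      "\<And>v. v \<in> set rs \<Longrightarrow> parents E v \<subseteq> set rs"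
  shows "network_state C ob E vs c rs \<in> hom \<I> (\<T> rs) \<and>
    splits (\<T> (restrict_list rs A)) (\<T> (restrict_list rs B)) (\<T> (restrict_list rs W))
      (marginal (restrict_list rs A) (restrict_list rs B) (restrict_list rs W) rs \<cdot> network_state C ob E vs c rs)"
  using rs
proof (induction rs)
  case Nil
  then show ?case using splits_unit by (simp add: marginal_def discard_unit hom_iff)
next
  case (Cons x rs)
  have x: "x \<in> V" "x \<notin> set rs" and rs: "set rs \<subseteq> V" "distinct rs" using Cons.prems by auto
  have sorted: "sorted_wrt (\<lambda>x y. (x, y) \<notin> E) rs" and later: "\<And>v. v \<in> set rs \<Longrightarrow> (x, v) \<notin> E"
    using Cons.prems(3) by simp_all
  have "parents E v \<subseteq> set rs" if "v \<in> set rs" for v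
    using Cons.prems(4)[of v] later[OF that] that by (auto simp: parents_def)
  note IH = Cons.IH[OF rs sorted this]
  have "(x, x) \<notin> E" using acyclic_asym[OF E(1), of x x] by blast
  then have px: "parents E x \<subseteq> set rs" using Cons.prems(4)[of x] by (auto simp: parents_def)
  define ps where "ps = restrict_list vs (parents E x)"
  have ps: "set ps = parents E x" "distinct ps" "set ps \<subseteq> set rs"
    using px rs vs by (auto simp: ps_def)
  define s where "s = network_state C ob E vs c rs"
  define T X where "T = \<T> rs" and "X = ob x"
  define as bs ws where "as = restrict_list rs A" and "bs = restrict_list rs B" and "ws = restrict_list rs W"
  define a b w where "a = rearrange C ob as rs" and "b = rearrange C ob bs rs" and "w = rearrange C ob ws rs"
  define k where "k = c x \<cdot> rearrange C ob ps rs"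
  have lists: "set as \<subseteq> set rs" "set bs \<subseteq> set rs" "set ws \<subseteq> set rs" "distinct as" "distinct bs" "distinct ws"
    using rs by (auto simp: as_def bs_def ws_def)
  have cx: "c x \<in> Arr C" "Dom C (c x) = \<T> ps" "Cod C (c x) = X"
    using c(2)[OF x(1)] by (simp_all add: hom_iff tensor_set_def ps_def X_def)
  have channel: "is_channel C (c x)"
    by (rule c(1)[OF x(1)])
  have T: "T \<in> Obj C" and X: "X \<in> Obj C" using rs x by (simp_all add: T_def X_def)
  have det: "det a" "det b" "det w" using rs lists by (simp_all add: a_def b_def w_def)
  have homs: "a \<in> hom T (\<T> as)" "b \<in> hom T (\<T> bs)" "w \<in> hom T (\<T> ws)"
    using rs lists by (simp_all add: a_def b_def w_def hom_iff T_def)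
  have s: "s \<in> hom \<I> T" and split: "splits (\<T> as) (\<T> bs) (\<T> ws) (\<langle>\<langle>a, b\<rangle>, w\<rangle> \<cdot> s)"
    using IH by (simp_all add: s_def T_def as_def bs_def ws_def a_def b_def w_def marginal_def)
  note split' = splits_swap_state[OF split s det homs]
  have k: "k \<in> hom T X" "is_channel C k"
    using cx channel rs ps by (simp_all add: k_def hom_iff T_def)
  have state: "network_state C ob E vs c (x # rs) = \<langle>\<i>\<d> T, k\<rangle> \<cdot> s"
    using s k T by (simp add: Let_def hom_iff pair_def flip: s_def T_def ps_def k_def)
  have s': "\<langle>\<i>\<d> T, k\<rangle> \<cdot> s \<in> hom \<I> (T \<boxtimes> X)"
    using s k T by (simp add: hom_iff)
  have keep: "rearrange C ob (x # ys) (x # rs) = rearrange C ob ys rs \<otimes> \<i>\<d> X"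
    if "set ys \<subseteq> set rs" "distinct ys" for ys
    unfolding rearrange_keep using rs x that by (simp add: X_def)
  have skip: "rearrange C ob ys (x # rs) = rearrange C ob ys rs \<cdot> \<p>\<^sub>1 T X"
    if "set ys \<subseteq> set rs" "distinct ys" for ys
    unfolding T_def X_def using rs x that by (intro rearrange_skip) auto
  \<comment> \<open>Where the parent conditions take effect: the new value is computed from one side
    and the observed variables alone.\<close>
  have factor: "\<exists>g\<in>hom (\<T> ls \<boxtimes> \<T> ws) X. k = g \<cdot> \<langle>rearrange C ob ls rs, w\<rangle>"
    if ls: "ls = restrict_list rs S" and sub: "parents E x \<subseteq> S \<union> W" for ls S
  proof -
    have ls': "set ls \<subseteq> set rs" "distinct ls" "set ls \<subseteq> V" using rs by (auto simp: ls)
    have "set ps \<subseteq> set ls \<union> set ws" using ps sub px by (auto simp: ls ws_def)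
    then obtain h where h: "h \<in> hom (\<T> ls \<boxtimes> \<T> ws) (\<T> ps)"
      "h \<cdot> \<langle>rearrange C ob ls rs, w\<rangle> = rearrange C ob ps rs"
      using rearrange_factor[OF rs(1) ls'(1) lists(3) _ ls'(2) lists(6) ps(2)] unfolding w_def by blast
    then have "k = (c x \<cdot> h) \<cdot> \<langle>rearrange C ob ls rs, w\<rangle>"
      using cx det homs ls' rs by (simp add: k_def hom_iff T_def)
    then show ?thesis using cx h by (intro bexI[of _ "c x \<cdot> h"]) (simp_all add: hom_iff)
  qed
  have T_Cons: "\<T> (x # ys) = \<T> ys \<boxtimes> X" for ys by (simp add: X_def)
  \<comment> \<open>A vertex in \<open>A\<close> or \<open>B\<close> extends its own side, one in
    \<open>W\<close> weights a side that together with \<open>W\<close> contains its parents, and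
    any other is dropped.\<close>
  consider "x \<in> A" "x \<notin> B" "x \<notin> W" | "x \<in> B" "x \<notin> A" "x \<notin> W"
    | "x \<in> W" "x \<notin> A" "x \<notin> B" "parents E x \<subseteq> A \<union> W"
    | "x \<in> W" "x \<notin> A" "x \<notin> B" "parents E x \<subseteq> B \<union> W" | "x \<notin> A" "x \<notin> B" "x \<notin> W"
    using disj pa(3) by blast
  then have "splits (\<T> (restrict_list (x # rs) A)) (\<T> (restrict_list (x # rs) B)) (\<T> (restrict_list (x # rs) W))
      (marginal (restrict_list (x # rs) A) (restrict_list (x # rs) B) (restrict_list (x # rs) W) (x # rs)
        \<cdot> \<langle>\<i>\<d> T, k\<rangle> \<cdot> s)"
  proof cases
    case 1
    have l: "restrict_list (x # rs) A = x # as" "restrict_list (x # rs) B = bs"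
      "restrict_list (x # rs) W = ws"
      using 1 by (simp_all add: as_def bs_def ws_def)
    have m: "marginal (x # as) (bs) (ws) (x # rs) = \<langle>\<langle>a \<otimes> \<i>\<d> X, b \<cdot> \<p>\<^sub>1 T X\<rangle>, w \<cdot> \<p>\<^sub>1 T X\<rangle>"
      unfolding marginal_def using lists by (simp only: keep skip a_def b_def w_def)
    obtain g where g: "g \<in> hom (\<T> as \<boxtimes> \<T> ws) X" "k = g \<cdot> \<langle>a, w\<rangle>"
      using factor[OF as_def pa(1)[OF 1(1)]] unfolding a_def by blast
    show ?thesis
      unfolding l m T_Cons g(2) by (rule splits_sample[OF split s det homs g(1)])
  next
    case 2
    have l: "restrict_list (x # rs) A = as" "restrict_list (x # rs) B = x # bs"
      "restrict_list (x # rs) W = ws"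
      using 2 by (simp_all add: as_def bs_def ws_def)
    have m: "marginal (as) (x # bs) (ws) (x # rs) = \<langle>\<langle>a \<cdot> \<p>\<^sub>1 T X, b \<otimes> \<i>\<d> X\<rangle>, w \<cdot> \<p>\<^sub>1 T X\<rangle>"
      unfolding marginal_def using lists by (simp only: keep skip a_def b_def w_def)
    obtain g where g: "g \<in> hom (\<T> bs \<boxtimes> \<T> ws) X" "k = g \<cdot> \<langle>b, w\<rangle>"
      using factor[OF bs_def pa(2)[OF 2(1)]] unfolding b_def by blast
    \<comment> \<open>The step lemmas change the first side only, so the sides are exchanged before
      and after.\<close>
    have "splits (\<T> bs \<boxtimes> X) (\<T> as) (\<T> ws) (\<langle>\<langle>b \<otimes> \<i>\<d> X, a \<cdot> \<p>\<^sub>1 T X\<rangle>, w \<cdot> \<p>\<^sub>1 T X\<rangle> \<cdot> \<langle>\<i>\<d> T, k\<rangle> \<cdot> s)"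
      unfolding g(2) by (rule splits_sample[OF split' s det(2,1,3) homs(2,1,3) g(1)])
    then show ?thesis
      unfolding l m T_Cons
      by (rule splits_swap_state[OF _ s']) (use det homs T X in \<open>simp_all add: hom_iff\<close>)
  next
    case 3
    have l: "restrict_list (x # rs) A = as" "restrict_list (x # rs) B = bs"
      "restrict_list (x # rs) W = x # ws"
      using 3 by (simp_all add: as_def bs_def ws_def)
    have m: "marginal (as) (bs) (x # ws) (x # rs) = \<langle>\<langle>a \<cdot> \<p>\<^sub>1 T X, b \<cdot> \<p>\<^sub>1 T X\<rangle>, w \<otimes> \<i>\<d> X\<rangle>"
      unfolding marginal_def using lists by (simp only: keep skip a_def b_def w_def)
    obtain g where g: "g \<in> hom (\<T> as \<boxtimes> \<T> ws) X" "k = g \<cdot> \<langle>a, w\<rangle>"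
      using factor[OF as_def 3(4)] unfolding a_def by blast
    show ?thesis
      unfolding l m T_Cons g(2) by (rule splits_observe[OF split s det homs g(1)])
  next
    case 4
    have l: "restrict_list (x # rs) A = as" "restrict_list (x # rs) B = bs"
      "restrict_list (x # rs) W = x # ws"
      using 4 by (simp_all add: as_def bs_def ws_def)
    have m: "marginal (as) (bs) (x # ws) (x # rs) = \<langle>\<langle>a \<cdot> \<p>\<^sub>1 T X, b \<cdot> \<p>\<^sub>1 T X\<rangle>, w \<otimes> \<i>\<d> X\<rangle>"
      unfolding marginal_def using lists by (simp only: keep skip a_def b_def w_def)
    obtain g where g: "g \<in> hom (\<T> bs \<boxtimes> \<T> ws) X" "k = g \<cdot> \<langle>b, w\<rangle>"
      using factor[OF bs_def 4(4)] unfolding b_def by blast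
    have "splits (\<T> bs) (\<T> as) (\<T> ws \<boxtimes> X) (\<langle>\<langle>b \<cdot> \<p>\<^sub>1 T X, a \<cdot> \<p>\<^sub>1 T X\<rangle>, w \<otimes> \<i>\<d> X\<rangle> \<cdot> \<langle>\<i>\<d> T, k\<rangle> \<cdot> s)"
      unfolding g(2) by (rule splits_observe[OF split' s det(2,1,3) homs(2,1,3) g(1)])
    then show ?thesis
      unfolding l m T_Cons
      by (rule splits_swap_state[OF _ s']) (use det homs T X in \<open>simp_all add: hom_iff\<close>)
  next
    \<comment> \<open>The new value is sampled by a channel and projected away at once, so the
      marginal is the old one.\<close>
    case 5
    have l: "restrict_list (x # rs) A = as" "restrict_list (x # rs) B = bs"
      "restrict_list (x # rs) W = ws"
      using 5 by (simp_all add: as_def bs_def ws_def)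
    have m: "marginal (as) (bs) (ws) (x # rs) = \<langle>\<langle>a \<cdot> \<p>\<^sub>1 T X, b \<cdot> \<p>\<^sub>1 T X\<rangle>, w \<cdot> \<p>\<^sub>1 T X\<rangle>"
      unfolding marginal_def using lists by (simp only: keep skip a_def b_def w_def)
    have "\<langle>\<langle>a \<cdot> \<p>\<^sub>1 T X, b \<cdot> \<p>\<^sub>1 T X\<rangle>, w \<cdot> \<p>\<^sub>1 T X\<rangle> = \<langle>\<langle>a, b\<rangle>, w\<rangle> \<cdot> \<p>\<^sub>1 T X"
      using det homs T X by (simp add: hom_iff)
    then have "\<langle>\<langle>a \<cdot> \<p>\<^sub>1 T X, b \<cdot> \<p>\<^sub>1 T X\<rangle>, w \<cdot> \<p>\<^sub>1 T X\<rangle> \<cdot> \<langle>\<i>\<d> T, k\<rangle> \<cdot> s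
        = (\<langle>\<langle>a, b\<rangle>, w\<rangle> \<cdot> \<p>\<^sub>1 T X) \<cdot> \<langle>\<i>\<d> T, k\<rangle> \<cdot> s" by (rule arg_cong)
    also have "\<dots> = \<langle>\<langle>a, b\<rangle>, w\<rangle> \<cdot> \<p>\<^sub>1 T X \<cdot> \<langle>\<i>\<d> T, k\<rangle> \<cdot> s"
      using s' det homs T X by (intro assoc) (simp_all add: hom_iff)
    also have "\<dots> = \<langle>\<langle>a, b\<rangle>, w\<rangle> \<cdot> s"
      using s k det homs by (intro discard_last) (simp_all add: hom_iff)
    finally show ?thesis unfolding l m using split by simp
  qed
  then show ?case unfolding state using s' by (simp add: T_def X_def)
qed

section \<open>From the product form to conditional independence\<close>

lemma state_conditional_arr [simp]:
  assumes "N \<in> hom \<I> (F \<boxtimes> W)" "F \<in> Obj C" "W \<in> Obj C"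
  shows "state_conditional C F W N \<in> Arr C" "Dom C (state_conditional C F W N) = W"
    "Cod C (state_conditional C F W N) = F"
  using assms density_in[OF assms] by (simp_all add: state_conditional_eq[OF assms] hom_iff)

lemma marginal2_eq:
  assumes "set vs = V" "distinct vs" "S \<inter> T = {}" "\<omega> \<in> hom \<I> (\<T> vs)"
  shows "marginal2 C ob vs S T \<omega>
    = \<langle>rearrange C ob (restrict_list vs S) vs, rearrange C ob (restrict_list vs T) vs\<rangle> \<cdot> \<omega>"
proof -
  have "distinct (restrict_list vs T @ restrict_list vs S)" using assms by auto
  then show ?thesis
    unfolding marginal2_def Let_def using assms
    by (intro comp_eqI split_tensor_rearrange) (auto simp: hom_iff)
qed

lemma marginal3_eq:
  assumes vs: "set vs = V" "distinct vs" and "Y \<inter> Z = {}" "Y \<inter> W = {}" "Z \<inter> W = {}" "\<omega> \<in> hom \<I> (\<T> vs)"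
  shows "marginal3 C ob vs Y Z W \<omega>
    = marginal (restrict_list vs Y) (restrict_list vs Z) (restrict_list vs W) vs \<cdot> \<omega>"
proof -
  let ?y = "restrict_list vs Y" and ?z = "restrict_list vs Z" and ?w = "restrict_list vs W"
  have d: "distinct (?z @ ?y)" "distinct (?w @ ?z @ ?y)" using assms by auto
  have sub: "set (?z @ ?y) \<subseteq> set vs" "set (?w @ ?z @ ?y) \<subseteq> set vs" "set ?w \<subseteq> set vs" "set ?y \<subseteq> set vs"
    "set ?z \<subseteq> set vs" by auto
  have V: "set ?y \<subseteq> V" "set ?z \<subseteq> V" "set ?w \<subseteq> V" "set (?z @ ?y) \<subseteq> V" using sub vs by auto
  have "split_tensor C ob (?z @ ?y) ?w \<cdot> rearrange C ob (?w @ ?z @ ?y) vs \<cdot> \<omega>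
      = \<langle>rearrange C ob (?z @ ?y) vs, rearrange C ob ?w vs\<rangle> \<cdot> \<omega>"
  proof (rule comp_eqI)
    show "split_tensor C ob (?z @ ?y) ?w \<cdot> rearrange C ob (?w @ ?z @ ?y) vs
        = \<langle>rearrange C ob (?z @ ?y) vs, rearrange C ob ?w vs\<rangle>"
      by (rule split_tensor_rearrange[OF equalityD1[OF vs(1)] sub(1,3) d(2)])
  qed (use assms d sub V in \<open>simp_all add: hom_iff\<close>)
  moreover have "(split_tensor C ob ?y ?z \<otimes> \<i>\<d> (\<T> ?w)) \<cdot> \<langle>rearrange C ob (?z @ ?y) vs, rearrange C ob ?w vs\<rangle> \<cdot> \<omega>
      = marginal ?y ?z ?w vs \<cdot> \<omega>"
  proof (rule comp_eqI)
    have "split_tensor C ob ?y ?z \<cdot> rearrange C ob (?z @ ?y) vs = \<langle>rearrange C ob ?y vs, rearrange C ob ?z vs\<rangle>"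
      by (rule split_tensor_rearrange[OF equalityD1[OF vs(1)] sub(4,5) d(1)])
    then show "(split_tensor C ob ?y ?z \<otimes> \<i>\<d> (\<T> ?w)) \<cdot> \<langle>rearrange C ob (?z @ ?y) vs, rearrange C ob ?w vs\<rangle>
        = marginal ?y ?z ?w vs"
      using vs d sub V by (simp add: marginal_def)
  qed (use assms d sub V in \<open>simp_all add: hom_iff\<close>)
  ultimately show ?thesis
    unfolding marginal3_def Let_def by simp
qed

lemma cond_indep_if_splits:
  assumes vs: "set vs = V" "distinct vs" and disj: "Y \<inter> Z = {}" "Y \<inter> W = {}" "Z \<inter> W = {}"
    and \<omega>: "\<omega> \<in> hom \<I> (\<T> vs)"
    and "splits (tensor_set C ob vs Y) (tensor_set C ob vs Z) (tensor_set C ob vs W) (marginal3 C ob vs Y Z W \<omega>)"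
  shows "cond_indep C ob vs \<omega> Y Z W"
proof -
  define ys zs ws where "ys = restrict_list vs Y" and "zs = restrict_list vs Z" and "ws = restrict_list vs W"
  have l: "set ys \<subseteq> V" "set zs \<subseteq> V" "set ws \<subseteq> V" "distinct ys" "distinct zs" "distinct ws"
    using vs by (auto simp: ys_def zs_def ws_def)
  define N where "N = marginal3 C ob vs Y Z W \<omega>"
  have N: "N = marginal ys zs ws vs \<cdot> \<omega>"
    using marginal3_eq[OF vs disj \<omega>] by (simp add: N_def ys_def zs_def ws_def)
  \<comment> \<open>Both two-block marginals arise from \<open>N\<close> by discarding a block, the
    form in which \<open>splits_state_conditional\<close> delivers them.\<close>
  have YW: "(\<p>\<^sub>1 (\<T> ys) (\<T> zs) \<otimes> \<i>\<d> (\<T> ws)) \<cdot> N = marginal2 C ob vs Y W \<omega>"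
    unfolding N marginal2_eq[OF vs disj(2) \<omega>] using l \<omega> vs
    by (intro comp_eqI) (simp_all add: marginal_def hom_iff flip: ys_def ws_def)
  have ZW: "(\<p>\<^sub>2 (\<T> ys) (\<T> zs) \<otimes> \<i>\<d> (\<T> ws)) \<cdot> N = marginal2 C ob vs Z W \<omega>"
    unfolding N marginal2_eq[OF vs disj(3) \<omega>] using l \<omega> vs
    by (intro comp_eqI) (simp_all add: marginal_def hom_iff flip: zs_def ws_def)
  have "N \<in> hom \<I> ((\<T> ys \<boxtimes> \<T> zs) \<boxtimes> \<T> ws)" using l \<omega> vs by (simp add: N hom_iff)
  then have m: "marginal2 C ob vs Y W \<omega> \<in> hom \<I> (\<T> ys \<boxtimes> \<T> ws)" "marginal2 C ob vs Z W \<omega> \<in> hom \<I> (\<T> zs \<boxtimes> \<T> ws)"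
    using l by (simp_all add: hom_iff flip: YW ZW)
  have "splits (\<T> ys) (\<T> zs) (\<T> ws) N"
    using assms(7) by (simp add: N_def tensor_set_def ys_def zs_def ws_def)
  from splits_state_conditional[OF this] show ?thesis
    using m l unfolding YW ZW
    by (simp add: cond_indep_def cond_dist_pair_def cond_dist_def tensor_set_def pair_def
        flip: N_def ys_def zs_def ws_def)
qed

text \<open>Closes two gaps between the induction and the claim: \<open>A\<close> and
  \<open>B\<close> may exceed \<open>Y\<close> and \<open>Z\<close>, and the surplus is discarded by
  \<open>splits_post\<close>; \<open>W\<close> is listed in the order of \<open>rs\<close>, which
  \<open>splits_iso\<close> changes to that of \<open>vs\<close>.\<close>

lemma splits_restrict:
  assumes rs: "set rs = V" "distinct rs" and vs: "set vs = V" "distinct vs"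
    and s: "s \<in> hom \<I> (\<T> rs)" and sub: "Y \<subseteq> A" "Z \<subseteq> B"
    and split: "splits (\<T> (restrict_list rs A)) (\<T> (restrict_list rs B)) (\<T> (restrict_list rs W))
      (marginal (restrict_list rs A) (restrict_list rs B) (restrict_list rs W) rs \<cdot> s)"
  shows "splits (\<T> (restrict_list vs Y)) (\<T> (restrict_list vs Z)) (\<T> (restrict_list vs W))
    (marginal (restrict_list vs Y) (restrict_list vs Z) (restrict_list vs W) vs \<cdot> rearrange C ob vs rs \<cdot> s)"
proof -
  define as bs ws where "as = restrict_list rs A" and "bs = restrict_list rs B" and "ws = restrict_list rs W"
  define ys zs us where "ys = restrict_list vs Y" and "zs = restrict_list vs Z" and "us = restrict_list vs W"
  have l: "set as \<subseteq> V" "set bs \<subseteq> V" "set ws \<subseteq> V" "set ys \<subseteq> V" "set zs \<subseteq> V" "set us \<subseteq> V"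
    "distinct as" "distinct bs" "distinct ws" "distinct ys" "distinct zs" "distinct us"
    "set ys \<subseteq> set as" "set zs \<subseteq> set bs" "set us = set ws"
    using rs vs sub by (auto simp: as_def bs_def ws_def ys_def zs_def us_def)
  let ?p = "rearrange C ob us ws" and ?q = "rearrange C ob ws us"
  let ?f = "rearrange C ob ys as" and ?g = "rearrange C ob zs bs"
  have "splits (\<T> ys) (\<T> zs) (\<T> ws) (((?f \<otimes> ?g) \<otimes> \<i>\<d> (\<T> ws)) \<cdot> marginal as bs ws rs \<cdot> s)"
    using split l by (intro splits_post) (simp_all add: as_def bs_def ws_def hom_iff)
  then have "splits (\<T> ys) (\<T> zs) (\<T> us)
      ((\<i>\<d> (\<T> ys \<boxtimes> \<T> zs) \<otimes> ?p) \<cdot> ((?f \<otimes> ?g) \<otimes> \<i>\<d> (\<T> ws)) \<cdot> marginal as bs ws rs \<cdot> s)"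
    using l by (rule_tac q="?q" in splits_iso) (simp_all add: rearrange_comp rearrange_self hom_iff)
  also have "(\<i>\<d> (\<T> ys \<boxtimes> \<T> zs) \<otimes> ?p) \<cdot> ((?f \<otimes> ?g) \<otimes> \<i>\<d> (\<T> ws)) \<cdot> marginal as bs ws rs \<cdot> s
      = ((?f \<otimes> ?g) \<otimes> ?p) \<cdot> marginal as bs ws rs \<cdot> s"
    using l rs s by (simp add: hom_iff)
  also have "\<dots> = marginal ys zs us rs \<cdot> s"
    using l rs s by (intro comp_eqI) (simp_all add: hom_iff marginal_def rearrange_comp)
  also have "\<dots> = marginal ys zs us vs \<cdot> rearrange C ob vs rs \<cdot> s"
    using l rs vs s by (intro comp_eqI[symmetric]) (simp_all add: hom_iff marginal_def rearrange_comp)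
  finally show ?thesis unfolding ys_def zs_def us_def .
qed

lemma d_separated_cond_indep:
  assumes G: "finite_dag V E" and vs: "distinct vs" "set vs = V" and fac: "factorises C ob V E vs \<omega>"
    and disj: "Y \<inter> Z = {}" "Y \<inter> W = {}" "Z \<inter> W = {}" and sep: "d_separated E Y Z W"
  shows "cond_indep C ob vs \<omega> Y Z W"
proof -
  have E: "acyclic E" "E \<subseteq> V \<times> V" using G by (simp_all add: finite_dag_def)
  obtain c xs where c: "\<And>v. v \<in> V \<Longrightarrow> is_channel C (c v)"
      "\<And>v. v \<in> V \<Longrightarrow> c v \<in> hom (tensor_set C ob vs (parents E v)) (ob v)"
    and top: "topological_ordering V E xs"
    and \<omega>: "\<omega> = rearrange C ob vs (rev xs) \<cdot> network_state C ob E vs c (rev xs)"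
    using fac unfolding factorises_def by blast
  obtain A B where AB: "Y \<subseteq> A" "Z \<subseteq> B" "A \<inter> B = {}" "A \<inter> W = {}" "B \<inter> W = {}"
    "\<And>v. v \<in> A \<Longrightarrow> parents E v \<subseteq> A \<union> W" "\<And>v. v \<in> B \<Longrightarrow> parents E v \<subseteq> B \<union> W"
    "\<And>v. v \<in> W \<Longrightarrow> parents E v \<subseteq> A \<union> W \<or> parents E v \<subseteq> B \<union> W"
    using d_separated_partition[OF E(1) sep disj(2,3)] by blast
  let ?rs = "rev xs"
  have rs: "set ?rs = V" "distinct ?rs" "sorted_wrt (\<lambda>x y. (x, y) \<notin> E) ?rs"
    using top by (simp_all add: topological_ordering_def sorted_wrt_rev)
  have parents: "parents E v \<subseteq> set ?rs" for v using E(2) rs(1) by (auto simp: parents_def)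
  note split = network_splits[OF E vs c AB(3-8) equalityD1[OF rs(1)] rs(2,3) parents]
  have s: "network_state C ob E vs c ?rs \<in> hom \<I> (\<T> ?rs)" using split by blast
  have \<omega>_in: "\<omega> \<in> hom \<I> (\<T> vs)" using s rs vs by (simp add: \<omega> hom_iff)
  have "splits (tensor_set C ob vs Y) (tensor_set C ob vs Z) (tensor_set C ob vs W) (marginal3 C ob vs Y Z W \<omega>)"
    unfolding marginal3_eq[OF vs(2,1) disj \<omega>_in] tensor_set_def
    using splits_restrict[OF rs(1,2) vs(2,1) s AB(1,2) conjunct2[OF split]] by (simp add: \<omega>)
  then show ?thesis by (rule cond_indep_if_splits[OF vs(2,1) disj \<omega>_in])
qed

end

theorem theorem3p20:
  fixes C :: "('o, 'm, 'z) cd_ec_scheme"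
    and V :: "'v set" and E :: "('v \<times> 'v) set"
    and ob :: "'v \<Rightarrow> 'o" and vs :: "'v list" and \<omega> :: 'm
    and Y Z W :: "'v set"
  assumes "effect_conditioning C"
    and "finite_dag V E"
    and "\<forall>v\<in>V. ob v \<in> Obj C"
    and "distinct vs" and "set vs = V"
    and "normalised_state C (tensor_list C ob vs) \<omega>"
    and "factorises C ob V E vs \<omega>"
    and "Y \<subseteq> V" and "Z \<subseteq> V" and "W \<subseteq> V"
    and "Y \<inter> Z = {}" and "Y \<inter> W = {}" and "Z \<inter> W = {}"
    and "d_separated E Y Z W"
  shows "cond_indep C ob vs \<omega> Y Z W"
proof -
  interpret effect_conditioning C by fact
  interpret variable_family C ob V by unfold_locales (use assms(3) in blast)
  show ?thesis using assms by (intro d_separated_cond_indep)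
qed

end
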